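(* Let $e>1$ be odd, $t\ge0$, $\mathbf c=(t+(1-e)/2,0)$. Let $\lambda$ be a partition with $2$-core $\Delta_t$ and put $\mu=\bar\lambda^{(2)}$. Assume $|\mu,\mathbf c\rangle$ is a highest weight vertex of $\mathcal G_{\mathbf c,e}$; then the $e$-core of $\lambda$ is a $2$-core $\Delta_s$ for some $s\ge0$. Put $\mathbf s=(s+(1-e)/2,0)$. Then there is a graph isomorphism between the connected component $B(\mu,\mathbf c)$ of $\mathcal G_{\mathbf c,e}$ containing $|\mu,\mathbf c\rangle$ and the connected component $B((\emptyset,\emptyset),\mathbf s)$ of $\mathcal G_{\mathbf s,e}$ containing $|(\emptyset,\emptyset),\mathbf s\rangle$, up to a shift of the labels of the arrows (i.e. there is $d\in\mathbb Z$ such that edges of colour $i$ correspond to edges of colour $i+d\bmod e$).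
   Context: Crystal graph $\mathcal G_{\mathbf d,e}$ ($\mathbf d=(d_1,d_2)\in\mathbb Z^2$): vertices $|\nu,\mathbf d\rangle$, $\nu$ a bipartition; nodes $(a,b,j)$ of $\nu^j$ (row $a$, column $b$) have content $b-a+d_j$ and residue content mod $e$; for residue $i$ order addable and removable $i$-nodes by increasing content, ties broken with larger $j$ first, form the word in $A$ (addable)/$R$ (removable), cancel consecutive $RA$ recursively to get $A^\alpha R^\beta$; the good addable $i$-node is that of the rightmost $A$; edge $|\nu,\mathbf d\rangle\xrightarrow{i}|\nu',\mathbf d\rangle$ iff $\nu'$ is $\nu$ plus its good addable $i$-node. Highest weight vertex: no incoming edges. $\Delta_t=(t,\dots,1)$. For a partition $\lambda$ with $\beta$-set $B$ of odd size, $\lambda^{(2)}=(\pi\{x/2:x\in B\text{ even}\},\pi\{(x-1)/2:x\in B\text{ odd}\})$, $\pi(X)$ the partition with $\beta$-set $X$; if $\lambda$ has $2$-core $\Delta_t$, $\bar\lambda^{(2)}=\lambda^{(2)}$ for $t$ even and the swapped pair for $t$ odd. *)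

theory Defs
  imports Main "HOL-Library.Product_Lexorder"
begin

definition is_partition :: "nat list \<Rightarrow> bool" where
  "is_partition l \<longleftrightarrow> sorted_wrt (\<ge>) l \<and> 0 \<notin> set l"

definition diag :: "nat list \<Rightarrow> (nat \<times> nat) set" where
  "diag l = {(a, b). 1 \<le> a \<and> a \<le> length l \<and> 1 \<le> b \<and> b \<le> l ! (a - 1)}"

definition addable :: "nat list \<Rightarrow> nat \<times> nat \<Rightarrow> bool" where
  "addable l x \<longleftrightarrow> x \<notin> diag l \<and> (\<exists>l'. is_partition l' \<and> diag l' = insert x (diag l))"

definition removable :: "nat list \<Rightarrow> nat \<times> nat \<Rightarrow> bool" where
  "removable l x \<longleftrightarrow> x \<in> diag l \<and> (\<exists>l'. is_partition l' \<and> diag l' = diag l - {x})"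

type_synonym bipartition = "nat list \<times> nat list"
type_synonym bnode = "nat \<times> nat \<times> nat"   \<comment> \<open>(row a, column b, component j \<in> {1,2})\<close>

definition is_bipartition :: "bipartition \<Rightarrow> bool" where
  "is_bipartition \<nu> \<longleftrightarrow> is_partition (fst \<nu>) \<and> is_partition (snd \<nu>)"

definition comp_of :: "bipartition \<Rightarrow> nat \<Rightarrow> nat list" where
  "comp_of \<nu> j = (if j = 1 then fst \<nu> else snd \<nu>)"

definition bnodes :: "bipartition \<Rightarrow> bnode set" where
  "bnodes \<nu> = {(a, b, j). j \<in> {1, 2} \<and> (a, b) \<in> diag (comp_of \<nu> j)}"

definition baddable :: "bipartition \<Rightarrow> bnode \<Rightarrow> bool" where
  "baddable \<nu> x \<longleftrightarrow> (case x of (a, b, j) \<Rightarrow> j \<in> {1, 2} \<and> addable (comp_of \<nu> j) (a, b))"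

definition bremovable :: "bipartition \<Rightarrow> bnode \<Rightarrow> bool" where
  "bremovable \<nu> x \<longleftrightarrow> (case x of (a, b, j) \<Rightarrow> j \<in> {1, 2} \<and> removable (comp_of \<nu> j) (a, b))"

definition content :: "int \<times> int \<Rightarrow> bnode \<Rightarrow> int" where
  "content d x = (case x of (a, b, j) \<Rightarrow> int b - int a + (if j = 1 then fst d else snd d))"

definition residue :: "nat \<Rightarrow> int \<times> int \<Rightarrow> bnode \<Rightarrow> int" where
  "residue e d x = content d x mod int e"

definition inodes :: "nat \<Rightarrow> int \<times> int \<Rightarrow> int \<Rightarrow> bipartition \<Rightarrow> (bnode \<times> bool) set" where
  "inodes e d i \<nu> =
     {(x, True) | x. baddable \<nu> x \<and> residue e d x = i} \<union>
     {(x, False) | x. bremovable \<nu> x \<and> residue e d x = i}"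

definition iword :: "nat \<Rightarrow> int \<times> int \<Rightarrow> int \<Rightarrow> bipartition \<Rightarrow> (bnode \<times> bool) list" where
  "iword e d i \<nu> =
     sort_key (\<lambda>(x, _). (content d x, - int (snd (snd x)))) (sorted_list_of_set (inodes e d i \<nu>))"

text \<open>Recursive cancellation of adjacent factors RA; the result has the form A^alpha R^beta.\<close>
fun cancelRA :: "('a \<times> bool) list \<Rightarrow> ('a \<times> bool) list" where
  "cancelRA [] = []"
| "cancelRA (x # xs) =
     (let ys = cancelRA xs in
      if \<not> snd x \<and> ys \<noteq> [] \<and> snd (hd ys) then tl ys else x # ys)"

definition good_add :: "nat \<Rightarrow> int \<times> int \<Rightarrow> int \<Rightarrow> bipartition \<Rightarrow> bnode option" where
  "good_add e d i \<nu> =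
     (let as = filter snd (cancelRA (iword e d i \<nu>))
      in if as = [] then None else Some (fst (last as)))"

definition crys_edge :: "nat \<Rightarrow> int \<times> int \<Rightarrow> bipartition \<Rightarrow> int \<Rightarrow> bipartition \<Rightarrow> bool" where
  "crys_edge e d \<nu> i \<nu>' \<longleftrightarrow>
     is_bipartition \<nu> \<and> is_bipartition \<nu>' \<and> 0 \<le> i \<and> i < int e \<and>
     (\<exists>x. good_add e d i \<nu> = Some x \<and> bnodes \<nu>' = insert x (bnodes \<nu>))"

definition highest_weight :: "nat \<Rightarrow> int \<times> int \<Rightarrow> bipartition \<Rightarrow> bool" where
  "highest_weight e d \<nu> \<longleftrightarrow> is_bipartition \<nu> \<and> \<not> (\<exists>\<nu>' i. crys_edge e d \<nu>' i \<nu>)"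

definition component :: "nat \<Rightarrow> int \<times> int \<Rightarrow> bipartition \<Rightarrow> bipartition set" where
  "component e d \<nu> =
     {\<nu>'. (\<lambda>x y. \<exists>i. crys_edge e d x i y \<or> crys_edge e d y i x)\<^sup>*\<^sup>* \<nu> \<nu>'}"

definition part_at :: "nat list \<Rightarrow> nat \<Rightarrow> nat" where
  "part_at l i = (if 1 \<le> i \<and> i \<le> length l then l ! (i - 1) else 0)"

text \<open>beta-set of size N (N \<ge> length l): {l_i + N - i : 1 \<le> i \<le> N}.\<close>
definition beta :: "nat \<Rightarrow> nat list \<Rightarrow> nat set" where
  "beta N l = {part_at l i + N - i | i. 1 \<le> i \<and> i \<le> N}"

text \<open>Removal of a rim e-hook, in the abacus formulation: move a bead x to x-e.\<close>
definition hook_removal :: "nat \<Rightarrow> nat list \<Rightarrow> nat list \<Rightarrow> bool" where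
  "hook_removal e l k \<longleftrightarrow> is_partition l \<and> is_partition k \<and>
     (\<exists>N x. length l \<le> N \<and> length k \<le> N \<and> x \<in> beta N l \<and> e \<le> x \<and>
            x - e \<notin> beta N l \<and> beta N k = insert (x - e) (beta N l - {x}))"

definition is_core :: "nat \<Rightarrow> nat list \<Rightarrow> nat list \<Rightarrow> bool" where
  "is_core e l k \<longleftrightarrow> (hook_removal e)\<^sup>*\<^sup>* l k \<and> \<not> (\<exists>k'. hook_removal e k k')"

definition stair :: "nat \<Rightarrow> nat list" where
  "stair t = rev [1..<t + 1]"

text \<open>pi(X): the partition with beta-set X.\<close>
definition pi_beta :: "nat set \<Rightarrow> nat list" where
  "pi_beta X = (let xs = rev (sorted_list_of_set X); m = length xs in
                filter (\<lambda>p. p \<noteq> 0) (map (\<lambda>k. xs ! k + k + 1 - m) [0..<m]))"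

definition quot2 :: "nat list \<Rightarrow> bipartition" where
  "quot2 l = (let B = beta (2 * length l + 1) l in
              (pi_beta {x div 2 | x. x \<in> B \<and> even x}, pi_beta {(x - 1) div 2 | x. x \<in> B \<and> odd x}))"

text \<open>bar lambda^(2) for lambda with 2-core Delta_t.\<close>
definition quot2_bar :: "nat \<Rightarrow> nat list \<Rightarrow> bipartition" where
  "quot2_bar t l = (if even t then quot2 l else (snd (quot2 l), fst (quot2 l)))"

end

theory Submission
  imports Defs
begin

text \<open>
The crystal of charged bipartitions is studied on its beads: a bead of charged content \<open>c\<close> in component
\<open>j\<close> is placed at \<open>2 c + [j = 1]\<close>, so that the order used for the signature words is the order of the
integers and an arrow moves a bead from \<open>p - 2\<close> to \<open>p\<close>, where \<open>p\<close> is the first place at which the prefix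
sums of the signature attain their maximum. For two adjacent colours these prefix sums interact in a
very simple way, and comparing first maxima yields Stembridge's local axioms. (As \<open>e\<close> is odd, \<open>e \<ge> 3\<close>, and
the Cartan matrix is simply laced.) These axioms force the component of a highest weight vertex to be
determined by its weight.

The beads of \<open>\<lambda>\<close> are the beads of its quotient up to a bijection of the integers under which residue
classes of contents correspond to residue classes of beads modulo \<open>e\<close>. Hence the weight of a vertex only
depends on the \<open>e\<close>-core of \<open>\<lambda>\<close>. The weight of a highest weight vertex is dominant, which says that the bead
set of the \<open>e\<close>-core is closed under subtracting 2, i.e. that the \<open>e\<close>-core is some \<open>\<Delta>\<^sub>s\<close>; and \<open>\<Delta>\<^sub>s\<close> has the
empty bipartition as its quotient.
\<close>

section \<open>Abstract crystals with Stembridge's axioms\<close>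

text \<open>The pairing \<open>rel\<close> matches vertices reached from the two sources by the same
  word of colours. The obstacle is its independence of the word: two words ending in the same vertex
  of one crystal must end in the same vertex of the other. Whether two arrows close to a square or
  to an octagon is read off from string lengths, so equality of \<open>eps\<close> has to be carried
  through the same induction on levels. The charge t + (1-e)/2 is chosen so that, in both
  components, a bead of content c comes from a bead of \<lambda> at a place congruent to 2c - t
  modulo e: an even place \<kappa> goes to \<kappa> - t, an odd one to \<kappa> - t + e - 1. As 2 is
  invertible modulo the odd number e, the weight of colour i is a number attached to the class of 2i
  - t, and removing a rim e-hook does not change it. Equating 2i - t with 2(i + k) - s modulo e
  gives the shift of labels k = (s - t)(e + 1)/2.\<close>

locale crystal =
  fixes V :: "'a set" and I :: "'i set"
    and edge :: "'i \<Rightarrow> 'a \<Rightarrow> 'a \<Rightarrow> bool"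
    and eps :: "'i \<Rightarrow> 'a \<Rightarrow> nat" and wt :: "'i \<Rightarrow> 'a \<Rightarrow> int"
    and cartan :: "'i \<Rightarrow> 'i \<Rightarrow> int"
  assumes edge_in: "edge i x y \<Longrightarrow> i \<in> I \<and> x \<in> V \<and> y \<in> V"
    and edge_fun: "edge i x y \<Longrightarrow> edge i x y' \<Longrightarrow> y = y'"
    and edge_inj: "edge i x y \<Longrightarrow> edge i x' y \<Longrightarrow> x = x'"
    and phi_pos: "x \<in> V \<Longrightarrow> i \<in> I \<Longrightarrow> (\<exists>y. edge i x y) \<longleftrightarrow> int (eps i x) + wt i x > 0"
    and eps_pos: "x \<in> V \<Longrightarrow> i \<in> I \<Longrightarrow> (\<exists>y. edge i y x) \<longleftrightarrow> eps i x > 0"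
    and eps_step: "edge i x y \<Longrightarrow> eps i y = Suc (eps i x)"
    and wt_step: "edge i x y \<Longrightarrow> j \<in> I \<Longrightarrow> wt j y = wt j x - cartan i j"
begin

text \<open>In the intended instances \<open>eps + wt\<close> is \<phi>, the length of the outgoing
  string of a colour; it is expressed through \<open>eps\<close> and \<open>wt\<close>, the two
  quantities that are tracked along arrows.\<close>

definition both_inc :: "'i \<Rightarrow> 'i \<Rightarrow> 'a \<Rightarrow> 'a \<Rightarrow> 'a \<Rightarrow> bool" where
  "both_inc i j x y z \<longleftrightarrow>
     int (eps j y) + wt j y = int (eps j x) + wt j x + 1 \<and>
     int (eps i z) + wt i z = int (eps i x) + wt i x + 1"

end

text \<open>Stembridge's local axioms for a simply laced crystal: two arrows leaving a vertex close up to a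
  square or to an octagon according to whether each arrow lengthens the string of the other colour.\<close>

locale stembridge = crystal +
  assumes square: "edge i x y \<Longrightarrow> edge j x z \<Longrightarrow> i \<noteq> j \<Longrightarrow> \<not> both_inc i j x y z \<Longrightarrow>
      \<exists>w. edge j y w \<and> edge i z w"
    and octagon: "edge i x y \<Longrightarrow> edge j x z \<Longrightarrow> i \<noteq> j \<Longrightarrow> both_inc i j x y z \<Longrightarrow>
      \<exists>y1 y2 z1 z2 w. edge j y y1 \<and> edge j y1 y2 \<and> edge i y2 w \<and>
                      edge i z z1 \<and> edge i z1 z2 \<and> edge j z2 w"
    and no_square: "edge i x y \<Longrightarrow> edge j x z \<Longrightarrow> i \<noteq> j \<Longrightarrow> edge j y w \<Longrightarrow> edge i z w \<Longrightarrow>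
      \<not> both_inc i j x y z"
    and below: "edge i y x \<Longrightarrow> edge j z x \<Longrightarrow> i \<noteq> j \<Longrightarrow>
      (\<exists>w. edge j w y \<and> edge i w z) \<or>
      (\<exists>y1 y2 z1 z2 w. edge j y1 y \<and> edge j y2 y1 \<and> edge i w y2 \<and>
                       edge i z1 z \<and> edge i z2 z1 \<and> edge j w z2)"
begin

section \<open>Directed reachability from a highest weight vertex\<close>

primrec reach :: "'a \<Rightarrow> nat \<Rightarrow> 'a \<Rightarrow> bool" where
  "reach x0 0 y = (y = x0)"
| "reach x0 (Suc n) y = (\<exists>i x. reach x0 n x \<and> edge i x y)"

lemma reach_step: "reach x0 n x \<Longrightarrow> edge i x y \<Longrightarrow> reach x0 (Suc n) y"
  by auto

text \<open>A second arrow into the same vertex is closed up from below; the vertices met on the way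
  down lie at smaller levels, and the other side of the diamond leads back up to \<open>z\<close>.
  The octagon goes down several levels before climbing, hence the strong induction.\<close>

lemma reach_below:
  assumes hw: "\<And>i y. \<not> edge i y x0"
  shows "reach x0 n y \<Longrightarrow> edge j z y \<Longrightarrow> \<exists>m. n = Suc m \<and> reach x0 m z"
proof (induction n arbitrary: y j z rule: less_induct)
  case (less n)
  show ?case
  proof (cases n)
    case 0
    with less.prems hw show ?thesis by auto
  next
    case (Suc m)
    then obtain i x where x: "reach x0 m x" "edge i x y"
      using less.prems(1) by auto
    note IH = less.IH[unfolded Suc]
    show ?thesis
    proof (cases "i = j")
      case True
      with x less.prems(2) have "z = x" using edge_inj by blast
      with x Suc show ?thesis by simp
    next
      case False
      from below[OF x(2) less.prems(2) False] show ?thesis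
      proof (elim disjE exE conjE)
        fix w assume w: "edge j w x" "edge i w z"
        from IH[OF _ x(1) w(1)] obtain k where "m = Suc k" "reach x0 k w" by auto
        with w Suc show ?thesis by auto
      next
        fix y1 y2 z1 z2 w
        assume w: "edge j y1 x" "edge j y2 y1" "edge i w y2" "edge i z1 z" "edge i z2 z1" "edge j w z2"
        from IH[OF _ x(1) w(1)] obtain k1 where k1: "m = Suc k1" "reach x0 k1 y1" by auto
        from IH[OF _ k1(2) w(2)] k1(1) obtain k2 where k2: "k1 = Suc k2" "reach x0 k2 y2" by auto
        from IH[OF _ k2(2) w(3)] k2(1) k1(1) obtain k3 where k3: "k2 = Suc k3" "reach x0 k3 w" by auto
        from k3(2) w have "reach x0 (Suc (Suc (Suc k3))) z"
          by (intro reach_step[OF reach_step[OF reach_step]])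
        with k1 k2 k3 Suc show ?thesis by auto
      qed
    qed
  qed
qed

lemma reach_level_unique:
  assumes hw: "\<And>i y. \<not> edge i y x0"
  shows "reach x0 n y \<Longrightarrow> reach x0 m y \<Longrightarrow> n = m"
proof (induction n arbitrary: y m)
  case 0
  with hw show ?case by (cases m) auto
next
  case (Suc n)
  then obtain i x where x: "reach x0 n x" "edge i x y" by auto
  from reach_below[OF hw Suc.prems(2) x(2)] obtain k where "m = Suc k" "reach x0 k x" by auto
  with Suc.IH[OF x(1)] show ?case by simp
qed

text \<open>By \<open>reach_below\<close> the directed descendants of a highest weight vertex are
  closed under predecessors, so an undirected path cannot leave them.\<close>

lemma component_eq_reach:
  assumes hw: "\<And>i y. \<not> edge i y x0"
  shows "{y. (\<lambda>x y. \<exists>i. edge i x y \<or> edge i y x)\<^sup>*\<^sup>* x0 y} = {y. \<exists>n. reach x0 n y}"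
proof -
  have "\<exists>n. reach x0 n y" if "(\<lambda>x y. \<exists>i. edge i x y \<or> edge i y x)\<^sup>*\<^sup>* x0 y" for y
    using that
  proof (induction rule: rtranclp_induct)
    case base
    have "reach x0 0 x0" by simp
    then show ?case by blast
  next
    case (step y z)
    then obtain n i where n: "reach x0 n y" "edge i y z \<or> edge i z y" by auto
    then show ?case using reach_below[OF hw n(1)] reach_step[OF n(1)] by metis
  qed
  moreover have "(\<lambda>x y. \<exists>i. edge i x y \<or> edge i y x)\<^sup>*\<^sup>* x0 y" if "reach x0 n y" for n y
    using that
  proof (induction n arbitrary: y)
    case (Suc n)
    then obtain i x where "reach x0 n x" "edge i x y" by auto
    with Suc.IH[of x] show ?case by (auto intro: rtranclp.rtrancl_into_rtrancl)
  qed simp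
  ultimately show ?thesis by blast
qed

end

section \<open>Two crystals whose highest weight vertices have equal weights\<close>

locale stembridge_pair =
  A: stembridge V I edge eps wt cartan + B: stembridge V' I edge' eps' wt' cartan
  for V :: "'a set" and I :: "'i set" and edge eps wt cartan
    and V' :: "'b set" and edge' eps' wt' +
  fixes x0 :: 'a and x0' :: 'b
  assumes x0_in: "x0 \<in> V" and x0'_in: "x0' \<in> V'"
    and hw: "\<not> edge i y x0" and hw': "\<not> edge' i y' x0'"
    and same_wt: "i \<in> I \<Longrightarrow> wt i x0 = wt' i x0'"
begin

primrec rel :: "nat \<Rightarrow> 'a \<Rightarrow> 'b \<Rightarrow> bool" where
  "rel 0 x x' = (x = x0 \<and> x' = x0')"
| "rel (Suc n) y y' = (\<exists>i x x'. rel n x x' \<and> edge i x y \<and> edge' i x' y')"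

definition same_eps :: "nat \<Rightarrow> bool" where
  "same_eps n \<longleftrightarrow> (\<forall>x x'. rel n x x' \<longrightarrow> (\<forall>i\<in>I. eps i x = eps' i x'))"

definition functional :: "nat \<Rightarrow> bool" where
  "functional n \<longleftrightarrow> (\<forall>x x' y'. rel n x x' \<longrightarrow> rel n x y' \<longrightarrow> x' = y')"

definition total :: "nat \<Rightarrow> bool" where
  "total n \<longleftrightarrow> (\<forall>x. A.reach x0 n x \<longrightarrow> (\<exists>x'. rel n x x'))"

definition good :: "nat \<Rightarrow> bool" where
  "good n \<longleftrightarrow> same_eps n \<and> functional n \<and> total n"

lemma rel_in: "rel n x x' \<Longrightarrow> x \<in> V \<and> x' \<in> V'"
  by (cases n) (auto simp: x0_in x0'_in dest: A.edge_in B.edge_in)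

lemma rel_reach: "rel n x x' \<Longrightarrow> A.reach x0 n x \<and> B.reach x0' n x'"
  by (induction n arbitrary: x x') auto

lemma rel_wt: "rel n x x' \<Longrightarrow> i \<in> I \<Longrightarrow> wt i x = wt' i x'"
proof (induction n arbitrary: x x')
  case 0
  then show ?case using same_wt by simp
next
  case (Suc n)
  then obtain j y y' where "rel n y y'" "edge j y x" "edge' j y' x'" by auto
  with Suc show ?case using A.wt_step B.wt_step by metis
qed

text \<open>Equal \<open>eps\<close> and equal weights give equal \<phi>, and its positivity decides
  whether an arrow leaves.\<close>

lemma lift_edge_ex:
  assumes "same_eps n" "rel n x x'" "edge i x y"
  shows "\<exists>y'. edge' i x' y' \<and> rel (Suc n) y y'"
proof -
  have i: "i \<in> I" and "x \<in> V" "x' \<in> V'" using A.edge_in assms(3) rel_in[OF assms(2)] by auto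
  then have "int (eps i x) + wt i x > 0" using A.phi_pos assms(3) by blast
  moreover have "eps i x = eps' i x'" using assms(1,2) i by (simp add: same_eps_def)
  ultimately have "\<exists>y'. edge' i x' y'"
    using B.phi_pos[OF \<open>x' \<in> V'\<close> i] rel_wt[OF assms(2) i] by simp
  with assms show ?thesis by auto
qed

lemma lift_edge:
  assumes "same_eps n" "functional (Suc n)" "rel n x x'" "edge i x y" "rel (Suc n) y y'"
  shows "edge' i x' y'"
  using lift_edge_ex[OF assms(1,3,4)] assms(2,5) unfolding functional_def by blast

lemma both_inc_transfer:
  assumes "same_eps n" "same_eps m" "rel n x x'" "rel m y y'" "rel m z z'" "i \<in> I" "j \<in> I"
  shows "B.both_inc i j x' y' z' \<longleftrightarrow> A.both_inc i j x y z"
proof -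
  have "eps k x = eps' k x'" "eps k y = eps' k y'" "eps k z = eps' k z'" if "k \<in> I" for k
    using assms that unfolding same_eps_def by blast+
  then show ?thesis
    unfolding A.both_inc_def B.both_inc_def
    using rel_wt[OF assms(3)] rel_wt[OF assms(4)] rel_wt[OF assms(5)] assms(6,7) by simp
qed

text \<open>The diamond below \<open>x\<close> and \<open>z\<close> has its vertices at levels
  already known to be good. It is rebuilt in the second crystal from its bottom vertex upwards: its
  shape is decided by string lengths, which agree on both sides, and since arrows are deterministic
  the copy must pass through \<open>x'\<close>, \<open>z'\<close> and end in
  \<open>y'\<close>.\<close>

lemma lift_confluence:
  assumes good: "\<And>m. m \<le> n \<Longrightarrow> good m"
    and x: "rel n x x'" "edge i x y" "edge' i x' y'"
    and z: "rel n z z'" "edge j z y"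
  shows "edge' j z' y'"
proof (cases "i = j")
  case True
  then have "x = z" using A.edge_inj x z by blast
  then have "x' = z'" using good[of n] x z by (auto simp: good_def functional_def)
  with True x show ?thesis by simp
next
  case False
  have ij: "i \<in> I" "j \<in> I" using A.edge_in x z by blast+
  have sq: ?thesis if w: "edge j w x" "edge i w z" for w
  proof -
    obtain m where m: "n = Suc m" "A.reach x0 m w"
      using A.reach_below[OF hw _ w(1)] rel_reach[OF x(1)] by blast
    note g = good[of m] good[of n]
    obtain w' where w': "rel m w w'" using m g by (auto simp: good_def total_def)
    have e: "edge' j w' x'" "edge' i w' z'"
      using lift_edge[OF _ _ w' w(1)] lift_edge[OF _ _ w' w(2)] g m x z by (auto simp: good_def)
    \<comment> \<open>A square in the first crystal excludes the octagon condition; the condition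
      transfers, so the second crystal has a square here too.\<close>
    have "\<not> A.both_inc j i w x z" using A.no_square[OF w(1,2) False[symmetric] x(2) z(2)] .
    then have "\<not> B.both_inc j i w' x' z'"
      using both_inc_transfer[OF _ _ w' x(1) z(1)] g m ij by (auto simp: good_def)
    from B.square[OF e False[symmetric] this] obtain u where "edge' i x' u" "edge' j z' u" by blast
    with x(3) B.edge_fun show ?thesis by blast
  qed
  from A.below[OF x(2) z(2) False] show ?thesis
  proof (elim disjE exE conjE)
    fix w assume "edge j w x" "edge i w z"
    then show ?thesis by (rule sq)
  next
    fix y1 y2 z1 z2 w
    assume w: "edge j y1 x" "edge j y2 y1" "edge i w y2" "edge i z1 z" "edge i z2 z1" "edge j w z2"
    show ?thesis
    proof (cases "A.both_inc i j w y2 z2")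
      \<comment> \<open>\<open>below\<close> does not promise that its octagon is a genuine one. If
        the condition fails at \<open>w\<close>, the square above \<open>w\<close> identifies
        \<open>y1\<close> with \<open>z1\<close>, and this vertex is the bottom of a square with top
        \<open>y\<close>.\<close>
      case False
      from A.square[OF w(3,6) \<open>i \<noteq> j\<close> False] obtain u where "edge j y2 u" "edge i z2 u" by blast
      then have "y1 = z1" using w A.edge_fun by metis
      then show ?thesis using w sq by blast
    next
      case True
      obtain k1 where k1: "n = Suc k1" "A.reach x0 k1 y1"
        using A.reach_below[OF hw _ w(1)] rel_reach[OF x(1)] by blast
      obtain k2 where k2: "k1 = Suc k2" "A.reach x0 k2 y2"
        using A.reach_below[OF hw k1(2) w(2)] by blast
      obtain k where k: "k2 = Suc k" "A.reach x0 k w"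
        using A.reach_below[OF hw k2(2) w(3)] by blast
      have g: "good k" "good (Suc k)" "good (Suc (Suc k))" "good (Suc (Suc (Suc k)))"
        and n: "n = Suc (Suc (Suc k))"
        using good k1 k2 k by auto
      obtain w' where w': "rel k w w'" using k g by (auto simp: good_def total_def)
      have se: "same_eps k" "same_eps (Suc k)" "same_eps (Suc (Suc k))" using g by (auto simp: good_def)
      obtain y2' where y2': "edge' i w' y2'" "rel (Suc k) y2 y2'"
        using lift_edge_ex[OF se(1) w' w(3)] by blast
      obtain z2' where z2': "edge' j w' z2'" "rel (Suc k) z2 z2'"
        using lift_edge_ex[OF se(1) w' w(6)] by blast
      obtain y1' where y1': "edge' j y2' y1'" "rel (Suc (Suc k)) y1 y1'"
        using lift_edge_ex[OF se(2) y2'(2) w(2)] by blast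
      obtain z1' where z1': "edge' i z2' z1'" "rel (Suc (Suc k)) z1 z1'"
        using lift_edge_ex[OF se(2) z2'(2) w(5)] by blast
      have x': "edge' j y1' x'"
        using lift_edge[OF se(3) _ y1'(2) w(1)] g x n by (auto simp: good_def)
      have z': "edge' i z1' z'"
        using lift_edge[OF se(3) _ z1'(2) w(4)] g z n by (auto simp: good_def)
      have "B.both_inc i j w' y2' z2'"
        using both_inc_transfer[OF se(1,2) w' y2'(2) z2'(2) ij] True by simp
      from B.octagon[OF y2'(1) z2'(1) \<open>i \<noteq> j\<close> this] obtain a1 a2 b1 b2 u where
        u: "edge' j y2' a1" "edge' j a1 a2" "edge' i a2 u"
           "edge' i z2' b1" "edge' i b1 b2" "edge' j b2 u" by blast
      have "a1 = y1'" using B.edge_fun[OF u(1) y1'(1)] .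
      then have "a2 = x'" using B.edge_fun[OF _ x'] u(2) by simp
      then have "u = y'" using B.edge_fun[OF _ x(3)] u(3) by simp
      have "b1 = z1'" using B.edge_fun[OF u(4) z1'(1)] .
      then have "b2 = z'" using B.edge_fun[OF _ z'] u(5) by simp
      with u(6) \<open>u = y'\<close> show ?thesis by simp
    qed
  qed
qed

lemma total_Suc:
  assumes "good n"
  shows "total (Suc n)"
  unfolding total_def
proof (intro allI impI)
  fix y assume "A.reach x0 (Suc n) y"
  then obtain i x where x: "A.reach x0 n x" "edge i x y" by auto
  with assms obtain x' where "rel n x x'" unfolding good_def total_def by blast
  with lift_edge_ex[OF _ this x(2)] assms show "\<exists>y'. rel (Suc n) y y'" unfolding good_def by blast
qed

lemma functional_Suc:
  assumes good: "\<And>m. m \<le> n \<Longrightarrow> good m"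
  shows "functional (Suc n)"
  unfolding functional_def
proof (intro allI impI)
  fix y y' u' assume "rel (Suc n) y y'" "rel (Suc n) y u'"
  then obtain i x x' j z z' where
    "rel n x x'" "edge i x y" "edge' i x' y'" "rel n z z'" "edge j z y" "edge' j z' u'" by auto
  with lift_confluence[OF good] show "y' = u'" using B.edge_fun by blast
qed

text \<open>A positive \<open>eps j y\<close> is witnessed by an arrow entering \<open>y\<close>.
  \<open>lift_confluence\<close> carries this arrow to the second crystal, and one level lower the
  values agree. Where the value is 0, the same statement with the crystals exchanged is
  used.\<close>

lemma eps_Suc:
  assumes good: "\<And>m. m \<le> n \<Longrightarrow> good m"
    and rel: "rel (Suc n) y y'" and j: "j \<in> I" and pos: "eps j y > 0"
  shows "eps j y = eps' j y'"
proof -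
  obtain i x x' where x: "rel n x x'" "edge i x y" "edge' i x' y'" using rel by auto
  obtain z where z: "edge j z y" using A.eps_pos[OF _ j] rel_in[OF rel] pos by blast
  then have "A.reach x0 n z" using A.reach_below[OF hw _ z] rel_reach[OF rel] by blast
  then obtain z' where z': "rel n z z'" using good[of n] by (auto simp: good_def total_def)
  have "edge' j z' y'" using lift_confluence[OF good x z' z] by simp
  then have "eps' j y' = Suc (eps' j z')" by (rule B.eps_step)
  moreover have "eps j y = Suc (eps j z)" using z by (rule A.eps_step)
  moreover have "eps j z = eps' j z'" using good[of n] z' j by (auto simp: good_def same_eps_def)
  ultimately show ?thesis by simp
qed

lemma isomorphism:
  shows "\<exists>f. bij_betw f {y. \<exists>n. A.reach x0 n y} {y. \<exists>n. B.reach x0' n y} \<and>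
    (\<forall>x\<in>{y. \<exists>n. A.reach x0 n y}. \<forall>y\<in>{y. \<exists>n. A.reach x0 n y}. \<forall>i.
      edge i x y \<longleftrightarrow> edge' i (f x) (f y))"
proof -
  \<comment> \<open>The same pair with its roles exchanged. It yields injectivity and surjectivity
    of the map, and equality of \<open>eps\<close> at vertices where only the second value is known
    to be positive.\<close>
  interpret S: stembridge_pair V' I edge' eps' wt' cartan V edge eps wt x0' x0
    by unfold_locales (auto simp: x0_in x0'_in hw hw' same_wt)
  have sym: "S.rel n x' x \<longleftrightarrow> rel n x x'" for n x x'
    by (induction n arbitrary: x x') auto
  have good: "good n \<and> S.good n" for n
  proof (induction n rule: less_induct)
    case (less n)
    show ?case
    proof (cases n)
      case 0
      have "eps i x0 = 0" "eps' i x0' = 0" if "i \<in> I" for i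
        using A.eps_pos[OF x0_in that] B.eps_pos[OF x0'_in that] hw hw' by auto
      with 0 show ?thesis
        by (auto simp: good_def S.good_def same_eps_def S.same_eps_def functional_def S.functional_def
            total_def S.total_def)
    next
      case (Suc m)
      have g: "\<And>k. k \<le> m \<Longrightarrow> good k" "\<And>k. k \<le> m \<Longrightarrow> S.good k" using less Suc by auto
      have "same_eps n" "S.same_eps n"
        using eps_Suc[OF g(1)] S.eps_Suc[OF g(2)] Suc sym
        unfolding same_eps_def S.same_eps_def by (metis gr0I)+
      with Suc show ?thesis
        using functional_Suc[OF g(1)] S.functional_Suc[OF g(2)] total_Suc[OF g(1)] S.total_Suc[OF g(2)]
        by (auto simp: good_def S.good_def)
    qed
  qed
  have fn: "x' = y'" if "rel n x x'" "rel m x y'" for n m x x' y'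
  proof -
    have "n = m" using A.reach_level_unique[OF hw] rel_reach[OF that(1)] rel_reach[OF that(2)] by blast
    with that good[of n] show ?thesis unfolding good_def functional_def by blast
  qed
  have inj: "x = y" if "rel n x x'" "rel m y x'" for n m x x' y
  proof -
    have "n = m" using B.reach_level_unique[OF hw'] rel_reach[OF that(1)] rel_reach[OF that(2)] by blast
    with that good[of n] sym show ?thesis unfolding S.good_def S.functional_def by metis
  qed
  have tot: "\<exists>x'. rel n x x'" if "A.reach x0 n x" for n x
    using good[of n] that by (auto simp: good_def total_def)
  have sur: "\<exists>x. rel n x x'" if "B.reach x0' n x'" for n x'
    using good[of n] that sym by (auto simp: S.good_def S.total_def)
  define f where "f x = (THE x'. \<exists>n. rel n x x')" for x
  have f: "f x = x'" if "rel n x x'" for n x x'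
    unfolding f_def using that fn by (intro the_equality) blast+
  have "inj_on f {y. \<exists>n. A.reach x0 n y}"
  proof (rule inj_onI, clarify)
    fix x y n m assume fxy: "f x = f y" and "A.reach x0 n x" "A.reach x0 m y"
    then obtain x' y' where "rel n x x'" "rel m y y'" using tot by blast
    with fxy f inj show "x = y" by metis
  qed
  moreover have "f ` {y. \<exists>n. A.reach x0 n y} = {y. \<exists>n. B.reach x0' n y}"
  proof (intro equalityI subsetI)
    fix u assume "u \<in> f ` {y. \<exists>n. A.reach x0 n y}"
    then obtain x n where "u = f x" "A.reach x0 n x" by blast
    with tot f rel_reach show "u \<in> {y. \<exists>n. B.reach x0' n y}" by blast
  next
    fix u assume "u \<in> {y. \<exists>n. B.reach x0' n y}"
    then obtain n x where "rel n x u" using sur by blast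
    with f rel_reach show "u \<in> f ` {y. \<exists>n. A.reach x0 n y}" by blast
  qed
  moreover have "edge i x y \<longleftrightarrow> edge' i (f x) (f y)"
    if reach_xy: "A.reach x0 n x" "A.reach x0 m y" for n m i x y
  proof -
    obtain x' y' where r: "rel n x x'" "rel m y y'" using tot reach_xy by blast
    have g: "same_eps n" "S.same_eps n" using good[of n] by (auto simp: good_def S.good_def)
    have "edge' i x' y'" if "edge i x y"
      using lift_edge_ex[OF g(1) r(1) that] fn r(2) by blast
    moreover have "edge i x y" if "edge' i x' y'"
      using S.lift_edge_ex[OF g(2) _ that] sym r inj by metis
    ultimately show ?thesis using f r by metis
  qed
  ultimately show ?thesis unfolding bij_betw_def by blast
qed

end

section \<open>Height functions and their extremal maxima\<close>

definition st :: "int \<Rightarrow> int \<Rightarrow> int" where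
  "st p u = (if p \<le> u then 1 else 0)"

definition firstmax :: "(int \<Rightarrow> int) \<Rightarrow> int \<Rightarrow> bool" where
  "firstmax G p \<longleftrightarrow> (\<forall>u<p. G u < G p) \<and> (\<forall>u>p. G u \<le> G p)"

text \<open>The last place of the maximum is \<open>p - 1\<close>. The index is the place just after
  it, where the height drops, because this is the place of the bead that moves back.\<close>

definition lastmax :: "(int \<Rightarrow> int) \<Rightarrow> int \<Rightarrow> bool" where
  "lastmax G p \<longleftrightarrow> (\<forall>u\<ge>p. G u < G (p - 1)) \<and> (\<forall>u<p. G u \<le> G (p - 1))"

definition height :: "(int \<Rightarrow> int) \<Rightarrow> int \<Rightarrow> bool" where
  "height G w \<longleftrightarrow> (\<exists>N. \<forall>u\<le>N. G u = 0) \<and> (\<exists>N. \<forall>u\<ge>N. G u = w)"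

definition peak :: "(int \<Rightarrow> int) \<Rightarrow> int" where
  "peak G = Max (range G)"

lemma firstmax_le: "firstmax G p \<Longrightarrow> G u \<le> G p"
  unfolding firstmax_def by (metis less_le_not_le linorder_less_linear order_refl)

lemma firstmax_unique: "firstmax G p \<Longrightarrow> firstmax G q \<Longrightarrow> p = q"
  unfolding firstmax_def by (metis linorder_less_linear not_less)

lemma lastmax_unique: "lastmax G p \<Longrightarrow> lastmax G q \<Longrightarrow> p = q"
  unfolding lastmax_def by (smt (verit))

lemma height_finite_range:
  assumes "height G w"
  shows "finite (range G)"
proof -
  obtain M N where MN: "\<forall>u\<le>M. G u = 0" "\<forall>u\<ge>N. G u = w" using assms by (auto simp: height_def)
  have "G u \<in> {0, w} \<union> G ` {M..N}" for u
    using MN by (cases "u \<le> M"; cases "u \<ge> N") auto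
  then have "range G \<subseteq> {0, w} \<union> G ` {M..N}" by blast
  then show ?thesis by (rule finite_subset) simp
qed

lemma peak_ge: "height G w \<Longrightarrow> G u \<le> peak G"
  unfolding peak_def using height_finite_range by (intro Max_ge) auto

lemma peak_attained: "height G w \<Longrightarrow> \<exists>u. G u = peak G"
  unfolding peak_def using Max_in[of "range G"] height_finite_range by (metis UNIV_not_empty image_is_empty rangeE)

lemma peak_eq: "height G w \<Longrightarrow> G u = m \<Longrightarrow> (\<And>v. G v \<le> m) \<Longrightarrow> peak G = m"
  by (metis order_antisym peak_attained peak_ge)

lemma peak_firstmax: "height G w \<Longrightarrow> firstmax G p \<Longrightarrow> peak G = G p"
  using firstmax_le peak_eq by blast

lemma peak_lastmax: "height G w \<Longrightarrow> lastmax G p \<Longrightarrow> peak G = G (p - 1)"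
  by (rule peak_eq[of _ _ "p - 1"]) (auto simp: lastmax_def, smt (verit))

lemma peak_nonneg:
  assumes "height G w"
  shows "peak G \<ge> 0" "peak G \<ge> w"
proof -
  obtain M N where MN: "\<forall>u\<le>M. G u = 0" "\<forall>u\<ge>N. G u = w" using assms by (auto simp: height_def)
  from MN peak_ge[OF assms, of M] peak_ge[OF assms, of N] show "peak G \<ge> 0" "peak G \<ge> w" by auto
qed

text \<open>The height vanishes far to the left. So a maximum equal to 0 is attained arbitrarily far
  to the left and has no first place, whereas a positive one is attained only to the right of some
  bound.\<close>

lemma ex_firstmax_iff:
  assumes "height G w"
  shows "(\<exists>p. firstmax G p) \<longleftrightarrow> peak G > 0"
proof -
  obtain M where M: "\<forall>u\<le>M. G u = 0" using assms by (auto simp: height_def)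
  show ?thesis
  proof
    assume "\<exists>p. firstmax G p"
    then obtain p where p: "firstmax G p" by blast
    have "G (min M p - 1) < G p" using p unfolding firstmax_def by simp
    with M peak_firstmax[OF assms p] show "peak G > 0" by auto
  next
    assume pos: "peak G > 0"
    obtain u where u: "G u = peak G" using peak_attained[OF assms] by blast
    have "M < u" using M u pos by (metis not_le less_irrefl)
    define n where "n = (LEAST n::nat. G (M + int n) = peak G)"
    have "G (M + int (nat (u - M))) = peak G" using u \<open>M < u\<close> by simp
    then have n: "G (M + int n) = peak G" and least: "\<And>m. m < n \<Longrightarrow> G (M + int m) \<noteq> peak G"
      unfolding n_def by (rule LeastI, use not_less_Least in blast)
    have "G v < G (M + int n)" if "v < M + int n" for v
    proof (cases "v \<le> M")
      case True
      with M n pos show ?thesis by simp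
    next
      case False
      then have "G v \<noteq> peak G" using least[of "nat (v - M)"] that by simp
      with peak_ge[OF assms, of v] n show ?thesis by simp
    qed
    with n peak_ge[OF assms] show "\<exists>p. firstmax G p" unfolding firstmax_def by metis
  qed
qed

text \<open>Reversal and adding a constant turn statements about the first maximum into statements about the
  last one.\<close>

lemma lastmax_reverse: "lastmax G p \<longleftrightarrow> firstmax (\<lambda>u. G (- u)) (1 - p)"
proof -
  have "(\<forall>u\<ge>p. P u) \<longleftrightarrow> (\<forall>u<1 - p. P (- u))" for P :: "int \<Rightarrow> bool"
  proof safe
    fix u assume "\<forall>u<1 - p. P (- u)" "p \<le> u"
    then show "P u" by (elim allE[of _ "- u"]) simp
  qed simp
  moreover have "(\<forall>u<p. P u) \<longleftrightarrow> (\<forall>u>1 - p. P (- u))" if "P (p - 1)" for P :: "int \<Rightarrow> bool"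
  proof safe
    fix u assume *: "\<forall>u>1 - p. P (- u)" "u < p"
    show "P u"
    proof (cases "u = p - 1")
      case False
      with * show ?thesis by (elim allE[of _ "- u"]) simp
    qed (use that in simp)
  qed simp
  ultimately show ?thesis unfolding lastmax_def firstmax_def by simp
qed

lemma height_reverse: "height G w \<Longrightarrow> height (\<lambda>u. G (- u) - w) (- w)"
  unfolding height_def by (metis (mono_tags, lifting) diff_0 diff_self minus_le_iff le_minus_iff)

lemma ex_lastmax_iff:
  assumes "height G w"
  shows "(\<exists>p. lastmax G p) \<longleftrightarrow> peak G > w"
proof -
  have h: "height (\<lambda>u. G (- u) - w) (- w)" using height_reverse[OF assms] .
  obtain u where u: "G u = peak G" using peak_attained[OF assms] by blast
  have "peak (\<lambda>u. G (- u) - w) = peak G - w"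
    by (rule peak_eq[OF h, of "- u"]) (use u peak_ge[OF assms] in auto)
  moreover have "lastmax G p \<longleftrightarrow> firstmax (\<lambda>u. G (- u) - w) (1 - p)" for p
    by (simp add: lastmax_reverse firstmax_def)
  then have "(\<exists>p. lastmax G p) \<longleftrightarrow> (\<exists>p. firstmax (\<lambda>u. G (- u) - w) p)"
    by (metis diff_diff_eq2 add_diff_cancel_left')
  ultimately show ?thesis using ex_firstmax_iff[OF h] by simp
qed

text \<open>Since the jump at \<open>p\<close> is at most 1, the value at \<open>p - 1\<close> is
  \<open>G p - 1\<close>. Lowering by 2 from \<open>p\<close> on makes it maximal and pushes all
  later values below it. Together with \<open>lastmax_flip\<close> this is why an arrow can be
  undone.\<close>

lemma firstmax_flip: "firstmax G p \<Longrightarrow> G p - G (p - 1) \<le> 1 \<Longrightarrow> lastmax (\<lambda>u. G u - 2 * st p u) p"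
  unfolding firstmax_def lastmax_def st_def by (smt (verit))

lemma lastmax_flip: "lastmax G p \<Longrightarrow> G (p - 1) - G p \<le> 1 \<Longrightarrow> firstmax (\<lambda>u. G u + 2 * st p u) p"
  unfolding firstmax_def lastmax_def st_def by (smt (verit))

lemma peak_add_st:
  assumes "height G w" "height (\<lambda>u. G u + st q u) w'"
  shows "peak (\<lambda>u. G u + st q u) = peak G + (if \<exists>u\<ge>q. G u = peak G then 1 else 0)"
proof (cases "\<exists>u\<ge>q. G u = peak G")
  case True
  then obtain u where "u \<ge> q" "G u = peak G" by blast
  then show ?thesis using True peak_ge[OF assms(1)]
    by (subst peak_eq[OF assms(2), of u]) (auto simp: st_def add_increasing2)
next
  case False
  obtain u where u: "G u = peak G" using peak_attained[OF assms(1)] by blast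
  then have "u < q" using False by (meson not_le)
  have "G v + st q v \<le> peak G" for v
    using False peak_ge[OF assms(1), of v] by (cases "v \<ge> q") (force simp: st_def)+
  then have "peak (\<lambda>u. G u + st q u) = peak G"
    using u \<open>u < q\<close> by (intro peak_eq[OF assms(2), of u]) (auto simp: st_def)
  with False show ?thesis by simp
qed

text \<open>The two height functions of adjacent colours: a move of one colour at \<open>p\<close> lowers its own
  height by 2 and raises the other one by 1 from \<open>p\<close> on.\<close>

lemma two_moves_right:
  assumes "firstmax G1 p" "firstmax G2 q" "p < q"
  shows "firstmax (\<lambda>u. G2 u + st p u) q"
  using assms unfolding firstmax_def st_def by (smt (verit))

text \<open>From \<open>q\<close> on the values were strictly below \<open>G1 p\<close>, so after
  the raise by 1 they reach it at most, and only to the right of \<open>p\<close>.\<close>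

lemma two_moves_square:
  assumes "firstmax G1 p" "firstmax G2 q" "p < q" "\<forall>u\<ge>q. G1 u < G1 p"
  shows "firstmax (\<lambda>u. G1 u + st q u) p"
  using assms unfolding firstmax_def st_def by (smt (verit))

lemma least_ge:
  assumes "u \<ge> (q::int)" "P u"
  shows "\<exists>r\<ge>q. P r \<and> (\<forall>v. q \<le> v \<and> v < r \<longrightarrow> \<not> P v)"
proof -
  define n where "n = (LEAST n::nat. P (q + int n))"
  have "P (q + int (nat (u - q)))" using assms by simp
  then have n: "P (q + int n)" and least: "\<And>m. m < n \<Longrightarrow> \<not> P (q + int m)"
    unfolding n_def by (rule LeastI, use not_less_Least in blast)
  have "\<not> P v" if "q \<le> v" "v < q + int n" for v
    using least[of "nat (v - q)"] that by simp
  with n show ?thesis by (intro exI[of _ "q + int n"]) auto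
qed

text \<open>Both sides of the octagon use the same four places. Starting with colour 1 the moves are
  at \<open>p\<close>, \<open>q\<close>, \<open>s\<close>, \<open>r\<close>; starting with colour 2
  they are at \<open>q\<close>, \<open>r\<close>, \<open>p\<close>, \<open>s\<close>. After the move
  at \<open>q\<close>, colour 1 moves at \<open>r\<close> and not at \<open>p\<close>, and this is
  what excludes a square.\<close>

lemma two_moves_octagon:
  assumes p: "firstmax G1 p" and q: "firstmax G2 q" and "p < q" and ex: "\<exists>u\<ge>q. G1 u = G1 p"
    and jump: "G2 q - G2 (q - 1) \<le> 1"
  shows "\<exists>r s. r \<noteq> p \<and>
     firstmax (\<lambda>u. G1 u + st q u) r \<and>
     firstmax (\<lambda>u. G1 u + st q u - 2 * st r u) p \<and>
     firstmax (\<lambda>u. G2 u - 2 * st q u + st r u + st p u) s \<and>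
     firstmax (\<lambda>u. G2 u + st p u - 2 * st q u) s \<and>
     firstmax (\<lambda>u. G1 u - 2 * st p u + st q u + st s u) r"
proof -
  \<comment> \<open>The first old maximum of \<open>G1\<close> at or beyond \<open>q\<close>: the
    raise from \<open>q\<close> on turns it into the first new maximum, of value
    \<open>G1 p + 1\<close>.\<close>
  obtain r where r: "r \<ge> q" "G1 r = G1 p" "\<And>v. q \<le> v \<Longrightarrow> v < r \<Longrightarrow> G1 v \<noteq> G1 p"
    using ex least_ge[of q _ "\<lambda>u. G1 u = G1 p"] by blast
  have q1: "G2 (q - 1) = G2 q - 1" using q jump unfolding firstmax_def by (smt (verit))
  \<comment> \<open>The first place from \<open>p\<close> on at height one below the maximum of
    \<open>G2\<close>. The raise from \<open>p\<close> on makes it maximal, while the old maxima are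
    lowered by the drop of 2 at \<open>q\<close>. The bound on the jump at \<open>q\<close> shows
    that \<open>q - 1\<close> is such a place, so \<open>s < q\<close>.\<close>
  obtain s where s: "s \<ge> p" "G2 s = G2 q - 1" "\<And>v. p \<le> v \<Longrightarrow> v < s \<Longrightarrow> G2 v \<noteq> G2 q - 1"
    using q1 least_ge[of p "q - 1" "\<lambda>u. G2 u = G2 q - 1"] \<open>p < q\<close> by auto
  have "s < q" using s q1 \<open>p < q\<close> by (smt (verit))
  have P: "\<And>u. u < p \<Longrightarrow> G1 u < G1 p" "\<And>u. G1 u \<le> G1 p"
    using p firstmax_le unfolding firstmax_def by auto
  have Q: "\<And>u. u < q \<Longrightarrow> G2 u < G2 q" "\<And>u. G2 u \<le> G2 q"
    using q firstmax_le unfolding firstmax_def by auto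
  have R: "G1 u < G1 p" if "q \<le> u" "u < r" for u using r(3)[OF that] P(2)[of u] by simp
  have S: "G2 u < G2 q - 1" if "p \<le> u" "u < s" for u
    using s(3)[OF that] Q(1)[of u] that \<open>s < q\<close> by simp
  note facts = P Q R S r(1,2) s(1,2) \<open>s < q\<close> \<open>p < q\<close>
  have "firstmax (\<lambda>u. G1 u + st q u) r"
    unfolding firstmax_def st_def using facts by (smt (verit))
  moreover have "firstmax (\<lambda>u. G1 u + st q u - 2 * st r u) p"
    unfolding firstmax_def st_def using facts by (smt (verit))
  moreover have "firstmax (\<lambda>u. G2 u - 2 * st q u + st r u + st p u) s"
    unfolding firstmax_def st_def using facts by (smt (verit))
  moreover have "firstmax (\<lambda>u. G2 u + st p u - 2 * st q u) s"
    unfolding firstmax_def st_def using facts by (smt (verit))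
  moreover have "firstmax (\<lambda>u. G1 u - 2 * st p u + st q u + st s u) r"
    unfolding firstmax_def st_def using facts by (smt (verit))
  ultimately show ?thesis using r(1) \<open>p < q\<close> by (intro exI[of _ r] exI[of _ s]) auto
qed

lemma st_neg: "st p (- u) = 1 - st (1 - p) u"
  by (simp add: st_def)

lemma two_comoves_right:
  assumes "lastmax G1 p" "lastmax G2 q" "q < p"
  shows "lastmax (\<lambda>u. G2 u - st p u) q"
  using two_moves_right[of "\<lambda>u. G1 (- u)" "1 - p" "\<lambda>u. G2 (- u)" "1 - q"] assms
  unfolding lastmax_reverse st_neg by (simp add: firstmax_def)

text \<open>The mirror image of the square and the octagon under \<open>u \<mapsto> - u\<close>. A
  reversed step function is a constant minus a step function, and constants do not affect the places
  of maxima.\<close>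

lemma two_comoves:
  assumes p: "lastmax G1 p" and q: "lastmax G2 q" and "q < p"
    and jump: "G2 (q - 1) - G2 q \<le> 1"
  shows "lastmax (\<lambda>u. G1 u - st q u) p \<or> (\<exists>r s.
     lastmax (\<lambda>u. G1 u - st q u) r \<and>
     lastmax (\<lambda>u. G1 u - st q u + 2 * st r u) p \<and>
     lastmax (\<lambda>u. G2 u + 2 * st q u - st r u - st p u) s \<and>
     lastmax (\<lambda>u. G2 u - st p u + 2 * st q u) s \<and>
     lastmax (\<lambda>u. G1 u + 2 * st p u - st q u - st s u) r)"
proof -
  let ?G1 = "\<lambda>u. G1 (- u)" and ?G2 = "\<lambda>u. G2 (- u)"
  have p': "firstmax ?G1 (1 - p)" and q': "firstmax ?G2 (1 - q)"
    using p q by (simp_all add: lastmax_reverse)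
  show ?thesis
  proof (cases "\<exists>u\<ge>1 - q. ?G1 u = ?G1 (1 - p)")
    case False
    then have "\<forall>u\<ge>1 - q. ?G1 u < ?G1 (1 - p)" using firstmax_le[OF p'] by (metis order_less_le)
    then show ?thesis using two_moves_square[OF p' q'] \<open>q < p\<close>
      by (simp add: lastmax_reverse st_neg firstmax_def)
  next
    case True
    obtain r s where rs:
     "firstmax (\<lambda>u. ?G1 u + st (1 - q) u) r"
     "firstmax (\<lambda>u. ?G1 u + st (1 - q) u - 2 * st r u) (1 - p)"
     "firstmax (\<lambda>u. ?G2 u - 2 * st (1 - q) u + st r u + st (1 - p) u) s"
     "firstmax (\<lambda>u. ?G2 u + st (1 - p) u - 2 * st (1 - q) u) s"
     "firstmax (\<lambda>u. ?G1 u - 2 * st (1 - p) u + st (1 - q) u + st s u) r"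
      using two_moves_octagon[OF p' q' _ True] \<open>q < p\<close> jump by auto
    show ?thesis
      by (intro disjI2 exI[of _ "1 - r"] exI[of _ "1 - s"])
        (use rs in \<open>simp add: lastmax_reverse st_neg firstmax_def algebra_simps\<close>)
  qed
qed

section \<open>Bead configurations, signatures and profiles\<close>

definition tame :: "(int \<Rightarrow> int) \<Rightarrow> bool" where
  "tame x \<longleftrightarrow> (\<exists>N. \<forall>u\<le>N. x u = 1) \<and> (\<exists>N. \<forall>u\<ge>N. x u = 0)"

definition maya :: "(int \<Rightarrow> int) \<Rightarrow> bool" where
  "maya x \<longleftrightarrow> tame x \<and> (\<forall>u. x u = 0 \<or> x u = 1)"

text \<open>Additive rather than a pair of updates, so that moves commute and cancel whatever the
  occupation of the places. It preserves \<open>tame\<close> unconditionally, and the formulas for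
  profiles, being linear, are proved at that level.\<close>

definition shift :: "int \<Rightarrow> int \<Rightarrow> (int \<Rightarrow> int) \<Rightarrow> int \<Rightarrow> int" where
  "shift p q x u = x u + of_bool (u = q) - of_bool (u = p)"

definition res :: "nat \<Rightarrow> int \<Rightarrow> int \<Rightarrow> bool" where
  "res e i u \<longleftrightarrow> int e dvd u div 2 - i"

text \<open>On a 0/1 configuration this is the signature: 1 if a bead can move from
  \<open>u - 2\<close> to \<open>u\<close> (an addable node), -1 if a bead can move back (a
  removable node).\<close>

definition jump :: "nat \<Rightarrow> int \<Rightarrow> (int \<Rightarrow> int) \<Rightarrow> int \<Rightarrow> int" where
  "jump e i x u = (if res e i u then x (u - 2) - x u else 0)"

definition profile :: "nat \<Rightarrow> int \<Rightarrow> (int \<Rightarrow> int) \<Rightarrow> int \<Rightarrow> int" where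
  "profile e i x k = sum (jump e i x) {u. u \<le> k \<and> jump e i x u \<noteq> 0}"

definition weight :: "nat \<Rightarrow> int \<Rightarrow> (int \<Rightarrow> int) \<Rightarrow> int" where
  "weight e i x = sum (jump e i x) {u. jump e i x u \<noteq> 0}"

lemma tame_shift: "tame x \<Longrightarrow> tame (shift p q x)"
proof -
  assume "tame x"
  then obtain M N where M: "\<forall>u\<le>M. x u = 1" and N: "\<forall>u\<ge>N. x u = 0" by (auto simp: tame_def)
  have "\<forall>u\<le>min M (min p q - 1). shift p q x u = 1" using M by (auto simp: shift_def)
  moreover have "\<forall>u\<ge>max N (max p q + 1). shift p q x u = 0" using N by (auto simp: shift_def)
  ultimately show ?thesis unfolding tame_def by blast
qed

lemma maya_shift: "maya x \<Longrightarrow> x p = 1 \<Longrightarrow> x q = 0 \<Longrightarrow> maya (shift p q x)"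
  unfolding maya_def using tame_shift by (auto simp: shift_def)

lemma finite_jump:
  assumes "tame x"
  shows "finite {u. jump e i x u \<noteq> 0}"
proof -
  obtain M N where M: "\<forall>u\<le>M. x u = 1" and N: "\<forall>u\<ge>N. x u = 0" using assms by (auto simp: tame_def)
  have "u \<in> {M..N + 2}" if "jump e i x u \<noteq> 0" for u
  proof (rule ccontr)
    assume "u \<notin> {M..N + 2}"
    then have "u < M \<or> u > N + 2" by auto
    then have "x (u - 2) = x u" using M N by auto
    with that show False by (simp add: jump_def split: if_splits)
  qed
  then have "{u. jump e i x u \<noteq> 0} \<subseteq> {M..N + 2}" by blast
  then show ?thesis by (rule finite_subset) simp
qed

lemma profile_step:
  assumes "tame x"
  shows "profile e i x k - profile e i x (k - 1) = jump e i x k"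
proof -
  have fin: "finite {u. u \<le> k - 1 \<and> jump e i x u \<noteq> 0}"
    using finite_jump[OF assms, of e i] by (rule rev_finite_subset) auto
  have "{u. u \<le> k \<and> jump e i x u \<noteq> 0} =
      (if jump e i x k = 0 then {u. u \<le> k - 1 \<and> jump e i x u \<noteq> 0}
       else insert k {u. u \<le> k - 1 \<and> jump e i x u \<noteq> 0})"
    using zle_diff1_eq by (auto simp: order_le_less)
  with fin show ?thesis by (simp add: profile_def)
qed

lemma profile_height:
  assumes "tame x"
  shows "height (profile e i x) (weight e i x)"
proof -
  obtain M N where M: "\<And>u. jump e i x u \<noteq> 0 \<Longrightarrow> M \<le> u" and N: "\<And>u. jump e i x u \<noteq> 0 \<Longrightarrow> u \<le> N"
    using finite_jump[OF assms, of e i] finite_has_minimal finite_has_maximal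
    by (metis (mono_tags, lifting) Max_ge Min_le mem_Collect_eq)
  have "profile e i x u = 0" if "u \<le> M - 1" for u
  proof -
    have "{v. v \<le> u \<and> jump e i x v \<noteq> 0} = {}" using M that by force
    then show ?thesis by (simp add: profile_def)
  qed
  moreover have "profile e i x u = weight e i x" if "u \<ge> N" for u
  proof -
    have "{v. v \<le> u \<and> jump e i x v \<noteq> 0} = {v. jump e i x v \<noteq> 0}" using N that by force
    then show ?thesis by (simp add: profile_def weight_def)
  qed
  ultimately show ?thesis unfolding height_def by blast
qed

lemma profile_unique:
  assumes "tame x" "\<And>k. F k - F (k - 1) = jump e i x k" "\<forall>u\<le>M. F u = 0"
  shows "F k = profile e i x k"
proof -
  obtain N where N: "\<forall>u\<le>N. profile e i x u = 0" using profile_height[OF assms(1)] unfolding height_def by blast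
  show ?thesis
  proof (cases "k \<le> min M N")
    case True
    with assms(3) N show ?thesis by simp
  next
    case False
    then have "min M N \<le> k" by linarith
    then show ?thesis
    proof (induction k rule: int_ge_induct)
      case base
      with assms(3) N show ?case by simp
    next
      case (step k)
      with assms(2)[of "k + 1"] profile_step[OF assms(1), of e i "k + 1"] show ?case by simp
    qed
  qed
qed

text \<open>Each of the two changed places enters the signature at itself and two places further on;
  the changes add up to 1, -2, 1 at \<open>p - 2\<close>, \<open>p\<close>, \<open>p + 2\<close>.
  Sorted by residue these are the negatives of the entries of a row of the affine Cartan
  matrix.\<close>

lemma profile_move:
  assumes "tame x"
  shows "profile e j (shift (p - 2) p x) k = profile e j x k + of_bool (res e j (p + 2)) * st (p + 2) k
    - 2 * of_bool (res e j p) * st p k + of_bool (res e j (p - 2)) * st (p - 2) k" (is "_ = ?F k")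
proof -
  obtain N where N: "\<forall>u\<le>N. profile e j x u = 0" using profile_height[OF assms] unfolding height_def by blast
  have st: "st a u - st a (u - 1) = of_bool (u = a)" for a u by (auto simp: st_def)
  have step: "?F k - ?F (k - 1) = jump e j (shift (p - 2) p x) k" for k
  proof -
    have "?F k - ?F (k - 1) = (profile e j x k - profile e j x (k - 1))
       + of_bool (res e j (p + 2)) * (st (p + 2) k - st (p + 2) (k - 1))
       - 2 * of_bool (res e j p) * (st p k - st p (k - 1))
       + of_bool (res e j (p - 2)) * (st (p - 2) k - st (p - 2) (k - 1))"
      by (simp add: algebra_simps)
    also have "\<dots> = jump e j (shift (p - 2) p x) k"
      unfolding st profile_step[OF assms] by (auto simp: jump_def shift_def)
    finally show ?thesis .
  qed
  have "\<forall>u\<le>min N (p - 3). ?F u = 0" using N by (auto simp: st_def)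
  with profile_unique[OF tame_shift[OF assms] step] show ?thesis by metis
qed

lemma maya_jump_le: "maya x \<Longrightarrow> \<bar>profile e i x k - profile e i x (k - 1)\<bar> \<le> 1"
  using profile_step[of x e i k] unfolding maya_def jump_def by (auto split: if_splits) (smt (verit))+

lemma firstmax_jump:
  assumes "maya x" "firstmax (profile e i x) p"
  shows "res e i p" "x (p - 2) = 1" "x p = 0"
proof -
  have "profile e i x (p - 1) < profile e i x p" using assms(2) by (simp add: firstmax_def)
  then have "jump e i x p > 0" using profile_step[of x e i p] assms(1) by (simp add: maya_def)
  then show "res e i p" "x (p - 2) = 1" "x p = 0"
    using assms(1) unfolding jump_def maya_def by (auto split: if_splits) (smt (verit))+
qed

lemma lastmax_jump:
  assumes "maya x" "lastmax (profile e i x) p"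
  shows "res e i p" "x (p - 2) = 0" "x p = 1"
proof -
  have "profile e i x (p - 1) > profile e i x p" using assms(2) by (simp add: lastmax_def)
  then have "jump e i x p < 0" using profile_step[of x e i p] assms(1) by (simp add: maya_def)
  then show "res e i p" "x (p - 2) = 0" "x p = 1"
    using assms(1) unfolding jump_def maya_def by (auto split: if_splits) (smt (verit))+
qed

section \<open>Bead configurations and the crystal operators\<close>

definition fedge :: "nat \<Rightarrow> int \<Rightarrow> (int \<Rightarrow> int) \<Rightarrow> (int \<Rightarrow> int) \<Rightarrow> bool" where
  "fedge e i x y \<longleftrightarrow> maya x \<and> (\<exists>p. firstmax (profile e i x) p \<and> y = shift (p - 2) p x)"

lemma res_iff:
  assumes "res e i p"
  shows "res e j p \<longleftrightarrow> int e dvd i - j"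
proof -
  have "p div 2 - j = (p div 2 - i) + (i - j)" by simp
  then show ?thesis using assms dvd_add_right_iff unfolding res_def by metis
qed

lemma res_add2 [simp]: "res e i (p + 2) \<longleftrightarrow> res e (i - 1) p"
proof -
  have "(p + 2) div 2 - i = p div 2 - (i - 1)" by simp
  then show ?thesis by (simp only: res_def)
qed

lemma res_diff2 [simp]: "res e i (p - 2) \<longleftrightarrow> res e (i + 1) p"
  using res_add2[of e "i + 1" "p - 2"] by simp

lemma not_dvd_small: "2 < e \<Longrightarrow> \<not> int e dvd 1" "2 < e \<Longrightarrow> \<not> int e dvd 2"
  "2 < e \<Longrightarrow> \<not> int e dvd - 1" "2 < e \<Longrightarrow> \<not> int e dvd - 2"
  by (auto dest: zdvd_imp_le)

text \<open>For \<open>2 < e\<close> the residues i - 1, i, i + 1 are distinct, so at most one of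
  the three terms of \<open>profile_move\<close> belongs to colour \<open>j\<close>.\<close>

lemma profile_move_cases:
  assumes "2 < e" "tame x" "res e i p"
  shows "int e dvd i - j \<Longrightarrow> profile e j (shift (p - 2) p x) = (\<lambda>k. profile e j x k - 2 * st p k)"
    and "int e dvd i + 1 - j \<Longrightarrow> profile e j (shift (p - 2) p x) = (\<lambda>k. profile e j x k + st (p + 2) k)"
    and "int e dvd i - 1 - j \<Longrightarrow> profile e j (shift (p - 2) p x) = (\<lambda>k. profile e j x k + st (p - 2) k)"
    and "\<not> int e dvd i - j \<Longrightarrow> \<not> int e dvd i + 1 - j \<Longrightarrow> \<not> int e dvd i - 1 - j \<Longrightarrow>
      profile e j (shift (p - 2) p x) = profile e j x"
proof -
  have r: "res e j p \<longleftrightarrow> int e dvd i - j" "res e j (p + 2) \<longleftrightarrow> int e dvd i + 1 - j"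
     "res e j (p - 2) \<longleftrightarrow> int e dvd i - 1 - j"
    using res_iff[OF assms(3)] by (simp_all add: algebra_simps)
  have excl: "\<not> (int e dvd a \<and> int e dvd a + 1)" "\<not> (int e dvd a \<and> int e dvd a - 1)"
      "\<not> (int e dvd a + 1 \<and> int e dvd a - 1)" for a
    using not_dvd_small[OF assms(1)] dvd_diff[of "int e" "a + 1" a] dvd_diff[of "int e" a "a - 1"]
      dvd_diff[of "int e" "a + 1" "a - 1"] by auto
  have eq: "i + 1 - j = (i - j) + 1" "i - 1 - j = (i - j) - 1" by simp_all
  note [simp] = profile_move[OF assms(2)] r[unfolded res_add2 res_diff2]
  show "int e dvd i - j \<Longrightarrow> profile e j (shift (p - 2) p x) = (\<lambda>k. profile e j x k - 2 * st p k)"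
    using excl[of "i - j"] unfolding eq by (intro ext) (auto simp: eq)
  show "int e dvd i + 1 - j \<Longrightarrow> profile e j (shift (p - 2) p x) = (\<lambda>k. profile e j x k + st (p + 2) k)"
    using excl[of "i - j"] unfolding eq by (intro ext) (auto simp: eq)
  show "int e dvd i - 1 - j \<Longrightarrow> profile e j (shift (p - 2) p x) = (\<lambda>k. profile e j x k + st (p - 2) k)"
    using excl[of "i - j"] unfolding eq by (intro ext) (auto simp: eq)
  show "\<not> int e dvd i - j \<Longrightarrow> \<not> int e dvd i + 1 - j \<Longrightarrow> \<not> int e dvd i - 1 - j \<Longrightarrow>
      profile e j (shift (p - 2) p x) = profile e j x"
    by (intro ext) auto
qed

lemma shift_shift [simp]: "shift p q (shift q p x) = x" "shift p p x = x"
  by (auto simp: shift_def)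

lemma shift_commute: "shift p q (shift r s x) = shift r s (shift p q x)"
  by (auto simp: shift_def)

lemma profile_unmove_cases:
  assumes "2 < e" "tame x" "res e i p"
  shows "int e dvd i - j \<Longrightarrow> profile e j (shift p (p - 2) x) = (\<lambda>k. profile e j x k + 2 * st p k)"
    and "int e dvd i + 1 - j \<Longrightarrow> profile e j (shift p (p - 2) x) = (\<lambda>k. profile e j x k - st (p + 2) k)"
    and "int e dvd i - 1 - j \<Longrightarrow> profile e j (shift p (p - 2) x) = (\<lambda>k. profile e j x k - st (p - 2) k)"
    and "\<not> int e dvd i - j \<Longrightarrow> \<not> int e dvd i + 1 - j \<Longrightarrow> \<not> int e dvd i - 1 - j \<Longrightarrow>
      profile e j (shift p (p - 2) x) = profile e j x"
  using profile_move_cases[OF assms(1) tame_shift[OF assms(2)] assms(3), of j p "p - 2"]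
  by (auto simp: fun_eq_iff)

lemma fedgeI:
  assumes "maya x" "firstmax (profile e i x) p"
  shows "fedge e i x (shift (p - 2) p x)" "maya (shift (p - 2) p x)" "res e i p"
  using assms firstmax_jump[OF assms] maya_shift by (auto simp: fedge_def)

lemma fedgeE:
  assumes "fedge e i x y"
  obtains p where "maya x" "maya y" "res e i p" "firstmax (profile e i x) p" "y = shift (p - 2) p x"
  using assms fedgeI unfolding fedge_def by metis

text \<open>An arrow can be reconstructed from its target: the bead at the last maximum moves back,
  and by \<open>lastmax_flip\<close> that place is then the first maximum.\<close>

lemma fedge_backI:
  assumes "2 < e" "maya y" "lastmax (profile e i y) p"
  shows "fedge e i (shift p (p - 2) y) y" "maya (shift p (p - 2) y)" "res e i p"
proof -
  note j = lastmax_jump[OF assms(2,3)]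
  then show "res e i p" "maya (shift p (p - 2) y)" using maya_shift[OF assms(2)] by auto
  have "firstmax (profile e i (shift p (p - 2) y)) p"
    using lastmax_flip[OF assms(3)] maya_jump_le[OF assms(2), of e i p] profile_unmove_cases(1)[OF assms(1) _ j(1)] assms(2)
    by (simp add: maya_def)
  with fedgeI(1)[OF \<open>maya (shift p (p - 2) y)\<close> this] show "fedge e i (shift p (p - 2) y) y" by simp
qed

lemma fedge_backE:
  assumes "2 < e" "fedge e i x y"
  obtains p where "maya x" "maya y" "res e i p" "lastmax (profile e i y) p" "x = shift p (p - 2) y"
proof -
  obtain p where p: "maya x" "maya y" "res e i p" "firstmax (profile e i x) p" "y = shift (p - 2) p x"
    using fedgeE[OF assms(2)] .
  have "lastmax (profile e i y) p"
    unfolding p(5)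
    using firstmax_flip[OF p(4)] maya_jump_le[OF p(1), of e i p] profile_move_cases(1)[OF assms(1) _ p(3), of x i] p(1)
    by (simp add: maya_def)
  moreover have "x = shift p (p - 2) y" unfolding p(5) by simp
  ultimately show thesis using that p by blast
qed

lemma firstmax_shift: "firstmax (\<lambda>u. F (u + d)) p \<longleftrightarrow> firstmax F (p + d)"
proof -
  have "firstmax F (p + d)" if max: "firstmax (\<lambda>u. F (u + d)) p" for F :: "int \<Rightarrow> int" and p d
  proof -
    have "F u < F (p + d)" if "u - d < p" for u
      using max that unfolding firstmax_def by force
    moreover have "F u \<le> F (p + d)" if "u - d > p" for u
      using max that unfolding firstmax_def by force
    ultimately show ?thesis unfolding firstmax_def by auto
  qed
  from this[of F d p] this[of "\<lambda>u. F (u + d)" "- d" "p + d"] show ?thesis by auto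
qed

lemma lastmax_shift: "lastmax (\<lambda>u. F (u + d)) p \<longleftrightarrow> lastmax F (p + d)"
  using firstmax_shift[of "\<lambda>u. F (- u)" "- d" "1 - p"]
  by (simp add: lastmax_reverse algebra_simps)

lemma peak_shift: "peak (\<lambda>u. F (u + d)) = peak F"
proof -
  have "range (\<lambda>u. F (u + d)) = range F" by (metis surj_plus_right image_image)
  then show ?thesis by (simp add: peak_def)
qed

section \<open>Stembridge's local axioms for bead configurations\<close>

definition both_rise :: "nat \<Rightarrow> int \<Rightarrow> int \<Rightarrow> (int \<Rightarrow> int) \<Rightarrow> (int \<Rightarrow> int) \<Rightarrow> (int \<Rightarrow> int) \<Rightarrow> bool" where
  "both_rise e i j x y z \<longleftrightarrow> peak (profile e j y) = peak (profile e j x) + 1 \<and>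
     peak (profile e i z) = peak (profile e i x) + 1"

text \<open>The three upward axioms in one predicate that is symmetric in the two arrows, so that
  only one order of their places has to be treated.\<close>

definition closes_up :: "nat \<Rightarrow> int \<Rightarrow> int \<Rightarrow> (int \<Rightarrow> int) \<Rightarrow> (int \<Rightarrow> int) \<Rightarrow> (int \<Rightarrow> int) \<Rightarrow> bool" where
  "closes_up e i j x y z \<longleftrightarrow>
     (\<not> both_rise e i j x y z \<longrightarrow> (\<exists>w. fedge e j y w \<and> fedge e i z w)) \<and>
     (both_rise e i j x y z \<longrightarrow> \<not> (\<exists>w. fedge e j y w \<and> fedge e i z w) \<and>
        (\<exists>y1 y2 z1 z2 w. fedge e j y y1 \<and> fedge e j y1 y2 \<and> fedge e i y2 w \<and>
                      fedge e i z z1 \<and> fedge e i z1 z2 \<and> fedge e j z2 w))"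

definition closes_down :: "nat \<Rightarrow> int \<Rightarrow> int \<Rightarrow> (int \<Rightarrow> int) \<Rightarrow> (int \<Rightarrow> int) \<Rightarrow> bool" where
  "closes_down e i j y z \<longleftrightarrow> (\<exists>w. fedge e j w y \<and> fedge e i w z) \<or>
      (\<exists>y1 y2 z1 z2 w. fedge e j y1 y \<and> fedge e j y2 y1 \<and> fedge e i w y2 \<and>
                       fedge e i z1 z \<and> fedge e i z2 z1 \<and> fedge e j w z2)"

lemma closes_up_sym: "closes_up e i j x y z \<Longrightarrow> closes_up e j i x z y"
  unfolding closes_up_def both_rise_def by blast

lemma closes_down_sym: "closes_down e i j y z \<Longrightarrow> closes_down e j i z y"
  unfolding closes_down_def by blast

text \<open>A move of colour \<open>i\<close> at \<open>p\<close> raises the profile of colour i + 1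
  from \<open>p + 2\<close> on and that of colour i - 1 from \<open>p - 2\<close> on. Reading the
  profile of \<open>j\<close> with the offset \<open>d\<close> cancels this displacement: in these
  coordinates both colours act on each other exactly at the place of the move, and the results on
  pairs of height functions apply.\<close>

lemma closes_up_lt:
  assumes e: "2 < e" and adj: "d = 2 \<and> int e dvd i + 1 - j \<or> d = - 2 \<and> int e dvd i - 1 - j"
    and x: "maya x" and p: "firstmax (profile e i x) p" and b: "firstmax (profile e j x) (q + d)"
    and "p < q"
  shows "closes_up e i j x (shift (p - 2) p x) (shift (q + d - 2) (q + d) x)"
proof -
  define y where "y = shift (p - 2) p x"
  define z where "z = shift (q + d - 2) (q + d) x"
  define G1 where "G1 = (\<lambda>x. profile e i x)"
  define G2 where "G2 = (\<lambda>x u. profile e j x (u + d))"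
  have "j + 1 - i = - (i - 1 - j)" "j - 1 - i = - (i + 1 - j)" by simp_all
  then have dji: "int e dvd j + 1 - i \<longleftrightarrow> int e dvd i - 1 - j" "int e dvd j - 1 - i \<longleftrightarrow> int e dvd i + 1 - j"
    by (simp_all only: dvd_minus_iff)
  have std: "st (a + d) (u + d) = st a u" for a u by (simp add: st_def)
  have m1: "G1 (shift (a - 2) a v) = (\<lambda>u. G1 v u - 2 * st a u)"
     "G2 (shift (a - 2) a v) = (\<lambda>u. G2 v u + st a u)" if "res e i a" "maya v" for a v
  proof -
    have v: "tame v" using that(2) by (simp add: maya_def)
    show "G1 (shift (a - 2) a v) = (\<lambda>u. G1 v u - 2 * st a u)"
      using profile_move_cases(1)[OF e v that(1), of i] by (simp add: G1_def)
    show "G2 (shift (a - 2) a v) = (\<lambda>u. G2 v u + st a u)"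
      using adj profile_move_cases(2,3)[OF e v that(1), of j] std[of a] by (auto simp: G2_def)
  qed
  have m2: "G2 (shift (a + d - 2) (a + d) v) = (\<lambda>u. G2 v u - 2 * st a u)"
     "G1 (shift (a + d - 2) (a + d) v) = (\<lambda>u. G1 v u + st a u)" if "res e j (a + d)" "maya v" for a v
  proof -
    have v: "tame v" using that(2) by (simp add: maya_def)
    show "G2 (shift (a + d - 2) (a + d) v) = (\<lambda>u. G2 v u - 2 * st a u)"
      using profile_move_cases(1)[OF e v that(1), of j] by (simp add: G2_def std)
    show "G1 (shift (a + d - 2) (a + d) v) = (\<lambda>u. G1 v u + st a u)"
      using adj profile_move_cases(2,3)[OF e v that(1), of i] by (auto simp: G1_def dji)
  qed
  have i_edge: "fedge e i v (shift (a - 2) a v) \<and> maya (shift (a - 2) a v) \<and> res e i a"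
    if "firstmax (G1 v) a" "maya v" for a v
    using fedgeI[OF that(2)] that(1) by (simp add: G1_def)
  have j_edge: "fedge e j v (shift (a + d - 2) (a + d) v) \<and> maya (shift (a + d - 2) (a + d) v) \<and> res e j (a + d)"
    if "firstmax (G2 v) a" "maya v" for a v
    using fedgeI[OF that(2)] that(1) by (simp add: G2_def firstmax_shift)
  have P: "firstmax (G1 x) p" and Q: "firstmax (G2 x) q"
    using p b by (simp_all add: G1_def G2_def firstmax_shift)
  have y: "fedge e i x y" "maya y" "res e i p" using i_edge[OF P x] by (simp_all add: y_def)
  have z: "fedge e j x z" "maya z" "res e j (q + d)" using j_edge[OF Q x] by (simp_all add: z_def)
  have Gy: "G1 y = (\<lambda>u. G1 x u - 2 * st p u)" "G2 y = (\<lambda>u. G2 x u + st p u)"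
    using m1[OF y(3) x] by (simp_all add: y_def)
  have Gz: "G1 z = (\<lambda>u. G1 x u + st q u)" "G2 z = (\<lambda>u. G2 x u - 2 * st q u)"
    using m2[OF z(3) x] by (simp_all add: z_def)
  have yw: "firstmax (G2 y) q" unfolding Gy using two_moves_right[OF P Q \<open>p < q\<close>] .
  define w where "w = shift (q + d - 2) (q + d) y"
  have w: "fedge e j y w" "maya w" using j_edge[OF yw y(2)] by (simp_all add: w_def)
  have tames: "tame x" "tame y" "tame z" using x y z by (simp_all add: maya_def)
  have hG1: "height (G1 v) (weight e i v)" if "tame v" for v using profile_height[OF that] by (simp add: G1_def)
  have hG2: "\<exists>N. height (G2 v) N" if "tame v" for v
  proof -
    from profile_height[OF that, of e j] obtain M N where
      "\<forall>u\<le>M. profile e j v u = 0" "\<forall>u\<ge>N. profile e j v u = weight e j v" unfolding height_def by blast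
    then have "\<forall>u\<le>M - d. G2 v u = 0" "\<forall>u\<ge>N - d. G2 v u = weight e j v" by (auto simp: G2_def)
    then show ?thesis unfolding height_def by blast
  qed
  have peak1: "peak (profile e i z) = peak (profile e i x) + (if \<exists>u\<ge>q. G1 x u = G1 x p then 1 else 0)"
    using peak_add_st[OF hG1[OF tames(1)] hG1[OF tames(3), unfolded Gz]] peak_firstmax[OF hG1[OF tames(1)] P]
    by (simp add: Gz[symmetric]) (simp add: G1_def)
  \<comment> \<open>The maximum of \<open>G2\<close> at \<open>q\<close> lies to the right of
    \<open>p\<close>, so it is always raised. Only the string of colour \<open>i\<close> can fail to
    grow.\<close>
  have "peak (G2 y) = peak (G2 x) + 1"
  proof -
    obtain N N' where h: "height (G2 x) N" "height (G2 y) N'" using hG2 tames by blast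
    have "\<exists>u\<ge>p. G2 x u = peak (G2 x)" using peak_firstmax[OF h(1) Q] \<open>p < q\<close> by (intro exI[of _ q]) auto
    with peak_add_st[OF h(1) h(2)[unfolded Gy]] show ?thesis by (simp add: Gy[symmetric])
  qed
  then have peak2: "peak (profile e j y) = peak (profile e j x) + 1"
    unfolding G2_def peak_shift .
  have rise: "both_rise e i j x y z \<longleftrightarrow> (\<exists>u\<ge>q. G1 x u = G1 x p)"
    unfolding both_rise_def peak1 peak2 by simp
  have "closes_up e i j x y z"
  proof (cases "\<exists>u\<ge>q. G1 x u = G1 x p")
    case False
    then have "\<forall>u\<ge>q. G1 x u < G1 x p" using firstmax_le[OF P] by (metis order_less_le)
    then have "firstmax (G1 z) p" unfolding Gz using two_moves_square[OF P Q \<open>p < q\<close>] by simp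
    then have "fedge e i z (shift (p - 2) p z)" using i_edge z by simp
    moreover have "shift (p - 2) p z = w" unfolding w_def y_def z_def by (rule shift_commute)
    ultimately show ?thesis using w False rise unfolding closes_up_def by auto
  next
    case True
    have "G2 x q - G2 x (q - 1) \<le> 1"
      using maya_jump_le[OF x, of e j "q + d"] by (simp add: G2_def algebra_simps)
    from two_moves_octagon[OF P Q \<open>p < q\<close> True this] obtain r s where rs: "r \<noteq> p"
      "firstmax (\<lambda>u. G1 x u + st q u) r"
      "firstmax (\<lambda>u. G1 x u + st q u - 2 * st r u) p"
      "firstmax (\<lambda>u. G2 x u - 2 * st q u + st r u + st p u) s"
      "firstmax (\<lambda>u. G2 x u + st p u - 2 * st q u) s"
      "firstmax (\<lambda>u. G1 x u - 2 * st p u + st q u + st s u) r" by blast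
    define z1 where "z1 = shift (r - 2) r z"
    define z2 where "z2 = shift (p - 2) p z1"
    define y2 where "y2 = shift (s + d - 2) (s + d) w"
    have z1: "fedge e i z z1" "maya z1" "res e i r" using i_edge[of z r] rs(2) z by (simp_all add: z1_def Gz)
    have Gz1: "G1 z1 = (\<lambda>u. G1 x u + st q u - 2 * st r u)" "G2 z1 = (\<lambda>u. G2 x u - 2 * st q u + st r u)"
      using m1[OF z1(3) z(2)] by (simp_all add: z1_def Gz)
    have z2: "fedge e i z1 z2" "maya z2" using i_edge[of z1 p] rs(3) z1 by (simp_all add: z2_def Gz1)
    have Gz2: "G2 z2 = (\<lambda>u. G2 x u - 2 * st q u + st r u + st p u)"
      using m1[OF y(3) z1(2)] by (simp add: z2_def Gz1)
    have zz: "fedge e j z2 (shift (s + d - 2) (s + d) z2)"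
      using j_edge[of z2 s] rs(4) z2 by (simp_all add: Gz2)
    have Gw: "G1 w = (\<lambda>u. G1 x u - 2 * st p u + st q u)" "G2 w = (\<lambda>u. G2 x u + st p u - 2 * st q u)"
      using m2[OF z(3) y(2)] by (simp_all add: w_def Gy)
    have y2: "fedge e j w y2" "maya y2" "res e j (s + d)"
      using j_edge[of w s] rs(5) w by (simp_all add: y2_def Gw)
    have Gy2: "G1 y2 = (\<lambda>u. G1 x u - 2 * st p u + st q u + st s u)"
      using m2[OF y2(3) w(2)] by (simp add: y2_def Gw)
    have yy: "fedge e i y2 (shift (r - 2) r y2)"
      using i_edge[of y2 r] rs(6) y2 by (simp_all add: Gy2)
    have "shift (r - 2) r y2 = shift (s + d - 2) (s + d) z2"
      unfolding y2_def w_def y_def z2_def z1_def z_def by (auto simp: shift_def)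
    \<comment> \<open>A common end would be \<open>w\<close> and \<open>z1\<close> at once, hence
      result from \<open>z\<close> both by a move at \<open>p\<close> and by a move at
      \<open>r\<close>; these differ at the place \<open>p\<close>.\<close>
    moreover have "\<not> (\<exists>w. fedge e j y w \<and> fedge e i z w)"
    proof
      assume "\<exists>w. fedge e j y w \<and> fedge e i z w"
      then obtain u where u: "fedge e j y u" "fedge e i z u" by blast
      have "u = w" using u(1) yw firstmax_unique unfolding fedge_def w_def G2_def firstmax_shift by blast
      moreover have "u = z1" using u(2) rs(2)[folded Gz(1)] firstmax_unique unfolding fedge_def z1_def G1_def by blast
      ultimately have "shift (r - 2) r z p = shift (p - 2) p z p"
        unfolding w_def z1_def y_def z_def using shift_commute by metis
      with \<open>r \<noteq> p\<close> show False by (auto simp: shift_def of_bool_def split: if_splits)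
    qed
    ultimately show ?thesis using w(1) y2(1) yy z1(1) z2(1) zz True rise unfolding closes_up_def by metis
  qed
  then show ?thesis by (simp add: y_def z_def)
qed

lemma adjacent_flip: "int e dvd j + 1 - i \<longleftrightarrow> int e dvd i - 1 - j" "int e dvd j - 1 - i \<longleftrightarrow> int e dvd i + 1 - j"
   "int e dvd j - i \<longleftrightarrow> int e dvd i - j"
proof -
  have "j + 1 - i = - (i - 1 - j)" "j - 1 - i = - (i + 1 - j)" "j - i = - (i - j)" by simp_all
  then show "int e dvd j + 1 - i \<longleftrightarrow> int e dvd i - 1 - j" "int e dvd j - 1 - i \<longleftrightarrow> int e dvd i + 1 - j"
   "int e dvd j - i \<longleftrightarrow> int e dvd i - j"
    by (simp_all only: dvd_minus_iff)
qed

lemma closes_up_adjacent: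
  assumes e: "2 < e" and adj: "int e dvd i + 1 - j" and y: "fedge e i x y" and z: "fedge e j x z"
  shows "closes_up e i j x y z"
proof -
  obtain p where p: "maya x" "firstmax (profile e i x) p" "y = shift (p - 2) p x"
    using fedgeE[OF y] by metis
  obtain b where b: "firstmax (profile e j x) b" "z = shift (b - 2) b x"
    using fedgeE[OF z] by metis
  \<comment> \<open>Otherwise this place would be empty, as the target of the move of colour
    \<open>i\<close>, and occupied, as the source of the move of colour \<open>j\<close>. So the
    places, once aligned by the offset, are strictly ordered one way or the other.\<close>
  have "b - 2 \<noteq> p" using firstmax_jump[OF p(1,2)] firstmax_jump[OF p(1) b(1)] by auto
  then consider "p < b - 2" | "b < p + 2" by linarith
  then show ?thesis
  proof cases
    case 1
    show ?thesis using closes_up_lt[OF e _ p(1,2), of 2 j "b - 2"] adj b p 1 by simp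
  next
    case 2
    have "closes_up e j i x z y"
      using closes_up_lt[OF e _ p(1) b(1), of "- 2" i "p + 2"] adj adjacent_flip(2)[of e j i] b p 2 by simp
    then show ?thesis by (rule closes_up_sym)
  qed
qed

lemma closes_up:
  assumes e: "2 < e" and ne: "\<not> int e dvd i - j" and y: "fedge e i x y" and z: "fedge e j x z"
  shows "closes_up e i j x y z"
proof (cases "int e dvd i + 1 - j \<or> int e dvd i - 1 - j")
  case True
  then show ?thesis
    using closes_up_adjacent[OF e _ y z] closes_up_adjacent[OF e _ z y] closes_up_sym adjacent_flip(1)[of e j i] by blast
next
  case False
  obtain p where p: "maya x" "res e i p" "firstmax (profile e i x) p" "y = shift (p - 2) p x" "maya y"
    using fedgeE[OF y] by metis
  obtain b where b: "res e j b" "firstmax (profile e j x) b" "z = shift (b - 2) b x" "maya z"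
    using fedgeE[OF z] by metis
  have t: "tame x" using p by (simp add: maya_def)
  have py: "profile e j y = profile e j x"
    using profile_move_cases(4)[OF e t p(2), of j] False ne p by simp
  have pz: "profile e i z = profile e i x"
    using profile_move_cases(4)[OF e t b(1), of i] False ne b adjacent_flip[of e j i] by simp
  have "fedge e j y (shift (b - 2) b y)" "fedge e i z (shift (p - 2) p z)"
    using fedgeI(1)[OF p(5), of e j b] fedgeI(1)[OF b(4), of e i p] p(3) b(2) py pz by simp_all
  moreover have "shift (b - 2) b y = shift (p - 2) p z" unfolding p(4) b(3) by (rule shift_commute)
  moreover have "\<not> both_rise e i j x y z" by (simp add: both_rise_def py)
  ultimately show ?thesis unfolding closes_up_def by auto
qed

text \<open>Dual to \<open>closes_up_lt\<close>, with last maxima and reversed order of the places.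
  Which of the two shapes occurs is left open, as in the axiom \<open>below\<close>.\<close>

lemma closes_down_gt:
  assumes e: "2 < e" and adj: "d = 2 \<and> int e dvd i + 1 - j \<or> d = - 2 \<and> int e dvd i - 1 - j"
    and x: "maya x" and p: "lastmax (profile e i x) p" and b: "lastmax (profile e j x) (q + d)"
    and "q < p"
  shows "closes_down e i j (shift p (p - 2) x) (shift (q + d) (q + d - 2) x)"
proof -
  define y where "y = shift p (p - 2) x"
  define z where "z = shift (q + d) (q + d - 2) x"
  define G1 where "G1 = (\<lambda>x. profile e i x)"
  define G2 where "G2 = (\<lambda>x u. profile e j x (u + d))"
  have std: "st (a + d) (u + d) = st a u" for a u by (simp add: st_def)
  have m1: "G1 (shift a (a - 2) v) = (\<lambda>u. G1 v u + 2 * st a u)"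
     "G2 (shift a (a - 2) v) = (\<lambda>u. G2 v u - st a u)" if "res e i a" "maya v" for a v
  proof -
    have v: "tame v" using that(2) by (simp add: maya_def)
    show "G1 (shift a (a - 2) v) = (\<lambda>u. G1 v u + 2 * st a u)"
      using profile_unmove_cases(1)[OF e v that(1), of i] by (simp add: G1_def)
    show "G2 (shift a (a - 2) v) = (\<lambda>u. G2 v u - st a u)"
      using adj profile_unmove_cases(2,3)[OF e v that(1), of j] std[of a] by (auto simp: G2_def)
  qed
  have m2: "G2 (shift (a + d) (a + d - 2) v) = (\<lambda>u. G2 v u + 2 * st a u)"
     "G1 (shift (a + d) (a + d - 2) v) = (\<lambda>u. G1 v u - st a u)" if "res e j (a + d)" "maya v" for a v
  proof -
    have v: "tame v" using that(2) by (simp add: maya_def)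
    show "G2 (shift (a + d) (a + d - 2) v) = (\<lambda>u. G2 v u + 2 * st a u)"
      using profile_unmove_cases(1)[OF e v that(1), of j] by (simp add: G2_def std)
    show "G1 (shift (a + d) (a + d - 2) v) = (\<lambda>u. G1 v u - st a u)"
      using adj profile_unmove_cases(2,3)[OF e v that(1), of i] adjacent_flip[of e j i] by (auto simp: G1_def)
  qed
  have i_edge: "fedge e i (shift a (a - 2) v) v \<and> maya (shift a (a - 2) v) \<and> res e i a"
    if "lastmax (G1 v) a" "maya v" for a v
    using fedge_backI[OF e that(2)] that(1) by (simp add: G1_def)
  have j_edge: "fedge e j (shift (a + d) (a + d - 2) v) v \<and> maya (shift (a + d) (a + d - 2) v) \<and> res e j (a + d)"
    if "lastmax (G2 v) a" "maya v" for a v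
    using fedge_backI[OF e that(2)] that(1) by (simp add: G2_def lastmax_shift)
  have P: "lastmax (G1 x) p" and Q: "lastmax (G2 x) q"
    using p b by (simp_all add: G1_def G2_def lastmax_shift)
  have y: "maya y" "res e i p" using i_edge[OF P x] by (simp_all add: y_def)
  have z: "maya z" "res e j (q + d)" using j_edge[OF Q x] by (simp_all add: z_def)
  have Gy: "G1 y = (\<lambda>u. G1 x u + 2 * st p u)" "G2 y = (\<lambda>u. G2 x u - st p u)"
    using m1[OF y(2) x] by (simp_all add: y_def)
  have Gz: "G1 z = (\<lambda>u. G1 x u - st q u)" "G2 z = (\<lambda>u. G2 x u + 2 * st q u)"
    using m2[OF z(2) x] by (simp_all add: z_def)
  have yw: "lastmax (G2 y) q" unfolding Gy using two_comoves_right[OF P Q \<open>q < p\<close>] .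
  define w where "w = shift (q + d) (q + d - 2) y"
  have w: "fedge e j w y" "maya w" using j_edge[OF yw y(1)] by (simp_all add: w_def)
  have "G2 x (q - 1) - G2 x q \<le> 1"
    using maya_jump_le[OF x, of e j "q + d"] by (simp add: G2_def algebra_simps)
  from two_comoves[OF P Q \<open>q < p\<close> this] have "closes_down e i j y z"
  proof (elim disjE exE conjE)
    assume "lastmax (\<lambda>u. G1 x u - st q u) p"
    then have "fedge e i (shift p (p - 2) z) z" using i_edge z by (simp add: Gz)
    moreover have "shift p (p - 2) z = w" unfolding w_def y_def z_def by (rule shift_commute)
    ultimately show ?thesis using w unfolding closes_down_def by auto
  next
    fix r s assume rs:
      "lastmax (\<lambda>u. G1 x u - st q u) r"
      "lastmax (\<lambda>u. G1 x u - st q u + 2 * st r u) p"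
      "lastmax (\<lambda>u. G2 x u + 2 * st q u - st r u - st p u) s"
      "lastmax (\<lambda>u. G2 x u - st p u + 2 * st q u) s"
      "lastmax (\<lambda>u. G1 x u + 2 * st p u - st q u - st s u) r"
    define z1 where "z1 = shift r (r - 2) z"
    define z2 where "z2 = shift p (p - 2) z1"
    define y2 where "y2 = shift (s + d) (s + d - 2) w"
    have z1: "fedge e i z1 z" "maya z1" "res e i r" using i_edge[of z r] rs(1) z by (simp_all add: z1_def Gz)
    have Gz1: "G1 z1 = (\<lambda>u. G1 x u - st q u + 2 * st r u)" "G2 z1 = (\<lambda>u. G2 x u + 2 * st q u - st r u)"
      using m1[OF z1(3) z(1)] by (simp_all add: z1_def Gz)
    have z2: "fedge e i z2 z1" "maya z2" using i_edge[of z1 p] rs(2) z1 by (simp_all add: z2_def Gz1)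
    have Gz2: "G2 z2 = (\<lambda>u. G2 x u + 2 * st q u - st r u - st p u)"
      using m1[OF y(2) z1(2)] by (simp add: z2_def Gz1)
    have zz: "fedge e j (shift (s + d) (s + d - 2) z2) z2"
      using j_edge[of z2 s] rs(3) z2 by (simp_all add: Gz2)
    have Gw: "G1 w = (\<lambda>u. G1 x u + 2 * st p u - st q u)" "G2 w = (\<lambda>u. G2 x u - st p u + 2 * st q u)"
      using m2[OF z(2) y(1)] by (simp_all add: w_def Gy)
    have y2: "fedge e j y2 w" "maya y2" "res e j (s + d)"
      using j_edge[of w s] rs(4) w by (simp_all add: y2_def Gw)
    have Gy2: "G1 y2 = (\<lambda>u. G1 x u + 2 * st p u - st q u - st s u)"
      using m2[OF y2(3) w(2)] by (simp add: y2_def Gw)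
    have yy: "fedge e i (shift r (r - 2) y2) y2"
      using i_edge[of y2 r] rs(5) y2 by (simp_all add: Gy2)
    have "shift r (r - 2) y2 = shift (s + d) (s + d - 2) z2"
      unfolding y2_def w_def y_def z2_def z1_def z_def by (auto simp: shift_def)
    then show ?thesis using w(1) y2(1) yy z1(1) z2(1) zz unfolding closes_down_def by metis
  qed
  then show ?thesis by (simp add: y_def z_def)
qed

lemma closes_down_adjacent:
  assumes e: "2 < e" and adj: "int e dvd i + 1 - j" and y: "fedge e i y x" and z: "fedge e j z x"
  shows "closes_down e i j y z"
proof -
  obtain p where p: "maya x" "lastmax (profile e i x) p" "y = shift p (p - 2) x"
    using fedge_backE[OF e y] by metis
  obtain b where b: "lastmax (profile e j x) b" "z = shift b (b - 2) x"
    using fedge_backE[OF e z] by metis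
  have "b - 2 \<noteq> p" using lastmax_jump[OF p(1,2)] lastmax_jump[OF p(1) b(1)] by auto
  then consider "b - 2 < p" | "p + 2 < b" by linarith
  then show ?thesis
  proof cases
    case 1
    show ?thesis using closes_down_gt[OF e _ p(1,2), of 2 j "b - 2"] adj b p 1 by simp
  next
    case 2
    have "closes_down e j i z y"
      using closes_down_gt[OF e _ p(1) b(1), of "- 2" i "p + 2"] adj adjacent_flip(2)[of e j i] b p 2 by simp
    then show ?thesis by (rule closes_down_sym)
  qed
qed

lemma closes_down:
  assumes e: "2 < e" and ne: "\<not> int e dvd i - j" and y: "fedge e i y x" and z: "fedge e j z x"
  shows "closes_down e i j y z"
proof (cases "int e dvd i + 1 - j \<or> int e dvd i - 1 - j")
  case True
  then show ?thesis
    using closes_down_adjacent[OF e _ y z] closes_down_adjacent[OF e _ z y] closes_down_sym adjacent_flip(1)[of e j i] by blast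
next
  case False
  obtain p where p: "maya x" "res e i p" "lastmax (profile e i x) p" "y = shift p (p - 2) x" "maya y"
    using fedge_backE[OF e y] by metis
  obtain b where b: "res e j b" "lastmax (profile e j x) b" "z = shift b (b - 2) x" "maya z"
    using fedge_backE[OF e z] by metis
  have t: "tame x" using p by (simp add: maya_def)
  have py: "profile e j y = profile e j x"
    using profile_unmove_cases(4)[OF e t p(2), of j] False ne p by simp
  have pz: "profile e i z = profile e i x"
    using profile_unmove_cases(4)[OF e t b(1), of i] False ne b adjacent_flip[of e j i] by simp
  have "fedge e j (shift b (b - 2) y) y" "fedge e i (shift p (p - 2) z) z"
    using fedge_backI(1)[OF e p(5), of j b] fedge_backI(1)[OF e b(4), of i p] p(3) b(2) py pz by simp_all
  moreover have "shift b (b - 2) y = shift p (p - 2) z" unfolding p(4) b(3) by (rule shift_commute)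
  ultimately show ?thesis unfolding closes_down_def by auto
qed

section \<open>String lengths and weights of bead configurations\<close>

definition fock_eps :: "nat \<Rightarrow> int \<Rightarrow> (int \<Rightarrow> int) \<Rightarrow> nat" where
  "fock_eps e i x = nat (peak (profile e i x) - weight e i x)"

definition affine_cartan :: "nat \<Rightarrow> int \<Rightarrow> int \<Rightarrow> int" where
  "affine_cartan e i j = (if int e dvd i - j then 2
     else if int e dvd i + 1 - j \<or> int e dvd i - 1 - j then - 1 else 0)"

text \<open>The peak is \<phi>. Since the profile ends at the weight, the peak is at least as large,
  and the truncation in \<open>fock_eps\<close> loses nothing.\<close>

lemma fock_phi: "tame x \<Longrightarrow> int (fock_eps e i x) + weight e i x = peak (profile e i x)"
  using peak_nonneg[OF profile_height] by (simp add: fock_eps_def)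

lemma fedge_iff_firstmax: "maya x \<Longrightarrow> (\<exists>y. fedge e i x y) \<longleftrightarrow> (\<exists>p. firstmax (profile e i x) p)"
  using fedgeI(1) fedge_def by metis

lemma fedge_iff_lastmax: "2 < e \<Longrightarrow> maya x \<Longrightarrow> (\<exists>y. fedge e i y x) \<longleftrightarrow> (\<exists>p. lastmax (profile e i x) p)"
  using fedge_backI(1) fedge_backE by metis

lemma fedge_unique: "fedge e i x y \<Longrightarrow> fedge e i x y' \<Longrightarrow> y = y'"
  using firstmax_unique unfolding fedge_def by blast

lemma fedge_injective:
  assumes "2 < e" "fedge e i x y" "fedge e i x' y"
  shows "x = x'"
proof -
  obtain p where "lastmax (profile e i y) p" "x = shift p (p - 2) y"
    by (rule fedge_backE[OF assms(1,2)])
  moreover obtain q where "lastmax (profile e i y) q" "x' = shift q (q - 2) y"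
    by (rule fedge_backE[OF assms(1,3)])
  ultimately show ?thesis using lastmax_unique by blast
qed

lemma fedge_weight:
  assumes "2 < e" "fedge e i x y"
  shows "weight e j y = weight e j x - affine_cartan e i j"
proof -
  obtain p where p: "maya x" "maya y" "res e i p" "y = shift (p - 2) p x"
    using fedgeE[OF assms(2)] by metis
  then have t: "tame x" "tame y" by (simp_all add: maya_def)
  obtain M N where M: "\<forall>u\<le>M. profile e j x u = 0" and N: "\<forall>u\<ge>N. profile e j x u = weight e j x"
    using profile_height[OF t(1), of e j] unfolding height_def by blast
  obtain N' where N': "\<forall>u\<ge>N'. profile e j y u = weight e j y"
    using profile_height[OF t(2), of e j] unfolding height_def by blast
  \<comment> \<open>To the right of this place all profiles and steps involved are constant, so
    comparing values there compares weights.\<close>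
  define u where "u = max (max N N') (p + 2)"
  have "weight e j y = profile e j y u" "weight e j x = profile e j x u" using N N' by (simp_all add: u_def)
  moreover have "st p u = 1" "st (p + 2) u = 1" "st (p - 2) u = 1" by (auto simp: st_def u_def)
  ultimately show ?thesis
    using profile_move_cases[OF assms(1) t(1) p(3), of j] p(4) by (auto simp: affine_cartan_def)
qed

text \<open>By \<open>firstmax_flip\<close> the new peak sits at \<open>p - 1\<close> and is one
  lower than the old one, while the weight falls by 2.\<close>

lemma fedge_eps:
  assumes "2 < e" "fedge e i x y"
  shows "fock_eps e i y = Suc (fock_eps e i x)"
proof -
  obtain p where p: "maya x" "maya y" "res e i p" "firstmax (profile e i x) p" "y = shift (p - 2) p x"
    using fedgeE[OF assms(2)] by metis
  have t: "tame x" "tame y" using p by (simp_all add: maya_def)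
  have "lastmax (profile e i y) p"
    using firstmax_flip[OF p(4)] maya_jump_le[OF p(1), of e i p] profile_move_cases(1)[OF assms(1) t(1) p(3), of i] p(5)
    by simp
  then have "peak (profile e i y) = profile e i y (p - 1)" using peak_lastmax profile_height t by blast
  also have "\<dots> = profile e i x (p - 1)"
    using profile_move_cases(1)[OF assms(1) t(1) p(3), of i] p(5) by (simp add: st_def)
  also have "\<dots> = profile e i x p - 1"
    using firstmax_jump[OF p(1,4)] profile_step[OF t(1), of e i p] by (simp add: jump_def)
  also have "\<dots> = peak (profile e i x) - 1" using peak_firstmax[OF profile_height p(4)] t by simp
  finally show ?thesis
    using fedge_weight[OF assms, of i] fock_phi[OF t(1), of e i] fock_phi[OF t(2), of e i]
    by (simp add: affine_cartan_def)
qed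

text \<open>The offset \<open>k\<close> of the colours is built in, so that an isomorphism that
  shifts labels becomes one that preserves them.\<close>

lemma fock_stembridge:
  assumes e: "2 < e"
  shows "stembridge {x. maya x} {0..<int e} (\<lambda>i x y. i \<in> {0..<int e} \<and> fedge e (i + k) x y)
    (\<lambda>i. fock_eps e (i + k)) (\<lambda>i. weight e (i + k)) (affine_cartan e)"
proof -
  have cart: "affine_cartan e (i + k) (j + k) = affine_cartan e i j" for i j
    by (simp add: affine_cartan_def algebra_simps)
  interpret crystal "{x. maya x}" "{0..<int e}" "\<lambda>i x y. i \<in> {0..<int e} \<and> fedge e (i + k) x y"
    "\<lambda>i. fock_eps e (i + k)" "\<lambda>i. weight e (i + k)" "affine_cartan e"
  proof (unfold_locales, goal_cases)
    case (1 i x y)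
    then show ?case using fedgeE by blast
  next
    case (2 i x y y')
    then show ?case using fedge_unique by blast
  next
    case (3 i x y x')
    then show ?case using fedge_injective[OF e] by blast
  next
    case (4 x i)
    then have t: "tame x" by (simp add: maya_def)
    with 4 show ?case
      using fedge_iff_firstmax[of x e "i + k"] ex_firstmax_iff[OF profile_height[OF t, of e "i + k"]]
      by (simp add: fock_phi)
  next
    case (5 x i)
    then have t: "tame x" by (simp add: maya_def)
    with 5 show ?case
      using fedge_iff_lastmax[OF e, of x "i + k"] ex_lastmax_iff[OF profile_height[OF t, of e "i + k"]]
      by (simp add: fock_eps_def)
  next
    case (6 i x y)
    then show ?case using fedge_eps[OF e] by simp
  next
    case (7 i x y j)
    then show ?case using fedge_weight[OF e, of "i + k" x y "j + k"] cart by simp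
  qed
  have ne: "\<not> int e dvd (i + k) - (j + k)" if "i \<in> {0..<int e}" "j \<in> {0..<int e}" "i \<noteq> j" for i j
  proof
    assume "int e dvd (i + k) - (j + k)"
    then have "int e dvd i - j" by simp
    then have "i mod int e = j mod int e" by (simp add: mod_eq_dvd_iff)
    with that show False by simp
  qed
  have rise: "both_inc i j x y z \<longleftrightarrow> both_rise e (i + k) (j + k) x y z"
    if "fedge e (i + k) x y" "fedge e (j + k) x z" for i j x y z
  proof -
    have "tame x" "tame y" "tame z" using that fedgeE unfolding maya_def by metis+
    then show ?thesis by (simp add: both_inc_def both_rise_def fock_phi)
  qed
  have up: "closes_up e (i + k) (j + k) x y z"
    if "i \<in> {0..<int e}" "j \<in> {0..<int e}" "i \<noteq> j" "fedge e (i + k) x y" "fedge e (j + k) x z" for i j x y z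
    using closes_up[OF e ne[OF that(1-3)] that(4,5)] .
  have down: "closes_down e (i + k) (j + k) y z"
    if "i \<in> {0..<int e}" "j \<in> {0..<int e}" "i \<noteq> j" "fedge e (i + k) y x" "fedge e (j + k) z x" for i j x y z
    using closes_down[OF e ne[OF that(1-3)] that(4,5)] .
  show ?thesis
  proof (unfold_locales, goal_cases)
    case (1 i x y j z)
    with up[of i j x y z] rise[of i x y j z] show ?case unfolding closes_up_def by blast
  next
    case (2 i x y j z)
    with up[of i j x y z] rise[of i x y j z] show ?case unfolding closes_up_def by blast
  next
    case (3 i x y j z w)
    with up[of i j x y z] rise[of i x y j z] show ?case unfolding closes_up_def by blast
  next
    case (4 i y x j z)
    with down[of i j y x z] show ?case unfolding closes_down_def by blast
  qed
qed

section \<open>Partitions as bead sets\<close>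

lemma part_at_pos: "is_partition l \<Longrightarrow> part_at l i > 0 \<longleftrightarrow> 1 \<le> i \<and> i \<le> length l"
  unfolding is_partition_def part_at_def by (auto simp: in_set_conv_nth)

lemma part_at_antimono:
  assumes "is_partition l" "1 \<le> i" "i \<le> j"
  shows "part_at l j \<le> part_at l i"
proof (cases "i = j \<or> j > length l")
  case True
  then show ?thesis by (auto simp: part_at_def)
next
  case False
  then have "i - 1 < j - 1" "j - 1 < length l" using assms by auto
  then have "l ! (i - 1) \<ge> l ! (j - 1)"
    using assms(1) unfolding is_partition_def by (auto dest: sorted_wrt_nth_less)
  with False assms show ?thesis by (simp add: part_at_def)
qed

lemma diag_iff: "(a, b) \<in> diag l \<longleftrightarrow> 1 \<le> a \<and> 1 \<le> b \<and> b \<le> part_at l a"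
  by (auto simp: diag_def part_at_def)

lemma partition_eqI:
  assumes "is_partition l" "is_partition l'" "\<And>i. 1 \<le> i \<Longrightarrow> part_at l i = part_at l' i"
  shows "l = l'"
proof -
  have "1 \<le> i \<and> i \<le> length l \<longleftrightarrow> 1 \<le> i \<and> i \<le> length l'" for i
    using part_at_pos[OF assms(1), of i] part_at_pos[OF assms(2), of i] assms(3)[of i] by auto
  from this[of "length l"] this[of "length l'"] have "length l = length l'" by (cases l; cases l') auto
  moreover have "l ! i = l' ! i" if "i < length l" for i
    using assms(3)[of "Suc i"] that \<open>length l = length l'\<close> by (simp add: part_at_def)
  ultimately show ?thesis by (simp add: nth_equalityI)
qed

lemma ex_partition:
  assumes anti: "\<And>i j. 1 \<le> i \<Longrightarrow> i \<le> j \<Longrightarrow> g j \<le> (g i :: nat)" and zero: "\<exists>n. g (Suc n) = 0"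
  shows "\<exists>l. is_partition l \<and> (\<forall>i\<ge>1. part_at l i = g i)"
proof -
  define m where "m = (LEAST m. g (Suc m) = 0)"
  have m: "g (Suc m) = 0" "\<And>k. k < m \<Longrightarrow> g (Suc k) \<noteq> 0"
    unfolding m_def using zero by (auto intro: LeastI_ex dest: not_less_Least)
  define l where "l = map g [1..<Suc m]"
  have nth: "l ! k = g (Suc k)" if "k < m" for k using that by (simp add: l_def del: upt_Suc)
  have len: "length l = m" by (simp add: l_def del: upt_Suc)
  have "is_partition l"
    unfolding is_partition_def using m(2) anti nth len
    by (auto simp: sorted_wrt_iff_nth_less in_set_conv_nth)
  moreover have "part_at l i = g i" if "i \<ge> 1" for i
  proof (cases "i \<le> m")
    case True
    with that nth[of "i - 1"] len show ?thesis by (simp add: part_at_def)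
  next
    case False
    with anti[of "Suc m" i] m(1) len show ?thesis by (simp add: part_at_def)
  qed
  ultimately show ?thesis by blast
qed

text \<open>One relation for both kinds of nodes: \<open>x\<close> is addable for \<open>l\<close>
  and removable for \<open>l'\<close>.\<close>

definition grow :: "nat list \<Rightarrow> nat \<times> nat \<Rightarrow> nat list \<Rightarrow> bool" where
  "grow l x l' \<longleftrightarrow> is_partition l \<and> is_partition l' \<and> x \<notin> diag l \<and> diag l' = insert x (diag l)"

lemma grow_iff:
  "grow l x l' \<longleftrightarrow> is_partition l \<and> is_partition l' \<and>
     (\<exists>a\<ge>1. x = (a, part_at l a + 1) \<and> (\<forall>i\<ge>1. part_at l' i = part_at l i + of_bool (i = a)))"
proof (cases "is_partition l \<and> is_partition l'")
  case True
  show ?thesis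
  proof
    assume g: "grow l x l'"
    obtain a b where x: "x = (a, b)" by (cases x)
    have d: "1 \<le> i \<and> 1 \<le> j \<and> j \<le> part_at l' i \<longleftrightarrow> (i = a \<and> j = b) \<or> 1 \<le> i \<and> 1 \<le> j \<and> j \<le> part_at l i" for i j
      using g unfolding grow_def x set_eq_iff by (metis diag_iff insert_iff prod.inject)
    have nd: "\<not> (1 \<le> a \<and> 1 \<le> b \<and> b \<le> part_at l a)" using g unfolding grow_def x diag_iff by blast
    have ab: "1 \<le> a" "1 \<le> b" "b \<le> part_at l' a" using d[of a b] by auto
    have b: "b = part_at l a + 1"
    proof (rule ccontr)
      assume "b \<noteq> part_at l a + 1"
      then show False using d[of a "b - 1"] nd ab by auto
    qed
    have "part_at l' i = part_at l i + of_bool (i = a)" if "i \<ge> 1" for i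
    proof -
      have "j \<le> part_at l' i \<longleftrightarrow> j \<le> part_at l i + of_bool (i = a)" for j
        using d[of i j] that b by (cases "j = 0") auto
      then show ?thesis by (meson order_antisym order_refl)
    qed
    with True ab b x show "is_partition l \<and> is_partition l' \<and>
     (\<exists>a\<ge>1. x = (a, part_at l a + 1) \<and> (\<forall>i\<ge>1. part_at l' i = part_at l i + of_bool (i = a)))" by blast
  next
    assume "is_partition l \<and> is_partition l' \<and>
     (\<exists>a\<ge>1. x = (a, part_at l a + 1) \<and> (\<forall>i\<ge>1. part_at l' i = part_at l i + of_bool (i = a)))"
    then obtain a where a: "a \<ge> 1" "x = (a, part_at l a + 1)"
      "\<And>i. i \<ge> 1 \<Longrightarrow> part_at l' i = part_at l i + of_bool (i = a)" by blast
    have "(i, j) \<in> diag l' \<longleftrightarrow> (i, j) \<in> insert x (diag l)" for i j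
      using a by (cases "i = 0") (auto simp: diag_iff)
    with True a show "grow l x l'" unfolding grow_def by (auto simp: diag_iff)
  qed
qed (auto simp: grow_def)

lemma addable_iff_grow: "is_partition l \<Longrightarrow> addable l x \<longleftrightarrow> (\<exists>l'. grow l x l')"
  by (auto simp: addable_def grow_def)

lemma removable_iff_grow:
  assumes "is_partition l"
  shows "removable l x \<longleftrightarrow> (\<exists>l'. grow l' x l)"
proof
  assume "removable l x"
  then obtain l' where "x \<in> diag l" "is_partition l'" "diag l' = diag l - {x}" by (auto simp: removable_def)
  with assms have "grow l' x l" unfolding grow_def by blast
  then show "\<exists>l'. grow l' x l" by blast
next
  assume "\<exists>l'. grow l' x l"
  then obtain l' where "is_partition l'" "x \<notin> diag l'" "diag l = insert x (diag l')" unfolding grow_def by blast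
  then show "removable l x" unfolding removable_def by auto
qed

text \<open>A beta-set without a size: for \<open>length l \<le> N\<close>, the set
  \<open>beta N l\<close> is the part of this set from \<open>- N\<close> on, moved up by
  \<open>N\<close>.\<close>

definition beads :: "nat list \<Rightarrow> int set" where
  "beads l = {int (part_at l i) - int i | i. i \<ge> 1}"

lemma bead_strict:
  assumes "is_partition l" "1 \<le> i" "i < j"
  shows "int (part_at l j) - int j < int (part_at l i) - int i"
  using part_at_antimono[OF assms(1,2), of j] assms(3) by simp

lemma bead_inj:
  assumes "is_partition l" "1 \<le> i" "1 \<le> j" "int (part_at l i) - int i = int (part_at l j) - int j"
  shows "i = j"
  using bead_strict[OF assms(1,2), of j] bead_strict[OF assms(1,3), of i] assms(4)
  by (cases i j rule: linorder_cases) auto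

text \<open>The rows enumerate the bead set in strictly decreasing order, and such an enumeration is
  determined by the set.\<close>

lemma beads_inject:
  assumes "is_partition l" "is_partition l'" "beads l = beads l'"
  shows "l = l'"
proof (rule partition_eqI[OF assms(1,2)])
  define f where "f i = int (part_at l i) - int i" for i
  define g where "g i = int (part_at l' i) - int i" for i
  have f: "f j < f i" and g: "g j < g i" if "1 \<le> i" "i < j" for i j
    using bead_strict assms(1,2) that unfolding f_def g_def by blast+
  have fg: "\<exists>j\<ge>1. f i = g j" and gf: "\<exists>j\<ge>1. g i = f j" if "i \<ge> 1" for i
    using assms(3) that unfolding beads_def f_def g_def set_eq_iff mem_Collect_eq by metis+
  have "1 \<le> i \<longrightarrow> f i = g i" for i
  proof (induction i rule: less_induct)
    case (less i)
    show ?case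
    proof
      assume i: "1 \<le> i"
      obtain j where j: "j \<ge> 1" "f i = g j" using fg i by blast
      have "j \<ge> i" using less.IH[of j] f[of j i] j by (metis less_irrefl not_le)
      obtain k where k: "k \<ge> 1" "g i = f k" using gf i by blast
      have "k \<ge> i" using less.IH[of k] g[of k i] k by (metis less_irrefl not_le)
      have "f i \<le> g i" using j \<open>j \<ge> i\<close> g[OF i, of j] by (cases "i = j") auto
      moreover have "g i \<le> f i" using k \<open>k \<ge> i\<close> f[OF i, of k] by (cases "i = k") auto
      ultimately show "f i = g i" by simp
    qed
  qed
  then show "part_at l i = part_at l' i" if "1 \<le> i" for i
    using that unfolding f_def g_def by auto
qed

lemma grow_beads:
  assumes "grow l (a, b) l'" "c = int b - int a"
  shows "c - 1 \<in> beads l" "c \<notin> beads l" "beads l' = insert c (beads l - {c - 1})"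
proof -
  have p: "is_partition l" "is_partition l'" and a: "a \<ge> 1" "b = part_at l a + 1"
    and l': "\<And>i. i \<ge> 1 \<Longrightarrow> part_at l' i = part_at l i + of_bool (i = a)"
    using assms(1) unfolding grow_iff by auto
  have c: "c - 1 = int (part_at l a) - int a" "c = int (part_at l' a) - int a" using assms(2) a l' by simp_all
  show "c - 1 \<in> beads l" unfolding beads_def using a c by blast
  have other: "int (part_at l' i) - int i = int (part_at l i) - int i" if "i \<ge> 1" "i \<noteq> a" for i
    using that l' by simp
  show "c \<notin> beads l"
  proof
    assume "c \<in> beads l"
    then obtain i where i: "i \<ge> 1" "c = int (part_at l i) - int i" unfolding beads_def by blast
    then have "i \<noteq> a" using c by auto
    with other[of i] i have "int (part_at l' i) - int i = int (part_at l' a) - int a" using c by simp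
    with bead_inj[OF p(2) i(1) a(1)] \<open>i \<noteq> a\<close> show False by blast
  qed
  show "beads l' = insert c (beads l - {c - 1})"
  proof (intro equalityI subsetI)
    fix z assume "z \<in> beads l'"
    then obtain i where i: "i \<ge> 1" "z = int (part_at l' i) - int i" unfolding beads_def by blast
    show "z \<in> insert c (beads l - {c - 1})"
    proof (cases "i = a")
      case False
      then have "z = int (part_at l i) - int i" using other i by simp
      then show ?thesis using bead_inj[OF p(1) i(1) a(1)] False i(1) c unfolding beads_def by auto
    qed (use i c in simp)
  next
    fix z assume z: "z \<in> insert c (beads l - {c - 1})"
    show "z \<in> beads l'"
    proof (cases "z = c")
      case True
      with a c show ?thesis unfolding beads_def by blast
    next
      case False
      with z obtain i where i: "i \<ge> 1" "z = int (part_at l i) - int i" "z \<noteq> c - 1" unfolding beads_def by blast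
      then have "i \<noteq> a" using c by auto
      then have "z = int (part_at l' i) - int i" using i other by simp
      with i(1) show ?thesis unfolding beads_def by blast
    qed
  qed
qed

text \<open>The row of the bead \<open>c - 1\<close> cannot be extended only if the row above has
  the same length, and then the bead of that row sits at \<open>c\<close>.\<close>

lemma ex_grow_up:
  assumes l: "is_partition l" and c: "c - 1 \<in> beads l" "c \<notin> beads l"
  shows "\<exists>a b l'. grow l (a, b) l' \<and> c = int b - int a"
proof -
  obtain a where a: "a \<ge> 1" "c - 1 = int (part_at l a) - int a" using c unfolding beads_def by blast
  define g where "g i = part_at l i + of_bool (i = a)" for i
  have "g j \<le> g i" if "1 \<le> i" "i \<le> j" for i j
  proof (cases "j = a \<and> i < j")
    case True
    have "part_at l i \<noteq> part_at l a"
    proof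
      assume eq: "part_at l i = part_at l a"
      have i: "i \<le> a - 1" "1 \<le> a - 1" using True that by auto
      then have "part_at l (a - 1) = part_at l a"
        using part_at_antimono[OF l, of i "a - 1"] part_at_antimono[OF l, of "a - 1" a] that eq by simp
      then have "c = int (part_at l (a - 1)) - int (a - 1)" using a i by simp
      with c(2) i show False unfolding beads_def by blast
    qed
    with part_at_antimono[OF l that] True show ?thesis by (auto simp: g_def)
  next
    case False
    with part_at_antimono[OF l that] that show ?thesis by (auto simp: g_def)
  qed
  moreover have "g (Suc (length l + a)) = 0" by (simp add: g_def part_at_def)
  ultimately obtain l' where "is_partition l'" "\<And>i. i \<ge> 1 \<Longrightarrow> part_at l' i = g i"
    using ex_partition[of g] by blast
  then have "grow l (a, part_at l a + 1) l'" using l a unfolding grow_iff g_def by blast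
  with a show ?thesis by (intro exI[of _ a] exI[of _ "part_at l a + 1"]) auto
qed

lemma ex_grow_down:
  assumes l': "is_partition l'" and c: "c \<in> beads l'" "c - 1 \<notin> beads l'"
  shows "\<exists>a b l. grow l (a, b) l' \<and> c = int b - int a"
proof -
  obtain a where a: "a \<ge> 1" "c = int (part_at l' a) - int a" using c unfolding beads_def by blast
  have lt: "part_at l' (Suc a) < part_at l' a"
  proof (rule ccontr)
    assume "\<not> ?thesis"
    then have "part_at l' (Suc a) = part_at l' a" using part_at_antimono[OF l', of a "Suc a"] a by simp
    then have "c - 1 = int (part_at l' (Suc a)) - int (Suc a)" using a by simp
    moreover have "Suc a \<ge> 1" by simp
    ultimately show False using c(2) unfolding beads_def by blast
  qed
  define g where "g i = part_at l' i - of_bool (i = a)" for i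
  have "g j \<le> g i" if "1 \<le> i" "i \<le> j" for i j
  proof (cases "i = a \<and> i < j")
    case True
    then have "part_at l' j \<le> part_at l' (Suc a)" using part_at_antimono[OF l', of "Suc a" j] by simp
    with True lt show ?thesis by (auto simp: g_def)
  next
    case False
    with part_at_antimono[OF l' that] that show ?thesis by (auto simp: g_def)
  qed
  moreover have "g (Suc (length l')) = 0" by (simp add: g_def part_at_def)
  ultimately obtain l where l: "is_partition l" "\<And>i. i \<ge> 1 \<Longrightarrow> part_at l i = g i"
    using ex_partition[of g] by blast
  have "\<forall>i\<ge>1. part_at l' i = part_at l i + of_bool (i = a)" using l(2) lt by (auto simp: g_def)
  with l(1) l' a have "grow l (a, part_at l a + 1) l'" unfolding grow_iff by blast
  moreover have "part_at l a + 1 = part_at l' a" using l(2)[of a] a lt by (simp add: g_def)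
  ultimately show ?thesis using a by (intro exI[of _ a] exI[of _ "part_at l a + 1"]) auto
qed

lemma grow_up_unique:
  assumes "grow l (a, b) l'" "grow l (a', b') l''" "int b - int a = int b' - int a'"
  shows "(a, b) = (a', b')"
  using assms bead_inj[of l a a'] unfolding grow_iff by auto

lemma grow_down_unique:
  assumes "grow l (a, b) l'" "grow l'' (a', b') l'" "int b - int a = int b' - int a'"
  shows "(a, b) = (a', b')"
proof -
  have "b = part_at l' a" "b' = part_at l' a'" "1 \<le> a" "1 \<le> a'" "is_partition l'"
    using assms(1,2) unfolding grow_iff by auto
  with bead_inj[of l' a a'] assms(3) show ?thesis by auto
qed

lemma beads_cofinite:
  "(\<exists>N. \<forall>u\<le>N. u \<in> beads l) \<and> (\<exists>N. \<forall>u\<ge>N. u \<notin> beads l)" if "is_partition l"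
proof
  have "u \<in> beads l" if "u \<le> - int (length l) - 1" for u
  proof -
    have "nat (- u) > length l" using that by simp
    then have "u = int (part_at l (nat (- u))) - int (nat (- u))" "nat (- u) \<ge> 1" using that by (simp_all add: part_at_def)
    then show ?thesis unfolding beads_def by blast
  qed
  then show "\<exists>N. \<forall>u\<le>N. u \<in> beads l" by blast
  have "u \<notin> beads l" if "u \<ge> int (part_at l 1)" for u
    using that part_at_antimono[OF \<open>is_partition l\<close>, of 1] unfolding beads_def by fastforce
  then show "\<exists>N. \<forall>u\<ge>N. u \<notin> beads l" by blast
qed

section \<open>The crystal graph in terms of bead configurations\<close>

text \<open>Even places belong to the second component and odd ones to the first. At equal content
  the second component thus comes first, which is the tie-breaking rule for signature words.\<close>

definition bconf :: "int \<times> int \<Rightarrow> bipartition \<Rightarrow> int \<Rightarrow> int" where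
  "bconf d \<nu> u = of_bool (if even u then u div 2 - snd d \<in> beads (snd \<nu>)
                           else u div 2 - fst d \<in> beads (fst \<nu>))"

definition pos :: "int \<times> int \<Rightarrow> bnode \<Rightarrow> int" where
  "pos d x = 2 * content d x + of_bool (snd (snd x) = 1)"

definition bgrow :: "bipartition \<Rightarrow> bnode \<Rightarrow> bipartition \<Rightarrow> bool" where
  "bgrow \<nu> x \<nu>' \<longleftrightarrow> is_bipartition \<nu> \<and> is_bipartition \<nu>' \<and> x \<notin> bnodes \<nu> \<and> bnodes \<nu>' = insert x (bnodes \<nu>)"

lemma bnodes_iff: "(a, b, j) \<in> bnodes \<nu> \<longleftrightarrow> j = 1 \<and> (a, b) \<in> diag (fst \<nu>) \<or> j = 2 \<and> (a, b) \<in> diag (snd \<nu>)"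
  by (auto simp: bnodes_def comp_of_def)

lemma diag_inject: "is_partition l \<Longrightarrow> is_partition l' \<Longrightarrow> diag l = diag l' \<Longrightarrow> l = l'"
proof (rule partition_eqI)
  fix i :: nat assume "diag l = diag l'" "1 \<le> i"
  then have "j \<le> part_at l i \<longleftrightarrow> j \<le> part_at l' i" for j
    using diag_iff[of i j l] diag_iff[of i j l'] by (cases "j = 0") auto
  then show "part_at l i = part_at l' i" by (meson order_antisym order_refl)
qed

lemma bgrow_iff:
  "bgrow \<nu> (a, b, j) \<nu>' \<longleftrightarrow> is_bipartition \<nu> \<and> is_bipartition \<nu>' \<and>
     (j = 1 \<and> grow (fst \<nu>) (a, b) (fst \<nu>') \<and> snd \<nu>' = snd \<nu> \<or>
      j = 2 \<and> grow (snd \<nu>) (a, b) (snd \<nu>') \<and> fst \<nu>' = fst \<nu>)"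
proof (cases "is_bipartition \<nu> \<and> is_bipartition \<nu>'")
  case True
  then have p: "is_partition (fst \<nu>)" "is_partition (snd \<nu>)" "is_partition (fst \<nu>')" "is_partition (snd \<nu>')"
    by (auto simp: is_bipartition_def)
  have eq: "bnodes \<nu>' = insert (a, b, j) (bnodes \<nu>) \<longleftrightarrow> (j = 1 \<or> j = 2) \<and>
     diag (fst \<nu>') = (if j = 1 then insert (a, b) (diag (fst \<nu>)) else diag (fst \<nu>)) \<and>
     diag (snd \<nu>') = (if j = 2 then insert (a, b) (diag (snd \<nu>)) else diag (snd \<nu>))" (is "?L \<longleftrightarrow> ?R")
  proof
    assume L: ?L
    have m: "(a', b', j') \<in> bnodes \<nu>' \<longleftrightarrow> (a' = a \<and> b' = b \<and> j' = j) \<or> (a', b', j') \<in> bnodes \<nu>" for a' b' j'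
      using L by auto
    have "j = 1 \<or> j = 2" using m[of a b j] by (auto simp: bnodes_iff)
    moreover have "(a', b') \<in> diag (fst \<nu>') \<longleftrightarrow> (j = 1 \<and> a' = a \<and> b' = b) \<or> (a', b') \<in> diag (fst \<nu>)" for a' b'
      using m[of a' b' 1] by (auto simp: bnodes_iff)
    moreover have "(a', b') \<in> diag (snd \<nu>') \<longleftrightarrow> (j = 2 \<and> a' = a \<and> b' = b) \<or> (a', b') \<in> diag (snd \<nu>)" for a' b'
      using m[of a' b' 2] by (auto simp: bnodes_iff)
    ultimately show ?R by auto
  next
    assume ?R
    then have "(a', b', j') \<in> bnodes \<nu>' \<longleftrightarrow> (a', b', j') \<in> insert (a, b, j) (bnodes \<nu>)" for a' b' j'
      by (auto simp: bnodes_iff)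
    then show ?L by auto
  qed
  show ?thesis
    unfolding bgrow_def eq grow_def using True p diag_inject by (auto simp: bnodes_iff)
qed (auto simp: bgrow_def)

lemma grow_partition: "grow l x l' \<Longrightarrow> is_partition l \<and> is_partition l'"
  by (simp add: grow_def)

lemma baddable_iff: "is_bipartition \<nu> \<Longrightarrow> baddable \<nu> x \<longleftrightarrow> (\<exists>\<nu>'. bgrow \<nu> x \<nu>')"
proof -
  assume b: "is_bipartition \<nu>"
  obtain a c j where x: "x = (a, c, j)" by (cases x) auto
  have p: "is_partition (fst \<nu>)" "is_partition (snd \<nu>)" using b by (auto simp: is_bipartition_def)
  show ?thesis
    unfolding x baddable_def bgrow_iff comp_of_def is_bipartition_def
    using p addable_iff_grow[of "fst \<nu>" "(a, c)"] addable_iff_grow[of "snd \<nu>" "(a, c)"] by auto (use grow_partition in blast)+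
qed

lemma bremovable_iff: "is_bipartition \<nu> \<Longrightarrow> bremovable \<nu> x \<longleftrightarrow> (\<exists>\<nu>'. bgrow \<nu>' x \<nu>)"
proof -
  assume b: "is_bipartition \<nu>"
  obtain a c j where x: "x = (a, c, j)" by (cases x) auto
  have p: "is_partition (fst \<nu>)" "is_partition (snd \<nu>)" using b by (auto simp: is_bipartition_def)
  show ?thesis
    unfolding x bremovable_def bgrow_iff comp_of_def is_bipartition_def
    using p removable_iff_grow[of "fst \<nu>" "(a, c)"] removable_iff_grow[of "snd \<nu>" "(a, c)"] by auto (use grow_partition in blast)+
qed

lemma pos_simps:
  "pos d (a, b, 1) = 2 * (int b - int a + fst d) + 1"
  "pos d (a, b, 2) = 2 * (int b - int a + snd d)"
  by (simp_all add: pos_def content_def)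

lemma pos_div2: "pos d x div 2 = content d x"
  by (simp add: pos_def)

lemma bgrow_conf:
  assumes "bgrow \<nu> x \<nu>'"
  shows "bconf d \<nu> (pos d x - 2) = 1" "bconf d \<nu> (pos d x) = 0"
    "bconf d \<nu>' = shift (pos d x - 2) (pos d x) (bconf d \<nu>)"
proof -
  obtain a b j where x: "x = (a, b, j)" by (cases x) auto
  define c where "c = int b - int a"
  have count: "(of_bool (w \<in> beads l') :: int) = of_bool (w \<in> beads l) + of_bool (w = c) - of_bool (w = c - 1)"
    if "grow l (a, b) l'" for l l' w
    using grow_beads[OF that c_def] by auto
  consider (1) "j = 1" "grow (fst \<nu>) (a, b) (fst \<nu>')" "snd \<nu>' = snd \<nu>"
    | (2) "j = 2" "grow (snd \<nu>) (a, b) (snd \<nu>')" "fst \<nu>' = fst \<nu>"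
    using assms unfolding x bgrow_iff by blast
  then have "bconf d \<nu> (pos d x - 2) = 1 \<and> bconf d \<nu> (pos d x) = 0 \<and>
    (\<forall>u. bconf d \<nu>' u = shift (pos d x - 2) (pos d x) (bconf d \<nu>) u)"
  proof cases
    case 1
    note g = grow_beads[OF 1(2) c_def]
    have k: "pos d x = 2 * (c + fst d) + 1" by (simp add: x 1 pos_def content_def c_def)
    have "u = pos d x \<longleftrightarrow> odd u \<and> u div 2 - fst d = c"
      "u = pos d x - 2 \<longleftrightarrow> odd u \<and> u div 2 - fst d = c - 1" for u
      unfolding k by presburger+
    then have "bconf d \<nu>' u = shift (pos d x - 2) (pos d x) (bconf d \<nu>) u" for u
      using count[OF 1(2), of "u div 2 - fst d"] 1(3) by (simp add: shift_def bconf_def)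
    moreover have at: "(pos d x - 2) div 2 - fst d = c - 1" "pos d x div 2 - fst d = c"
      "\<not> even (pos d x - 2)" "\<not> even (pos d x)"
      unfolding k by presburger+
    have "bconf d \<nu> (pos d x - 2) = of_bool (c - 1 \<in> beads (fst \<nu>))"
      "bconf d \<nu> (pos d x) = of_bool (c \<in> beads (fst \<nu>))"
      by (simp_all only: bconf_def at if_False simp_thms)
    ultimately show ?thesis using g(1,2) by simp
  next
    case 2
    note g = grow_beads[OF 2(2) c_def]
    have k: "pos d x = 2 * (c + snd d)" by (simp add: x 2 pos_def content_def c_def)
    have "u = pos d x \<longleftrightarrow> even u \<and> u div 2 - snd d = c"
      "u = pos d x - 2 \<longleftrightarrow> even u \<and> u div 2 - snd d = c - 1" for u
      unfolding k by presburger+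
    then have "bconf d \<nu>' u = shift (pos d x - 2) (pos d x) (bconf d \<nu>) u" for u
      using count[OF 2(2), of "u div 2 - snd d"] 2(3) by (simp add: shift_def bconf_def)
    moreover have at: "(pos d x - 2) div 2 - snd d = c - 1" "pos d x div 2 - snd d = c"
      "even (pos d x - 2)" "even (pos d x)"
      unfolding k by presburger+
    have "bconf d \<nu> (pos d x - 2) = of_bool (c - 1 \<in> beads (snd \<nu>))"
      "bconf d \<nu> (pos d x) = of_bool (c \<in> beads (snd \<nu>))"
      by (simp_all only: bconf_def at if_True)
    ultimately show ?thesis using g(1,2) by simp
  qed
  then show "bconf d \<nu> (pos d x - 2) = 1" "bconf d \<nu> (pos d x) = 0"
    "bconf d \<nu>' = shift (pos d x - 2) (pos d x) (bconf d \<nu>)" by auto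
qed

lemma div2_minus2: "(p - 2) div 2 = p div 2 - (1 :: int)"
  by simp

lemma ex_bgrow_up:
  assumes b: "is_bipartition \<nu>" and "bconf d \<nu> (p - 2) = 1" "bconf d \<nu> p = 0"
  shows "\<exists>x \<nu>'. bgrow \<nu> x \<nu>' \<and> pos d x = p"
proof (cases "even p")
  case True
  define c where "c = p div 2 - snd d"
  have "c - 1 \<in> beads (snd \<nu>)" "c \<notin> beads (snd \<nu>)"
    using assms True by (auto simp: bconf_def c_def div2_minus2 algebra_simps)
  with b obtain a k l' where g: "grow (snd \<nu>) (a, k) l'" "c = int k - int a"
    using ex_grow_up[of "snd \<nu>" c] by (auto simp: is_bipartition_def)
  then have "bgrow \<nu> (a, k, 2) (fst \<nu>, l')"
    using b by (auto simp: bgrow_iff is_bipartition_def grow_def)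
  moreover have "pos d (a, k, 2) = p" using g True unfolding pos_simps c_def by (auto elim!: evenE)
  ultimately show ?thesis by blast
next
  case False
  define c where "c = p div 2 - fst d"
  have "c - 1 \<in> beads (fst \<nu>)" "c \<notin> beads (fst \<nu>)"
    using assms False by (auto simp: bconf_def c_def div2_minus2 algebra_simps)
  with b obtain a k l' where g: "grow (fst \<nu>) (a, k) l'" "c = int k - int a"
    using ex_grow_up[of "fst \<nu>" c] by (auto simp: is_bipartition_def)
  then have "bgrow \<nu> (a, k, 1) (l', snd \<nu>)"
    using b by (auto simp: bgrow_iff is_bipartition_def grow_def)
  moreover have "pos d (a, k, 1) = p" using g False unfolding pos_simps c_def by (auto elim!: oddE)
  ultimately show ?thesis by blast
qed

lemma ex_bgrow_down:
  assumes b: "is_bipartition \<nu>" and "bconf d \<nu> (p - 2) = 0" "bconf d \<nu> p = 1"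
  shows "\<exists>x \<nu>'. bgrow \<nu>' x \<nu> \<and> pos d x = p"
proof (cases "even p")
  case True
  define c where "c = p div 2 - snd d"
  have "c - 1 \<notin> beads (snd \<nu>)" "c \<in> beads (snd \<nu>)"
    using assms True by (auto simp: bconf_def c_def div2_minus2 algebra_simps)
  with b obtain a k l' where g: "grow l' (a, k) (snd \<nu>)" "c = int k - int a"
    using ex_grow_down[of "snd \<nu>" c] by (auto simp: is_bipartition_def)
  then have "bgrow (fst \<nu>, l') (a, k, 2) \<nu>"
    using b by (auto simp: bgrow_iff is_bipartition_def grow_def)
  moreover have "pos d (a, k, 2) = p" using g True unfolding pos_simps c_def by (auto elim!: evenE)
  ultimately show ?thesis by blast
next
  case False
  define c where "c = p div 2 - fst d"
  have "c - 1 \<notin> beads (fst \<nu>)" "c \<in> beads (fst \<nu>)"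
    using assms False by (auto simp: bconf_def c_def div2_minus2 algebra_simps)
  with b obtain a k l' where g: "grow l' (a, k) (fst \<nu>)" "c = int k - int a"
    using ex_grow_down[of "fst \<nu>" c] by (auto simp: is_bipartition_def)
  then have "bgrow (l', snd \<nu>) (a, k, 1) \<nu>"
    using b by (auto simp: bgrow_iff is_bipartition_def grow_def)
  moreover have "pos d (a, k, 1) = p" using g False unfolding pos_simps c_def by (auto elim!: oddE)
  ultimately show ?thesis by blast
qed

lemma pos_parity: "bgrow \<nu> (a, b, j) \<nu>' \<Longrightarrow> (j = 1 \<longleftrightarrow> odd (pos d (a, b, j))) \<and> (j = 2 \<longleftrightarrow> even (pos d (a, b, j)))"
  by (auto simp: bgrow_iff pos_def)

lemma bgrow_up_unique:
  assumes "bgrow \<nu> x \<nu>'" "bgrow \<nu> y \<nu>''" "pos d x = pos d y"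
  shows "x = y"
proof -
  obtain a b j a' b' j' where x: "x = (a, b, j)" and y: "y = (a', b', j')" by (cases x; cases y) auto
  have jj: "j = j'" "j = 1 \<or> j = 2"
    using pos_parity[of \<nu> a b j \<nu>' d] pos_parity[of \<nu> a' b' j' \<nu>'' d] assms x y
    by (auto simp: bgrow_iff)
  have "int b - int a = int b' - int a'" using assms(3) jj by (auto simp: x y pos_def content_def)
  then show ?thesis using assms(1,2) jj grow_up_unique unfolding x y bgrow_iff by auto
qed

lemma bgrow_down_unique:
  assumes "bgrow \<nu>' x \<nu>" "bgrow \<nu>'' y \<nu>" "pos d x = pos d y"
  shows "x = y"
proof -
  obtain a b j a' b' j' where x: "x = (a, b, j)" and y: "y = (a', b', j')" by (cases x; cases y) auto
  have jj: "j = j'" "j = 1 \<or> j = 2"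
    using pos_parity[of \<nu>' a b j \<nu> d] pos_parity[of \<nu>'' a' b' j' \<nu> d] assms x y
    by (auto simp: bgrow_iff)
  have "int b - int a = int b' - int a'" using assms(3) jj by (auto simp: x y pos_def content_def)
  then show ?thesis using assms(1,2) jj grow_down_unique unfolding x y bgrow_iff by auto
qed

lemma bconf_inject:
  assumes "is_bipartition \<nu>" "is_bipartition \<nu>'" "bconf d \<nu> = bconf d \<nu>'"
  shows "\<nu> = \<nu>'"
proof -
  have "c \<in> beads (snd \<nu>) \<longleftrightarrow> c \<in> beads (snd \<nu>')" for c
    using fun_cong[OF assms(3), of "2 * (c + snd d)"] by (simp add: bconf_def of_bool_def split: if_splits)
  moreover have "c \<in> beads (fst \<nu>) \<longleftrightarrow> c \<in> beads (fst \<nu>')" for c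
    using fun_cong[OF assms(3), of "2 * (c + fst d) + 1"] by (simp add: bconf_def of_bool_def split: if_splits)
  ultimately show ?thesis using assms(1,2) beads_inject
    unfolding is_bipartition_def by (metis prod_eqI set_eqI)
qed

lemma maya_bconf:
  assumes "is_bipartition \<nu>"
  shows "maya (bconf d \<nu>)"
proof -
  obtain M1 N1 M2 N2 where
    h: "\<And>u. u \<le> M1 \<Longrightarrow> u \<in> beads (fst \<nu>)" "\<And>u. u \<ge> N1 \<Longrightarrow> u \<notin> beads (fst \<nu>)"
       "\<And>u. u \<le> M2 \<Longrightarrow> u \<in> beads (snd \<nu>)" "\<And>u. u \<ge> N2 \<Longrightarrow> u \<notin> beads (snd \<nu>)"
    using assms beads_cofinite[of "fst \<nu>"] beads_cofinite[of "snd \<nu>"] unfolding is_bipartition_def by metis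
  have "\<forall>u\<le>2 * min (M1 + fst d) (M2 + snd d). bconf d \<nu> u = 1"
  proof (intro allI impI)
    fix u assume "u \<le> 2 * min (M1 + fst d) (M2 + snd d)"
    then have "u div 2 \<le> min (M1 + fst d) (M2 + snd d)" by presburger
    with h show "bconf d \<nu> u = 1" by (auto simp: bconf_def)
  qed
  moreover have "\<forall>u\<ge>2 * max (N1 + fst d) (N2 + snd d). bconf d \<nu> u = 0"
  proof (intro allI impI)
    fix u assume "u \<ge> 2 * max (N1 + fst d) (N2 + snd d)"
    then have "u div 2 \<ge> max (N1 + fst d) (N2 + snd d)" by presburger
    with h show "bconf d \<nu> u = 0" by (auto simp: bconf_def)
  qed
  ultimately have "tame (bconf d \<nu>)" unfolding tame_def by blast
  then show ?thesis by (auto simp: maya_def bconf_def)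
qed

text \<open>The cancellation procedure: the number of surviving letters A is the maximum of the prefix sums
  of the signature, and the last of them is where this maximum is reached first.\<close>

definition sgn_of :: "'a \<times> bool \<Rightarrow> int" where
  "sgn_of x = (if snd x then 1 else - 1)"

definition hsum :: "('a \<times> bool) list \<Rightarrow> int" where
  "hsum w = sum_list (map sgn_of w)"

lemma hsum_simps [simp]: "hsum [] = 0" "hsum (x # w) = sgn_of x + hsum w" "hsum (u @ v) = hsum u + hsum v"
  by (simp_all add: hsum_def)

lemma cancelRA_form:
  "\<exists>as rs. cancelRA w = as @ rs \<and> (\<forall>a\<in>set as. snd a) \<and> (\<forall>r\<in>set rs. \<not> snd r)"
proof (induction w)
  case (Cons x w)
  then obtain as rs where w: "cancelRA w = as @ rs" "\<forall>a\<in>set as. snd a" "\<forall>r\<in>set rs. \<not> snd r" by blast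
  show ?case
  proof (cases "snd x")
    case True
    then show ?thesis using w by (intro exI[of _ "x # as"] exI[of _ rs]) auto
  next
    case False
    show ?thesis
    proof (cases as)
      case Nil
      then show ?thesis using w False by (intro exI[of _ "[]"] exI[of _ "x # rs"]) (auto simp: Let_def)
    next
      case (Cons a as')
      then show ?thesis using w False by (intro exI[of _ as'] exI[of _ rs]) (auto simp: Let_def)
    qed
  qed
qed simp

text \<open>The reduced word begins with its letters A. A new R in front therefore cancels the first
  of them, and if there is none it survives without changing the list of letters A, in agreement
  with \<open>tl [] = []\<close>.\<close>

lemma cancelRA_filter:
  "filter snd (cancelRA (x # w)) =
    (if snd x then x # filter snd (cancelRA w) else tl (filter snd (cancelRA w)))"
proof -
  obtain as rs where w: "cancelRA w = as @ rs" "\<forall>a\<in>set as. snd a" "\<forall>r\<in>set rs. \<not> snd r"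
    using cancelRA_form by blast
  then have f: "filter snd as = as" "filter snd rs = []" by (auto simp: filter_empty_conv)
  show ?thesis
    using w f by (cases as; cases "snd x"; cases rs) (auto simp: Let_def)
qed

lemma cancelRA_prefix_le: "hsum (take n w) \<le> int (length (filter snd (cancelRA w)))"
proof (induction w arbitrary: n)
  case (Cons x w)
  show ?case
  proof (cases n)
    case (Suc m)
    with Cons[of m] show ?thesis
      unfolding cancelRA_filter by (cases "filter snd (cancelRA w) = []") (auto simp: sgn_of_def)
  qed simp
qed simp

lemma cancelRA_last:
  assumes "filter snd (cancelRA w) \<noteq> []"
  shows "\<exists>u v. w = u @ last (filter snd (cancelRA w)) # v \<and>
    hsum (u @ [last (filter snd (cancelRA w))]) = int (length (filter snd (cancelRA w))) \<and>
    (\<forall>n\<le>length u. hsum (take n u) < int (length (filter snd (cancelRA w))))"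
  using assms
proof (induction w)
  case (Cons x w)
  let ?C = "filter snd (cancelRA w)" and ?D = "filter snd (cancelRA (x # w))"
  show ?case
  proof (cases "?C = []")
    case True
    then have "?D = [x]" "snd x" using Cons.prems unfolding cancelRA_filter by (auto split: if_splits)
    then show ?thesis by (intro exI[of _ "[]"] exI[of _ w]) (auto simp: sgn_of_def)
  next
    case False
    with Cons.IH obtain u v where uv: "w = u @ last ?C # v" "hsum (u @ [last ?C]) = int (length ?C)"
      "\<And>n. n \<le> length u \<Longrightarrow> hsum (take n u) < int (length ?C)" by blast
    have D: "last ?D = last ?C" "int (length ?D) = sgn_of x + int (length ?C)"
      using False Cons.prems unfolding cancelRA_filter
      by (auto simp: sgn_of_def last_tl of_nat_diff Suc_le_eq split: if_splits)
    \<comment> \<open>This serves the empty prefix, whose sum 0 must lie below the number of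
      surviving letters A.\<close>
    then have pos: "0 < sgn_of x + int (length ?C)"
      using Cons.prems by (metis length_greater_0_conv of_nat_0_less_iff)
    have "hsum (take n (x # u)) < int (length ?D)" if "n \<le> length (x # u)" for n
      using that D pos uv(3)[of "n - 1"] by (cases n) (auto simp del: cancelRA.simps)
    then show ?thesis using uv D by (intro exI[of _ "x # u"] exI[of _ v]) (auto simp del: cancelRA.simps)
  qed
qed simp


section \<open>Signature words and profiles\<close>

lemma baddable_conf:
  assumes "is_bipartition \<nu>" "baddable \<nu> x"
  shows "bconf d \<nu> (pos d x - 2) = 1" "bconf d \<nu> (pos d x) = 0"
  using assms bgrow_conf unfolding baddable_iff[OF assms(1)] by blast+

lemma bremovable_conf:
  assumes "is_bipartition \<nu>" "bremovable \<nu> x"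
  shows "bconf d \<nu> (pos d x - 2) = 0" "bconf d \<nu> (pos d x) = 1"
proof -
  obtain \<nu>' where "bgrow \<nu>' x \<nu>" using assms unfolding bremovable_iff[OF assms(1)] by blast
  from bgrow_conf[OF this, of d] show "bconf d \<nu> (pos d x - 2) = 0" "bconf d \<nu> (pos d x) = 1"
    by (auto simp: shift_def)
qed

lemma residue_eq_iff:
  assumes "0 \<le> i" "i < int e"
  shows "residue e d x = i \<longleftrightarrow> res e i (pos d x)"
proof -
  have "i mod int e = i" using assms by simp
  then show ?thesis unfolding residue_def res_def pos_div2 by (metis mod_eq_dvd_iff)
qed

abbreviation key :: "int \<times> int \<Rightarrow> bnode \<times> bool \<Rightarrow> int" where
  "key d z \<equiv> pos d (fst z)"

lemma inodes_jump:
  assumes "is_bipartition \<nu>" "0 \<le> i" "i < int e" "z \<in> inodes e d i \<nu>"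
  shows "jump e i (bconf d \<nu>) (key d z) = sgn_of z"
  using assms(4) baddable_conf[OF assms(1), of _ d] bremovable_conf[OF assms(1), of _ d]
    residue_eq_iff[OF assms(2,3), of d]
  unfolding inodes_def by (auto simp: jump_def sgn_of_def)

text \<open>The sign of the jump at a place tells whether its node is addable or removable, and for
  either kind the place determines the node.\<close>

lemma inodes_key_inj:
  assumes b: "is_bipartition \<nu>" and i: "0 \<le> i" "i < int e"
  shows "inj_on (key d) (inodes e d i \<nu>)"
proof (rule inj_onI)
  fix z z' assume z: "z \<in> inodes e d i \<nu>" "z' \<in> inodes e d i \<nu>" "key d z = key d z'"
  then have "sgn_of z = sgn_of z'" using inodes_jump[OF b i] by metis
  then have s: "snd z = snd z'" by (auto simp: sgn_of_def split: if_splits)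
  have "fst z = fst z'"
  proof (cases "snd z")
    case True
    then have "baddable \<nu> (fst z)" "baddable \<nu> (fst z')" using z s by (auto simp: inodes_def)
    then show ?thesis using bgrow_up_unique z(3) unfolding baddable_iff[OF b] by blast
  next
    case False
    then have "bremovable \<nu> (fst z)" "bremovable \<nu> (fst z')" using z s by (auto simp: inodes_def)
    then show ?thesis using bgrow_down_unique z(3) unfolding bremovable_iff[OF b] by blast
  qed
  with s show "z = z'" by (simp add: prod_eq_iff)
qed

lemma inodes_key_image:
  assumes b: "is_bipartition \<nu>" and i: "0 \<le> i" "i < int e"
  shows "key d ` inodes e d i \<nu> = {u. jump e i (bconf d \<nu>) u \<noteq> 0}"
proof (intro equalityI subsetI)
  fix u assume "u \<in> key d ` inodes e d i \<nu>"
  then obtain z where "z \<in> inodes e d i \<nu>" "u = key d z" by blast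
  then have "jump e i (bconf d \<nu>) u = sgn_of z" using inodes_jump[OF b i] by blast
  then show "u \<in> {u. jump e i (bconf d \<nu>) u \<noteq> 0}" by (simp add: sgn_of_def)
next
  fix u assume "u \<in> {u. jump e i (bconf d \<nu>) u \<noteq> 0}"
  then have r: "res e i u" and ne: "bconf d \<nu> (u - 2) \<noteq> bconf d \<nu> u"
    by (auto simp: jump_def split: if_splits)
  have "bconf d \<nu> (u - 2) = 1 \<and> bconf d \<nu> u = 0 \<or> bconf d \<nu> (u - 2) = 0 \<and> bconf d \<nu> u = 1"
    using ne unfolding bconf_def of_bool_def by presburger
  then show "u \<in> key d ` inodes e d i \<nu>"
  proof (elim disjE conjE)
    assume "bconf d \<nu> (u - 2) = 1" "bconf d \<nu> u = 0"
    then obtain x where "baddable \<nu> x" "pos d x = u"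
      using ex_bgrow_up[OF b] baddable_iff[OF b] by blast
    moreover from this have "residue e d x = i" using r residue_eq_iff[OF i] by simp
    ultimately have "(x, True) \<in> inodes e d i \<nu>" "key d (x, True) = u"
      unfolding inodes_def by (blast, simp)
    then show ?thesis by blast
  next
    assume "bconf d \<nu> (u - 2) = 0" "bconf d \<nu> u = 1"
    then obtain x where "bremovable \<nu> x" "pos d x = u"
      using ex_bgrow_down[OF b] bremovable_iff[OF b] by blast
    moreover from this have "residue e d x = i" using r residue_eq_iff[OF i] by simp
    ultimately have "(x, False) \<in> inodes e d i \<nu>" "key d (x, False) = u"
      unfolding inodes_def by (blast, simp)
    then show ?thesis by blast
  qed
qed

lemma finite_inodes:
  assumes "is_bipartition \<nu>" "0 \<le> i" "i < int e"
  shows "finite (inodes e d i \<nu>)"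
proof -
  have "tame (bconf d \<nu>)" using maya_bconf[OF assms(1)] by (simp add: maya_def)
  then show ?thesis
    using finite_imageD[OF _ inodes_key_inj[OF assms]] finite_jump unfolding inodes_key_image[OF assms] by blast
qed

text \<open>For components 1 and 2, comparing content and \<open>- j\<close> lexicographically is
  comparing places. Distinct letters have distinct places, so the order is strict.\<close>

lemma iword_props:
  assumes b: "is_bipartition \<nu>" and i: "0 \<le> i" "i < int e"
  shows "set (iword e d i \<nu>) = inodes e d i \<nu>" "sorted_wrt (\<lambda>y z. key d y < key d z) (iword e d i \<nu>)"
proof -
  let ?f = "\<lambda>(x, _). (content d x, - int (snd (snd x)))" and ?S = "inodes e d i \<nu>"
  let ?w = "iword e d i \<nu>"
  show set: "set ?w = ?S" using finite_inodes[OF assms] by (simp add: iword_def)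
  have "distinct ?w" by (simp add: iword_def)
  have "sorted (map ?f ?w)" by (simp add: iword_def)
  then have *: "?f (?w ! m) \<le> ?f (?w ! n)" if "m < n" "n < length ?w" for m n
    using that sorted_nth_mono[of "map ?f ?w" m n] by simp
  have mono: "key d y \<le> key d z" if "?f y \<le> ?f z" "y \<in> ?S" "z \<in> ?S" for y z
  proof -
    have j: "snd (snd (fst y)) \<in> {1, 2}" "snd (snd (fst z)) \<in> {1, 2}"
      using that(2,3) by (auto simp: inodes_def baddable_def bremovable_def)
    from that(1) have "content d (fst y) < content d (fst z) \<or>
        content d (fst y) = content d (fst z) \<and> snd (snd (fst z)) \<le> snd (snd (fst y))"
      by (auto simp: case_prod_beta less_eq_prod_def)
    with j show ?thesis by (auto simp: pos_def)
  qed
  show "sorted_wrt (\<lambda>y z. key d y < key d z) ?w"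
    unfolding sorted_wrt_iff_nth_less
  proof (intro allI impI)
    fix m n assume mn: "m < n" "n < length ?w"
    then have mem: "?w ! m \<in> ?S" "?w ! n \<in> ?S" using set nth_mem[of m ?w] nth_mem[of n ?w] by auto
    have "?w ! m \<noteq> ?w ! n" using \<open>distinct ?w\<close> mn by (simp add: nth_eq_iff_index_eq)
    then have "key d (?w ! m) \<noteq> key d (?w ! n)" using inodes_key_inj[OF assms, where d = d] mem by (meson inj_onD)
    with mono[OF *[OF mn] mem] show "key d (?w ! m) < key d (?w ! n)" by simp
  qed
qed

lemma profile_prefix:
  assumes b: "is_bipartition \<nu>" and i: "0 \<le> i" "i < int e"
  shows "profile e i (bconf d \<nu>) k = hsum (filter (\<lambda>z. key d z \<le> k) (iword e d i \<nu>))"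
proof -
  let ?w = "iword e d i \<nu>" and ?S = "{z \<in> inodes e d i \<nu>. key d z \<le> k}"
  have "distinct ?w" by (simp add: iword_def)
  then have "hsum (filter (\<lambda>z. key d z \<le> k) ?w) = sum sgn_of ?S"
    unfolding hsum_def using iword_props(1)[OF assms]
    by (simp add: sum_list_distinct_conv_sum_set)
  also have "\<dots> = sum (\<lambda>z. jump e i (bconf d \<nu>) (key d z)) ?S"
    using inodes_jump[OF assms] by (intro sum.cong) auto
  also have "\<dots> = sum (jump e i (bconf d \<nu>)) (key d ` ?S)"
    using inj_on_subset[OF inodes_key_inj[OF assms, where d = d], of ?S] by (subst sum.reindex) auto
  also have "key d ` ?S = {u. u \<le> k \<and> jump e i (bconf d \<nu>) u \<noteq> 0}"
  proof -
    have "key d ` ?S = {u \<in> key d ` inodes e d i \<nu>. u \<le> k}" by blast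
    then show ?thesis unfolding inodes_key_image[OF assms] by blast
  qed
  finally show ?thesis by (simp add: profile_def)
qed

lemma filter_le_take:
  assumes "sorted_wrt (\<lambda>y z. f y < (f z :: int)) w"
  shows "\<exists>n\<le>length w. filter (\<lambda>z. f z \<le> k) w = take n w"
  using assms
proof (induction w)
  case (Cons x w)
  then obtain n where n: "n \<le> length w" "filter (\<lambda>z. f z \<le> k) w = take n w" by auto
  show ?case
  proof (cases "f x \<le> k")
    case True
    with n show ?thesis by (intro exI[of _ "Suc n"]) auto
  next
    case False
    then have "filter (\<lambda>z. f z \<le> k) (x # w) = []" using Cons.prems by (fastforce simp: filter_empty_conv)
    then show ?thesis by (intro exI[of _ 0]) auto
  qed
qed simp

lemma good_add_firstmax:
  assumes b: "is_bipartition \<nu>" and i: "0 \<le> i" "i < int e" and g: "good_add e d i \<nu> = Some x"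
  shows "baddable \<nu> x" "firstmax (profile e i (bconf d \<nu>)) (pos d x)"
proof -
  let ?w = "iword e d i \<nu>"
  let ?C = "filter snd (cancelRA ?w)"
  note P = profile_prefix[OF b i, of d] and W = iword_props[OF b i, of d]
  have C: "?C \<noteq> []" "x = fst (last ?C)" using g by (auto simp: good_add_def Let_def split: if_splits)
  have "snd (last ?C)" using last_in_set[OF C(1)] by auto
  with C have x: "last ?C = (x, True)" by (simp add: prod_eq_iff)
  from cancelRA_last[OF C(1)] obtain u v where uv: "?w = u @ (x, True) # v"
    "hsum (u @ [(x, True)]) = int (length ?C)" "\<And>n. n \<le> length u \<Longrightarrow> hsum (take n u) < int (length ?C)"
    unfolding x by blast
  have "(x, True) \<in> inodes e d i \<nu>" using W(1) uv(1) by auto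
  then show "baddable \<nu> x" by (auto simp: inodes_def)
  have s: "sorted_wrt (\<lambda>y z. key d y < key d z) (u @ (x, True) # v)" using W(2) uv(1) by simp
  have at: "profile e i (bconf d \<nu>) (pos d x) = int (length ?C)"
  proof -
    have "filter (\<lambda>z. key d z \<le> pos d x) u = u" "filter (\<lambda>z. key d z \<le> pos d x) v = []"
      using s by (auto simp: sorted_wrt_append filter_id_conv filter_empty_conv intro: less_imp_le dest!: bspec)
    then show ?thesis using uv(2) unfolding P uv(1) by simp
  qed
  show "firstmax (profile e i (bconf d \<nu>)) (pos d x)"
    unfolding firstmax_def at
  proof (intro conjI allI impI)
    fix k assume k: "k < pos d x"
    have "filter (\<lambda>z. key d z \<le> k) v = []"
      using s k by (fastforce simp: sorted_wrt_append filter_empty_conv)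
    then have "filter (\<lambda>z. key d z \<le> k) ?w = filter (\<lambda>z. key d z \<le> k) u" using k uv(1) by simp
    moreover obtain n where "n \<le> length u" "filter (\<lambda>z. key d z \<le> k) u = take n u"
      using filter_le_take[of "key d" u k] s by (auto simp: sorted_wrt_append)
    ultimately show "profile e i (bconf d \<nu>) k < int (length ?C)" unfolding P using uv(3) by simp
  next
    fix k
    show "profile e i (bconf d \<nu>) k \<le> int (length ?C)"
      unfolding P using filter_le_take[OF W(2), of k] cancelRA_prefix_le[of _ ?w] by metis
  qed
qed

text \<open>Only the existence of a good node is at stake, as uniqueness of the first maximum then
  fixes its place. A first maximum has positive height, and this height is a lower bound for the
  number of surviving letters A.\<close>

lemma firstmax_good_add:
  assumes b: "is_bipartition \<nu>" and i: "0 \<le> i" "i < int e"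
    and p: "firstmax (profile e i (bconf d \<nu>)) p"
  shows "\<exists>x. good_add e d i \<nu> = Some x \<and> pos d x = p"
proof -
  let ?w = "iword e d i \<nu>"
  let ?C = "filter snd (cancelRA ?w)"
  have t: "tame (bconf d \<nu>)" using maya_bconf[OF b] by (simp add: maya_def)
  have "0 < peak (profile e i (bconf d \<nu>))" using ex_firstmax_iff[OF profile_height[OF t]] p by blast
  then have "0 < profile e i (bconf d \<nu>) p" using peak_firstmax[OF profile_height[OF t] p] by simp
  moreover have "profile e i (bconf d \<nu>) p \<le> int (length ?C)"
    unfolding profile_prefix[OF b i]
    using filter_le_take[OF iword_props(2)[OF b i, where d = d], of p] cancelRA_prefix_le[of _ ?w] by metis
  ultimately have "?C \<noteq> []" by auto
  then obtain x where x: "good_add e d i \<nu> = Some x" by (auto simp: good_add_def Let_def)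
  then show ?thesis using firstmax_unique[OF good_add_firstmax(2)[OF b i x] p] by blast
qed

lemma crys_edge_iff:
  "crys_edge e d \<nu> i \<nu>' \<longleftrightarrow> is_bipartition \<nu> \<and> is_bipartition \<nu>' \<and> i \<in> {0..<int e} \<and>
     fedge e i (bconf d \<nu>) (bconf d \<nu>')"
proof (cases "is_bipartition \<nu> \<and> is_bipartition \<nu>' \<and> i \<in> {0..<int e}")
  case True
  then have b: "is_bipartition \<nu>" "is_bipartition \<nu>'" and i: "0 \<le> i" "i < int e" by auto
  have "(\<exists>x. good_add e d i \<nu> = Some x \<and> bnodes \<nu>' = insert x (bnodes \<nu>)) \<longleftrightarrow>
     fedge e i (bconf d \<nu>) (bconf d \<nu>')"
  proof
    assume "\<exists>x. good_add e d i \<nu> = Some x \<and> bnodes \<nu>' = insert x (bnodes \<nu>)"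
    then obtain x where x: "good_add e d i \<nu> = Some x" "bnodes \<nu>' = insert x (bnodes \<nu>)" by blast
    note g = good_add_firstmax[OF b(1) i x(1)]
    have "x \<notin> bnodes \<nu>" using g(1) unfolding baddable_iff[OF b(1)] bgrow_def by blast
    with b x have "bgrow \<nu> x \<nu>'" by (simp add: bgrow_def)
    from bgrow_conf(3)[OF this, of d] g(2) show "fedge e i (bconf d \<nu>) (bconf d \<nu>')"
      using maya_bconf[OF b(1)] unfolding fedge_def by auto
  next
    assume "fedge e i (bconf d \<nu>) (bconf d \<nu>')"
    then obtain p where p: "firstmax (profile e i (bconf d \<nu>)) p" "bconf d \<nu>' = shift (p - 2) p (bconf d \<nu>)"
      unfolding fedge_def by blast
    obtain x where x: "good_add e d i \<nu> = Some x" "pos d x = p" using firstmax_good_add[OF b(1) i p(1)] by blast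
    obtain \<nu>'' where n: "bgrow \<nu> x \<nu>''"
      using good_add_firstmax(1)[OF b(1) i x(1)] baddable_iff[OF b(1)] by blast
    then have "bconf d \<nu>'' = bconf d \<nu>'" using bgrow_conf(3) p(2) x(2) by simp
    then have "\<nu>'' = \<nu>'" using bconf_inject n b(2) unfolding bgrow_def by blast
    with n x show "\<exists>x. good_add e d i \<nu> = Some x \<and> bnodes \<nu>' = insert x (bnodes \<nu>)" unfolding bgrow_def by blast
  qed
  with True show ?thesis by (auto simp: crys_edge_def)
qed (auto simp: crys_edge_def)

text \<open>A move by two places stays within a component and amounts to adding a node, so arrows do
  not leave the configurations of bipartitions with charge \<open>d\<close>.
  \<open>fedge_to_bconf\<close> is the counterpart for incoming arrows.\<close>

lemma fedge_from_bconf: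
  assumes "is_bipartition \<nu>" "fedge e i (bconf d \<nu>) y"
  shows "\<exists>\<nu>'. is_bipartition \<nu>' \<and> y = bconf d \<nu>'"
proof -
  obtain p where p: "maya (bconf d \<nu>)" "firstmax (profile e i (bconf d \<nu>)) p" "y = shift (p - 2) p (bconf d \<nu>)"
    using fedgeE[OF assms(2)] by metis
  then obtain x \<nu>' where "bgrow \<nu> x \<nu>'" "pos d x = p"
    using ex_bgrow_up[OF assms(1)] firstmax_jump[OF p(1,2)] by blast
  then have "y = bconf d \<nu>'" "is_bipartition \<nu>'"
    using bgrow_conf(3)[of \<nu> x \<nu>' d] p(3) by (simp_all add: bgrow_def)
  then show ?thesis by blast
qed

lemma fedge_to_bconf:
  assumes "2 < e" "is_bipartition \<nu>" "fedge e i y (bconf d \<nu>)"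
  shows "\<exists>\<nu>'. is_bipartition \<nu>' \<and> y = bconf d \<nu>'"
proof -
  obtain p where p: "maya (bconf d \<nu>)" "lastmax (profile e i (bconf d \<nu>)) p" "y = shift p (p - 2) (bconf d \<nu>)"
    using fedge_backE[OF assms(1,3)] by metis
  then obtain x \<nu>' where x: "bgrow \<nu>' x \<nu>" "pos d x = p"
    using ex_bgrow_down[OF assms(2)] lastmax_jump[OF p(1,2)] by blast
  have "y = bconf d \<nu>'" unfolding p(3) bgrow_conf(3)[OF x(1), of d] x(2) by simp
  with x show ?thesis unfolding bgrow_def by blast
qed

section \<open>Cores\<close>

lemma low_beads: "u < - int (length l) \<Longrightarrow> u \<in> beads l"
proof -
  assume u: "u < - int (length l)"
  then have "nat (- u) > length l" by linarith
  with u have "u = int (part_at l (nat (- u))) - int (nat (- u))" "nat (- u) \<ge> 1"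
    by (simp_all add: part_at_def)
  then show ?thesis unfolding beads_def by blast
qed

lemma beta_iff:
  assumes "length l \<le> N"
  shows "x \<in> beta N l \<longleftrightarrow> int x - int N \<in> beads l"
proof
  assume "x \<in> beta N l"
  then obtain i where i: "x = part_at l i + N - i" "1 \<le> i" "i \<le> N" unfolding beta_def by blast
  then have "int x - int N = int (part_at l i) - int i" by simp
  with i show "int x - int N \<in> beads l" unfolding beads_def by blast
next
  assume "int x - int N \<in> beads l"
  then obtain i where i: "int x - int N = int (part_at l i) - int i" "i \<ge> 1" unfolding beads_def by blast
  have "i \<le> N"
  proof (rule ccontr)
    assume "\<not> i \<le> N"
    with assms have "part_at l i = 0" by (simp add: part_at_def)
    with i \<open>\<not> i \<le> N\<close> show False by simp
  qed
  moreover from this i have "x = part_at l i + N - i" by linarith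
  ultimately show "x \<in> beta N l" using i unfolding beta_def by blast
qed

lemma hook_removal_beads:
  assumes "hook_removal e l k"
  shows "\<exists>u. u \<in> beads l \<and> u - int e \<notin> beads l \<and> beads k = insert (u - int e) (beads l - {u})"
proof -
  obtain N x where N: "length l \<le> N" "length k \<le> N" and x: "x \<in> beta N l" "e \<le> x" "x - e \<notin> beta N l"
    "beta N k = insert (x - e) (beta N l - {x})" using assms unfolding hook_removal_def by blast
  define u where "u = int x - int N"
  have ue: "int (x - e) - int N = u - int e" using x(2) by (simp add: u_def of_nat_diff)
  have "w \<in> beads k \<longleftrightarrow> w \<in> insert (u - int e) (beads l - {u})" for w
  proof (cases "w < - int N")
    case True
    with N have "w \<in> beads k" "w \<in> beads l" using low_beads by simp_all
    with True show ?thesis by (auto simp: u_def)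
  next
    case False
    define y where "y = nat (w + int N)"
    have w: "w = int y - int N" using False by (simp add: y_def)
    have "w = u - int e \<longleftrightarrow> y = x - e" "w = u \<longleftrightarrow> y = x" using x(2) by (auto simp: w u_def)
    then show ?thesis using beta_iff[OF N(1), of y] beta_iff[OF N(2), of y] x(4) unfolding w by auto
  qed
  moreover have "u \<in> beads l" "u - int e \<notin> beads l"
    using x(1,3) beta_iff[OF N(1)] ue by (auto simp: u_def)
  ultimately show ?thesis by blast
qed

lemma hook_removal_ex:
  assumes l: "is_partition l" and u: "u \<in> beads l" "u - int e \<notin> beads l"
    and k: "is_partition k" "beads k = insert (u - int e) (beads l - {u})"
  shows "hook_removal e l k"
proof -
  define N where "N = max (length l) (length k)"
  define x where "x = nat (u + int N)"
  have N: "length l \<le> N" "length k \<le> N" by (simp_all add: N_def)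
  \<comment> \<open>All places below \<open>- N\<close> are occupied, so the gap
    \<open>u - e\<close> is visible in a beta-set of size \<open>N\<close>.\<close>
  have "\<not> u - int e < - int N" using u(2) low_beads[of "u - int e" l] N by auto
  then have x: "int x = u + int N" "e \<le> x" "int (x - e) - int N = u - int e" by (auto simp: x_def of_nat_diff)
  have "y \<in> beta N k \<longleftrightarrow> y \<in> insert (x - e) (beta N l - {x})" for y
  proof -
    have "int y - int N = u - int e \<longleftrightarrow> y = x - e" "int y - int N = u \<longleftrightarrow> y = x" using x by auto
    then show ?thesis using beta_iff[OF N(1), of y] beta_iff[OF N(2), of y] k(2) by auto
  qed
  moreover have "x \<in> beta N l" "x - e \<notin> beta N l" using x u beta_iff[OF N(1)] by simp_all
  ultimately show ?thesis unfolding hook_removal_def using l k(1) N x(2) by blast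
qed

text \<open>Iterating one-box moves realises the removal of a rim hook.\<close>

lemma ex_partition_beads:
  assumes l: "is_partition l" and u: "u \<in> beads l" "u - int n \<notin> beads l"
  shows "\<exists>k. is_partition k \<and> beads k = insert (u - int n) (beads l - {u})"
  using assms
proof (induction n arbitrary: u l rule: less_induct)
  case (less n)
  show ?case
  proof (cases "n = 0")
    case True
    with less.prems show ?thesis by simp
  next
    case n0: False
    show ?thesis
    proof (cases "u - 1 \<in> beads l")
      \<comment> \<open>The place below is free: the bead moves there and then travels the remaining
        n - 1 steps.\<close>
      case False
      obtain a b k where g: "grow k (a, b) l" "u = int b - int a"
        using ex_grow_down[OF less.prems(1,2) False] by blast
      note gb = grow_beads[OF g]
      have k: "is_partition k" using g by (simp add: grow_def)
      have bk: "beads k = insert (u - 1) (beads l - {u})" using gb by auto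
      show ?thesis
      proof (cases "n = 1")
        case True
        with k bk show ?thesis by auto
      next
        case False
        have e: "(u - 1) - int (n - 1) = u - int n" using n0 by simp
        have "u - int n \<notin> beads k" using bk less.prems(3) False n0 by auto
        then obtain k' where "is_partition k'" "beads k' = insert (u - int n) (beads k - {u - 1})"
          using less.IH[of "n - 1" k "u - 1"] n0 k bk e by auto
        moreover have "u - 1 \<notin> beads l - {u}" using \<open>u - 1 \<notin> beads l\<close> by simp
        ultimately show ?thesis using bk by auto
      qed
    next
      \<comment> \<open>The place below is occupied. Its bead travels down to \<open>u - n\<close>,
        and the bead at \<open>u\<close> then takes the vacated place; as sets this is the same as
        moving \<open>u\<close> itself.\<close>
      case True
      have n1: "n \<noteq> 1" using True less.prems(3) by auto
      have e: "(u - 1) - int (n - 1) = u - int n" using n0 by simp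
      obtain k where k: "is_partition k" "beads k = insert (u - int n) (beads l - {u - 1})"
        using less.IH[of "n - 1" l "u - 1"] less.prems True n0 e by auto
      have "u \<in> beads k" "u - 1 \<notin> beads k" using k(2) less.prems(2) n1 n0 by auto
      then obtain a b k' where g: "grow k' (a, b) k" "u = int b - int a"
        using ex_grow_down[OF k(1)] by blast
      have "beads k' = insert (u - 1) (beads k - {u})" using grow_beads[OF g] by auto
      moreover have "u \<noteq> u - int n" using n0 by simp
      ultimately have "beads k' = insert (u - int n) (beads l - {u})"
        using k(2) True by auto
      moreover have "is_partition k'" using g by (simp add: grow_def)
      ultimately show ?thesis by blast
    qed
  qed
qed

section \<open>Size of a partition and existence of cores\<close>

definition box_count :: "nat list \<Rightarrow> nat" where
  "box_count l = (\<Sum>i\<in>{1..length l}. part_at l i)"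

lemma sum_beta:
  assumes "is_partition l" "length l \<le> N"
  shows "\<Sum>(beta N l) = box_count l + (\<Sum>i\<in>{1..N}. N - i)"
proof -
  let ?f = "\<lambda>i. part_at l i + N - i"
  have "beta N l = ?f ` {1..N}" by (auto simp: beta_def)
  moreover have "inj_on ?f {1..N}"
  proof (rule inj_onI)
    fix i j assume ij: "i \<in> {1..N}" "j \<in> {1..N}" "?f i = ?f j"
    then have "int (part_at l i) - int i = int (part_at l j) - int j" by auto
    with bead_inj[OF assms(1)] ij show "i = j" by auto
  qed
  ultimately have "\<Sum>(beta N l) = sum ?f {1..N}" by (simp add: sum.reindex)
  also have "\<dots> = (\<Sum>i\<in>{1..N}. part_at l i + (N - i))" by (intro sum.cong) auto
  also have "\<dots> = (\<Sum>i\<in>{1..N}. part_at l i) + (\<Sum>i\<in>{1..N}. N - i)" by (rule sum.distrib)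
  also have "(\<Sum>i\<in>{1..N}. part_at l i) = box_count l"
    unfolding box_count_def using assms(2) by (intro sum.mono_neutral_right) (auto simp: part_at_def)
  finally show ?thesis .
qed

lemma hook_removal_less:
  assumes "hook_removal e l k" "e > 0"
  shows "box_count k < box_count l"
proof -
  obtain N x where N: "length l \<le> N" "length k \<le> N" and x: "x \<in> beta N l" "e \<le> x" "x - e \<notin> beta N l"
    "beta N k = insert (x - e) (beta N l - {x})" and p: "is_partition l" "is_partition k"
    using assms unfolding hook_removal_def by blast
  have fin: "finite (beta N l)"
  proof -
    have "beta N l = (\<lambda>i. part_at l i + N - i) ` {1..N}" by (auto simp: beta_def)
    then show ?thesis by simp
  qed
  have "\<Sum>(beta N k) = (x - e) + \<Sum>(beta N l - {x})" using x fin by simp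
  moreover have "\<Sum>(beta N l) = x + \<Sum>(beta N l - {x})" using x(1) fin by (simp add: sum.remove)
  ultimately have "\<Sum>(beta N k) < \<Sum>(beta N l)" using x(2) assms(2) by simp
  then show ?thesis using sum_beta[OF p(1) N(1)] sum_beta[OF p(2) N(2)] by simp
qed

lemma ex_core:
  assumes "e > 0"
  shows "\<exists>k. is_core e l k"
proof (induction "box_count l" arbitrary: l rule: less_induct)
  case less
  show ?case
  proof (cases "\<exists>k. hook_removal e l k")
    case True
    then obtain k where k: "hook_removal e l k" by blast
    then obtain k' where "is_core e k k'" using less hook_removal_less[OF k assms] by blast
    with k show ?thesis unfolding is_core_def by (meson converse_rtranclp_into_rtranclp)
  next
    case False
    then show ?thesis unfolding is_core_def by blast
  qed
qed

lemma core_partition: "(hook_removal e)\<^sup>*\<^sup>* l k \<Longrightarrow> is_partition l \<Longrightarrow> is_partition k"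
  by (induction rule: rtranclp_induct) (auto simp: hook_removal_def)

lemma core_closed:
  assumes "is_partition k" "\<not> (\<exists>k'. hook_removal e k k')" "u \<in> beads k"
  shows "u - int e \<in> beads k"
  using assms ex_partition_beads hook_removal_ex by metis

section \<open>Staircases and their beads\<close>

lemma part_at_stair: "i \<ge> 1 \<Longrightarrow> part_at (stair s) i = s + 1 - i"
proof -
  assume "i \<ge> 1"
  have "rev [1..<s + 1] ! (i - 1) = s + 1 - i" if "i \<le> s"
    using that \<open>i \<ge> 1\<close> by (subst rev_nth) (auto simp del: upt_Suc)
  then show ?thesis using \<open>i \<ge> 1\<close> by (auto simp: part_at_def stair_def simp del: upt_Suc)
qed

lemma is_partition_stair: "is_partition (stair s)"
  unfolding is_partition_def stair_def by (auto simp: sorted_wrt_rev simp del: upt_Suc)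

lemma beads_stair: "u \<in> beads (stair s) \<longleftrightarrow> u < - int s \<or> (u < int s \<and> odd (u + int s))"
proof
  assume "u \<in> beads (stair s)"
  then obtain i where i: "i \<ge> 1" "u = int (s + 1 - i) - int i" unfolding beads_def using part_at_stair by auto
  show "u < - int s \<or> (u < int s \<and> odd (u + int s))"
  proof (cases "i \<le> s")
    case True
    then have "u = int s + 1 - 2 * int i" using i by simp
    with i show ?thesis by simp
  next
    case False
    then have "u = - int i" using i by simp
    with False show ?thesis by simp
  qed
next
  assume r: "u < - int s \<or> (u < int s \<and> odd (u + int s))"
  show "u \<in> beads (stair s)"
  proof (cases "u < - int s")
    case True
    have "length (stair s) = s" by (simp add: stair_def del: upt_Suc)
    with True show ?thesis using low_beads by simp
  next
    case False
    with r have h: "u < int s" "odd (u + int s)" "- int s \<le> u" by auto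
    from h(2) obtain m where m: "u + int s = 2 * m + 1" by (elim oddE)
    define i where "i = nat (int s - m)"
    have "1 \<le> i" "i \<le> s" "u = int (s + 1 - i) - int i" using h m by (auto simp: i_def)
    then have "u = int (part_at (stair s) i) - int i" using part_at_stair by simp
    with \<open>1 \<le> i\<close> show ?thesis unfolding beads_def by blast
  qed
qed

text \<open>List the beads in decreasing order. Closure under subtracting 2 bounds the gaps by 2,
  and a gap of 1 is followed by gaps of 1 only. A gap of 1 means two equal consecutive parts;
  equality then persists to the end, so these parts are 0. Hence nonzero parts decrease by exactly
  1.\<close>

lemma stair_if_closed:
  assumes k: "is_partition k" and closed: "\<And>u. u \<in> beads k \<Longrightarrow> u - 2 \<in> beads k"
  shows "\<exists>s. k = stair s"
proof -
  define b where "b i = int (part_at k i) - int i" for i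
  have mem: "u \<in> beads k \<longleftrightarrow> (\<exists>i\<ge>1. u = b i)" for u unfolding beads_def b_def by blast
  have strict: "b j < b i" if "1 \<le> i" "i < j" for i j
    using bead_strict[OF k that] by (simp add: b_def)
  have next2: "b (Suc i) = b i - 1 \<or> b (Suc i) = b i - 2" if "i \<ge> 1" for i
  proof -
    have "b i - 2 \<in> beads k" using closed mem that by blast
    then obtain j where j: "j \<ge> 1" "b i - 2 = b j" using mem by blast
    have "i < j"
    proof (rule ccontr)
      assume "\<not> i < j"
      then have "j < i \<or> j = i" by auto
      with strict[OF j(1), of i] j(2) show False by auto
    qed
    then have "b j \<le> b (Suc i)" using strict[of "Suc i" j] by (cases "j = Suc i") auto
    with strict[OF that, of "Suc i"] j show ?thesis by auto
  qed
  have flat: "b (Suc (Suc i)) = b (Suc i) - 1" if "i \<ge> 1" "b (Suc i) = b i - 1" for i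
  proof (rule ccontr)
    assume "b (Suc (Suc i)) \<noteq> b (Suc i) - 1"
    then have lt: "b (Suc (Suc i)) < b i - 2" using next2[of "Suc i"] that by auto
    have "b i - 2 \<in> beads k" using closed mem that(1) by blast
    then obtain j where j: "j \<ge> 1" "b i - 2 = b j" using mem by blast
    have "Suc i < j"
    proof (rule ccontr)
      assume "\<not> Suc i < j"
      then have "j < Suc i \<or> j = Suc i" by auto
      with strict[OF j(1), of "Suc i"] j(2) that(2) show False by auto
    qed
    then have "b j \<le> b (Suc (Suc i))" using strict[of "Suc (Suc i)" j] by (cases "j = Suc (Suc i)") auto
    with lt j show False by simp
  qed
  have const: "b (i + n) = b i - int n" if "i \<ge> 1" "b (Suc i) = b i - 1" for i n
  proof -
    have "b (i + n) = b i - int n \<and> b (Suc (i + n)) = b (i + n) - 1"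
      using that flat by (induction n) auto
    then show ?thesis by blast
  qed
  have step: "part_at k i = part_at k (Suc i) + 1" if "i \<ge> 1" "part_at k i > 0" for i
  proof (rule ccontr)
    assume "part_at k i \<noteq> part_at k (Suc i) + 1"
    then have "b (Suc i) = b i - 1" using next2[OF that(1)] by (auto simp: b_def)
    \<comment> \<open>The part in row \<open>i\<close> would still occur \<open>length k\<close>
      rows further down, where all parts are 0.\<close>
    from const[OF that(1) this, of "length k"] that show False
      by (simp add: b_def part_at_def split: if_splits)
  qed
  have "part_at k (Suc n) = part_at k 1 - n" for n
  proof (induction n)
    case (Suc n)
    then show ?case
      using step[of "Suc n"] part_at_antimono[OF k, of "Suc n" "Suc (Suc n)"]
      by (cases "part_at k (Suc n) = 0") auto
  qed simp
  then have "part_at k i = part_at (stair (part_at k 1)) i" if "i \<ge> 1" for i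
    using that part_at_stair[OF that] by (metis Suc_pred' diff_Suc_Suc less_eq_Suc_le One_nat_def Suc_eq_plus1)
  then show ?thesis using partition_eqI[OF k is_partition_stair] by blast
qed

section \<open>Weights attached to residue classes of beads\<close>

definition bead_ind :: "nat list \<Rightarrow> int \<Rightarrow> int" where
  "bead_ind l u = of_bool (u \<in> beads l)"

definition drop2 :: "nat \<Rightarrow> int \<Rightarrow> nat list \<Rightarrow> int \<Rightarrow> int" where
  "drop2 e r l u = of_bool (int e dvd u - r) * (bead_ind l (u - 2) - bead_ind l u)"

definition class_weight :: "nat \<Rightarrow> int \<Rightarrow> nat list \<Rightarrow> int" where
  "class_weight e r l = sum (drop2 e r l) {u. drop2 e r l u \<noteq> 0}"

lemma class_weight_cong:
  assumes "int e dvd r - r'"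
  shows "class_weight e r l = class_weight e r' l"
proof -
  have "int e dvd u - r \<longleftrightarrow> int e dvd u - r'" for u
  proof -
    have "u - r' = (u - r) + (r - r')" by simp
    then show ?thesis using assms by (metis dvd_add_left_iff)
  qed
  then show ?thesis by (simp add: class_weight_def drop2_def)
qed

lemma finite_drop2:
  assumes "is_partition l"
  shows "finite {u. drop2 e r l u \<noteq> 0}"
proof -
  obtain M N where M: "\<And>u. u \<le> M \<Longrightarrow> u \<in> beads l" and N: "\<And>u. u \<ge> N \<Longrightarrow> u \<notin> beads l"
    using beads_cofinite[OF assms] by metis
  have "u \<in> {M..N + 2}" if "drop2 e r l u \<noteq> 0" for u
  proof (rule ccontr)
    assume "u \<notin> {M..N + 2}"
    then have "u < M \<or> u > N + 2" by auto
    then have "bead_ind l (u - 2) = bead_ind l u" using M N by (auto simp: bead_ind_def)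
    with that show False by (simp add: drop2_def)
  qed
  then have "{u. drop2 e r l u \<noteq> 0} \<subseteq> {M..N + 2}" by blast
  then show ?thesis by (rule finite_subset) simp
qed

text \<open>The old and the new place of the bead are congruent modulo e. The changes at
  \<open>v\<close> and \<open>v + 2\<close> are therefore compensated within their classes by those
  at \<open>w\<close> and \<open>w + 2\<close>.\<close>

lemma class_weight_hook:
  assumes "hook_removal e l k"
  shows "class_weight e r k = class_weight e r l"
proof -
  obtain v where v: "v \<in> beads l" "v - int e \<notin> beads l" "beads k = insert (v - int e) (beads l - {v})"
    using hook_removal_beads[OF assms] by blast
  have p: "is_partition l" "is_partition k" using assms by (simp_all add: hook_removal_def)
  define w where "w = v - int e"
  have ind: "bead_ind k u = bead_ind l u + of_bool (u = w) - of_bool (u = v)" for u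
    using v by (auto simp: bead_ind_def w_def)
  have dvds: "int e dvd w - a \<longleftrightarrow> int e dvd v - a" for a
  proof -
    have "w - a = (v - a) - int e" by (simp add: w_def)
    then show ?thesis by (metis dvd_diff_right_iff dvd_refl dvd_diff_commute)
  qed
  define A where "A = {u. drop2 e r l u \<noteq> 0} \<union> {u. drop2 e r k u \<noteq> 0} \<union> {v, w, v + 2, w + 2}"
  have finA: "finite A" using finite_drop2 p by (simp add: A_def)
  have sub: "class_weight e r l = sum (drop2 e r l) A" "class_weight e r k = sum (drop2 e r k) A"
    unfolding class_weight_def using finA by (intro sum.mono_neutral_left; auto simp: A_def)+
  let ?D = "\<lambda>a u. of_bool (u = a) * of_bool (int e dvd u - r) :: int"
  have delta: "sum (?D a) A = of_bool (int e dvd a - r)" if "a \<in> A" for a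
  proof -
    have "sum (?D a) A = (\<Sum>u\<in>A. if u = a then of_bool (int e dvd a - r) else 0)" by (intro sum.cong) auto
    with finA that show ?thesis by simp
  qed
  have "drop2 e r k u = drop2 e r l u + ?D (w + 2) u - ?D (v + 2) u - ?D w u + ?D v u" for u
    unfolding drop2_def ind by (auto simp: of_bool_def)
  then have "class_weight e r k = (\<Sum>u\<in>A. drop2 e r l u + ?D (w + 2) u - ?D (v + 2) u - ?D w u + ?D v u)"
    unfolding sub(2) by (intro sum.cong) auto
  also have "\<dots> = class_weight e r l + sum (?D (w + 2)) A - sum (?D (v + 2)) A - sum (?D w) A + sum (?D v) A"
    unfolding sub(1) by (simp only: sum.distrib sum_subtractf)
  also have "\<dots> = class_weight e r l"
    using delta[of w] delta[of v] delta[of "w + 2"] delta[of "v + 2"] dvds[of r] dvds[of "r - 2"]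
    by (simp add: A_def algebra_simps)
  finally show ?thesis .
qed

lemma class_weight_core:
  assumes "(hook_removal e)\<^sup>*\<^sup>* l k"
  shows "class_weight e r k = class_weight e r l"
  using assms by (induction rule: rtranclp_induct) (auto simp: class_weight_hook)

text \<open>If some bead \<open>u\<close> of an \<open>e\<close>-core had a gap at \<open>u - 2\<close>, then all terms of the weight of the class of
  \<open>u\<close> would be nonpositive, with a negative one at \<open>u\<close>.\<close>

lemma core_is_stair:
  assumes k: "is_partition k" and nohook: "\<not> (\<exists>k'. hook_removal e k k')"
    and pos: "\<And>r. class_weight e r k \<ge> 0"
  shows "\<exists>s. k = stair s"
proof (rule stair_if_closed[OF k], rule ccontr)
  fix u assume u: "u \<in> beads k" "u - 2 \<notin> beads k"
  have closed: "v - int e * int m \<in> beads k" if "v \<in> beads k" for v m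
  proof (induction m)
    case (Suc m)
    then have "v - int e * int m - int e \<in> beads k" using core_closed[OF k nohook] by blast
    then show ?case by (simp add: algebra_simps)
  qed (use that in simp)
  have nonpos: "drop2 e u k v \<le> 0" for v
  proof (cases "int e dvd v - u")
    case True
    then obtain m where m: "v - u = int e * m" by blast
    show ?thesis
    \<comment> \<open>At or above \<open>u\<close>, a bead at \<open>v - 2\<close> would force one
      at \<open>u - 2\<close>; below \<open>u\<close>, the place \<open>v\<close> itself carries a
      bead. In both cases the term cannot be positive.\<close>
    proof (cases "m \<ge> 0")
      case True
      have "v - 2 \<notin> beads k"
      proof
        assume "v - 2 \<in> beads k"
        from closed[OF this, of "nat m"] True m u(2) show False by (simp add: algebra_simps)
      qed
      then show ?thesis by (simp add: drop2_def bead_ind_def)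
    next
      case False
      then have "u - int e * int (nat (- m)) = v" using m by simp
      then have "v \<in> beads k" using closed[OF u(1)] by metis
      then show ?thesis by (simp add: drop2_def bead_ind_def)
    qed
  qed (simp add: drop2_def)
  have "drop2 e u k u = - 1" using u by (simp add: drop2_def bead_ind_def)
  moreover from this have "class_weight e u k =
      drop2 e u k u + sum (drop2 e u k) ({v. drop2 e u k v \<noteq> 0} - {u})"
    unfolding class_weight_def using finite_drop2[OF k] by (subst sum.remove[of _ u]) auto
  moreover have "sum (drop2 e u k) ({v. drop2 e u k v \<noteq> 0} - {u}) \<le> 0"
    using nonpos by (intro sum_nonpos) auto
  ultimately have "class_weight e u k < 0" by simp
  with pos[of u] show False by simp
qed

section \<open>Quotients and the main theorem\<close>

lemma filter_nonzero:
  assumes "sorted_wrt (\<ge>) (L :: nat list)"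
  shows "is_partition (filter (\<lambda>p. p \<noteq> 0) L)" "part_at (filter (\<lambda>p. p \<noteq> 0) L) i = part_at L i"
proof -
  show "is_partition (filter (\<lambda>p. p \<noteq> 0) L)"
    using assms by (auto simp: is_partition_def intro: sorted_wrt_filter)
  have cons: "part_at (x # l) i = (if i = 1 then x else part_at l (i - 1))" for x l i
    by (auto simp: part_at_def nth_Cons')
  show "part_at (filter (\<lambda>p. p \<noteq> 0) L) i = part_at L i"
    using assms
  proof (induction L arbitrary: i)
    case (Cons x L)
    show ?case
    proof (cases "x = 0")
      case True
      with Cons.prems have zero: "\<And>y. y \<in> set (x # L) \<Longrightarrow> y = 0" by auto
      then have "filter (\<lambda>p. p \<noteq> 0) (x # L) = []" unfolding filter_empty_conv by blast
      moreover have "(x # L) ! (i - 1) = 0" if "1 \<le> i \<and> i \<le> length (x # L)"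
        by (rule zero, rule nth_mem) (use that in auto)
      then have "part_at (x # L) i = 0"
        by (cases "1 \<le> i \<and> i \<le> length (x # L)") (simp_all only: part_at_def if_True if_False simp_thms)
      ultimately show ?thesis by (simp only: part_at_def list.size) simp
    next
      case False
      with Cons show ?thesis by (simp add: cons)
    qed
  qed simp
qed

lemma pi_beta_beads:
  assumes "finite Y"
  shows "is_partition (pi_beta Y)"
    and "c \<in> beads (pi_beta Y) \<longleftrightarrow> c < - int (card Y) \<or> (\<exists>y\<in>Y. c = int y - int (card Y))"
proof -
  define m where "m = card Y"
  define xs where "xs = rev (sorted_list_of_set Y)"
  define f where "f k = xs ! k + k + 1 - m" for k
  have len: "length xs = m" and set: "set xs = Y" using assms by (simp_all add: xs_def m_def)
  have pi: "pi_beta Y = filter (\<lambda>p. p \<noteq> 0) (map f [0..<m])"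
    unfolding pi_beta_def Let_def using len by (simp add: xs_def[symmetric] f_def[abs_def])
  have "sorted_wrt (>) xs"
    unfolding xs_def sorted_wrt_rev using strict_sorted_list_of_set[of Y] by simp
  then have desc: "xs ! j < xs ! k" if "k < j" "j < m" for j k
    using that len by (auto simp: sorted_wrt_iff_nth_less)
  \<comment> \<open>Among m distinct natural numbers, the one with k larger ones is at least m - k -
    1. So the subtraction of natural numbers in \<open>pi_beta\<close> is exact.\<close>
  have low: "m \<le> xs ! k + k + 1" if "k < m" for k
    using that
  proof (induction "m - k" arbitrary: k)
    case (Suc n)
    show ?case
    proof (cases "Suc k = m")
      case False
      then have "m \<le> xs ! Suc k + Suc k + 1"
        using Suc.hyps(1)[of "Suc k"] Suc.hyps(2) Suc.prems by simp
      then show ?thesis using desc[of k "Suc k"] Suc.prems False by linarith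
    qed simp
  qed simp
  have fint: "int (f k) - int (Suc k) = int (xs ! k) - int m" if "k < m" for k
    using low[OF that] by (simp add: f_def)
  have "f j \<le> f k" if "k < j" "j < m" for j k
  proof -
    have "xs ! j + j \<le> xs ! k + k" using that
    proof (induction j)
      case (Suc j)
      show ?case
      proof (cases "k = j")
        case True
        with desc[of j "Suc j"] Suc.prems show ?thesis by simp
      next
        case False
        with Suc desc[of j "Suc j"] show ?thesis by simp
      qed
    qed simp
    then show ?thesis by (simp add: f_def)
  qed
  then have srt: "sorted_wrt (\<ge>) (map f [0..<m])" by (simp add: sorted_wrt_iff_nth_less)
  show "is_partition (pi_beta Y)" unfolding pi by (rule filter_nonzero(1)[OF srt])
  have at: "part_at (pi_beta Y) i = (if 1 \<le> i \<and> i \<le> m then f (i - 1) else 0)" for i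
    unfolding pi filter_nonzero(2)[OF srt] by (auto simp: part_at_def)
  show "c \<in> beads (pi_beta Y) \<longleftrightarrow> c < - int (card Y) \<or> (\<exists>y\<in>Y. c = int y - int (card Y))"
    unfolding m_def[symmetric]
  proof
    assume "c \<in> beads (pi_beta Y)"
    then obtain i where i: "i \<ge> 1" "c = int (part_at (pi_beta Y) i) - int i" unfolding beads_def by blast
    show "c < - int m \<or> (\<exists>y\<in>Y. c = int y - int m)"
    proof (cases "i \<le> m")
      case True
      then have "c = int (xs ! (i - 1)) - int m" using i at fint[of "i - 1"] by simp
      moreover have "xs ! (i - 1) \<in> Y" using True i len set nth_mem[of "i - 1" xs] by auto
      ultimately show ?thesis by blast
    qed (use i at in simp)
  next
    assume "c < - int m \<or> (\<exists>y\<in>Y. c = int y - int m)"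
    then show "c \<in> beads (pi_beta Y)"
    proof
      assume c: "c < - int m"
      then have "nat (- c) > m" by linarith
      with c have "c = int (part_at (pi_beta Y) (nat (- c))) - int (nat (- c))" "nat (- c) \<ge> 1" using at by auto
      then show ?thesis unfolding beads_def by blast
    next
      assume "\<exists>y\<in>Y. c = int y - int m"
      then obtain k where k: "k < m" "c = int (xs ! k) - int m" using set len by (metis in_set_conv_nth)
      then have "c = int (part_at (pi_beta Y) (Suc k)) - int (Suc k)" using at fint by simp
      moreover have "Suc k \<ge> 1" by simp
      ultimately show ?thesis unfolding beads_def by blast
    qed
  qed
qed

text \<open>For \<open>length l \<le> N\<close> and \<open>p\<close> = 0 or 1 these are the elements
  of parity \<open>p\<close> of the beta-set of size \<open>N\<close>, halved and rounded down: the
  beta-sets of the two components of the quotient.\<close>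

definition parity_class :: "nat \<Rightarrow> nat \<Rightarrow> nat list \<Rightarrow> nat set" where
  "parity_class N p l = {y. int (2 * y + p) - int N \<in> beads l}"

lemma finite_parity_class:
  assumes "is_partition l"
  shows "finite (parity_class N p l)"
proof -
  obtain M where M: "\<And>u. u \<ge> M \<Longrightarrow> u \<notin> beads l" using beads_cofinite[OF assms] by blast
  have "y \<in> {..nat (M + int N)}" if "y \<in> parity_class N p l" for y
  proof -
    have "int (2 * y + p) - int N < M" using that M unfolding parity_class_def by (metis mem_Collect_eq not_less)
    then show ?thesis by simp
  qed
  then have "parity_class N p l \<subseteq> {..nat (M + int N)}" by blast
  then show ?thesis by (rule finite_subset) simp
qed

lemma quot2_parity_class:
  "quot2 l = (pi_beta (parity_class (2 * length l + 1) 0 l), pi_beta (parity_class (2 * length l + 1) 1 l))"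
proof -
  let ?N = "2 * length l + 1"
  have B: "x \<in> beta ?N l \<longleftrightarrow> int x - int ?N \<in> beads l" for x by (rule beta_iff) simp
  have even: "{x div 2 | x. x \<in> beta ?N l \<and> even x} = {y. 2 * y + 0 \<in> beta ?N l}"
  proof (intro equalityI subsetI)
    fix y assume "y \<in> {x div 2 | x. x \<in> beta ?N l \<and> even x}"
    then obtain x where x: "y = x div 2" "x \<in> beta ?N l" "even x" by blast
    then have "2 * y + 0 = x" by simp
    with x show "y \<in> {y. 2 * y + 0 \<in> beta ?N l}" by (simp only: mem_Collect_eq)
  next
    fix y assume y: "y \<in> {y. 2 * y + 0 \<in> beta ?N l}"
    have "y = (2 * y + 0) div 2" "even (2 * y + 0)" by simp_all
    with y show "y \<in> {x div 2 | x. x \<in> beta ?N l \<and> even x}" by blast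
  qed
  have odd: "{(x - 1) div 2 | x. x \<in> beta ?N l \<and> odd x} = {y. 2 * y + 1 \<in> beta ?N l}"
  proof (intro equalityI subsetI)
    fix y assume "y \<in> {(x - 1) div 2 | x. x \<in> beta ?N l \<and> odd x}"
    then obtain x where x: "y = (x - 1) div 2" "x \<in> beta ?N l" "odd x" by blast
    then have "2 * y + 1 = x" by simp
    with x show "y \<in> {y. 2 * y + 1 \<in> beta ?N l}" by (simp only: mem_Collect_eq)
  next
    fix y assume y: "y \<in> {y. 2 * y + 1 \<in> beta ?N l}"
    have "y = (2 * y + 1 - 1) div 2" "odd (2 * y + 1)" by simp_all
    with y show "y \<in> {(x - 1) div 2 | x. x \<in> beta ?N l \<and> odd x}" by blast
  qed
  have "{y. 2 * y + p \<in> beta ?N l} = parity_class ?N p l" for p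
    unfolding parity_class_def B[symmetric] ..
  with even odd show ?thesis unfolding quot2_def Let_def by presburger
qed

text \<open>The formula contains the size of the parity class. This is the way the 2-core enters: it
  determines these sizes.\<close>

lemma parity_class_beads:
  assumes "is_partition l" "length l \<le> N" "p \<le> 1"
  shows "c \<in> beads (pi_beta (parity_class N p l)) \<longleftrightarrow>
     2 * c + 2 * int (card (parity_class N p l)) + int p - int N \<in> beads l"
proof -
  let ?Y = "parity_class N p l"
  note fin = finite_parity_class[OF assms(1), of N p]
  show ?thesis
  proof (cases "c < - int (card ?Y)")
    case True
    then have "2 * c + 2 * int (card ?Y) + int p - int N < - int (length l)" using assms by simp
    with True show ?thesis using low_beads pi_beta_beads(2)[OF fin] by blast
  next
    case False
    define y where "y = nat (c + int (card ?Y))"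
    have y: "c = int y - int (card ?Y)" using False by (simp add: y_def)
    have "int (2 * y + p) - int N = 2 * c + 2 * int (card ?Y) + int p - int N" using y by simp
    moreover have "c \<in> beads (pi_beta ?Y) \<longleftrightarrow> y \<in> ?Y"
      unfolding pi_beta_beads(2)[OF fin] using y False by auto
    ultimately show ?thesis by (simp add: parity_class_def)
  qed
qed

text \<open>A 2-hook moves a bead within its parity class. That all places below \<open>- N\<close>
  are occupied is carried along, as it keeps the bead within the range counted by the
  classes.\<close>

lemma card_parity_class_hook:
  assumes "hook_removal 2 l k" "\<forall>u < - int N. u \<in> beads l" "p \<le> 1"
  shows "card (parity_class N p k) = card (parity_class N p l) \<and> (\<forall>u < - int N. u \<in> beads k)"
proof -
  obtain v where v: "v \<in> beads l" "v - 2 \<notin> beads l" "beads k = insert (v - 2) (beads l - {v})"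
    using hook_removal_beads[OF assms(1)] by auto
  have p: "is_partition l" using assms by (simp add: hook_removal_def)
  have low: "v - 2 \<ge> - int N" using v(2) assms(2) by (meson not_le)
  have mem: "y \<in> parity_class N p k \<longleftrightarrow>
     int (2 * y + p) - int N = v - 2 \<or> y \<in> parity_class N p l \<and> int (2 * y + p) - int N \<noteq> v" for y
    using v(3) by (auto simp: parity_class_def)
  have "card (parity_class N p k) = card (parity_class N p l)"
  proof (cases "even (v + int N - int p)")
    case True
    then obtain m where m: "v + int N - int p = 2 * m" by (elim evenE)
    define z where "z = nat (m - 1)"
    have z: "int z = m - 1" using m low assms(3) by (simp add: z_def)
    have zv: "int (2 * z + p) - int N = v - 2" "int (2 * (z + 1) + p) - int N = v" using z m by simp_all
    have "parity_class N p k = insert z (parity_class N p l - {z + 1})"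
    proof (rule set_eqI)
      fix y
      have "int (2 * y + p) - int N = v - 2 \<longleftrightarrow> y = z" "int (2 * y + p) - int N = v \<longleftrightarrow> y = z + 1"
        using zv by auto
      then show "y \<in> parity_class N p k \<longleftrightarrow> y \<in> insert z (parity_class N p l - {z + 1})" using mem[of y] by auto
    qed
    moreover have "z + 1 \<in> parity_class N p l" "z \<notin> parity_class N p l"
      by (simp_all only: parity_class_def mem_Collect_eq zv v simp_thms)
    moreover note finite_parity_class[OF p, of N p]
    ultimately show ?thesis by (metis card_Suc_Diff1 card_insert_disjoint finite_Diff Diff_iff)
  next
    case False
    then have "int (2 * y + p) - int N \<noteq> v" "int (2 * y + p) - int N \<noteq> v - 2" for y by auto presburger+
    then have "parity_class N p k = parity_class N p l" using mem by blast
    then show ?thesis by simp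
  qed
  moreover have "\<forall>u < - int N. u \<in> beads k" using v(3) low assms(2) by auto
  ultimately show ?thesis by blast
qed

lemma card_parity_class_core:
  assumes "(hook_removal 2)\<^sup>*\<^sup>* l k" "length l \<le> N" "p \<le> 1"
  shows "card (parity_class N p k) = card (parity_class N p l) \<and> (\<forall>u < - int N. u \<in> beads k)"
  using assms(1)
proof (induction rule: rtranclp_induct)
  case base
  show ?case using low_beads assms(2) by auto
next
  case (step k k')
  then show ?case using card_parity_class_hook[of k k' N p] assms(3) by simp
qed

text \<open>Beads of \<open>stair t\<close> at places of the parity of t stop below -t, those of the
  other parity continue up to t - 1.\<close>

lemma card_parity_class_stair:
  assumes low: "\<forall>u < - int N. u \<in> beads (stair t)" and "p \<le> 1"
  shows "2 * int (card (parity_class N p (stair t))) =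
    (if even (int t + int N - int p) then int N - int t - int p else int N + int t + 1 - int p)"
proof -
  have "- int t \<notin> beads (stair t)" by (simp add: beads_stair)
  then have t: "t \<le> N" using low by (metis neg_less_iff_less not_le of_nat_less_iff)
  show ?thesis
  proof (cases "even (int t + int N - int p)")
    case True
    then obtain m where m: "int t + int N - int p = 2 * m" by (elim evenE)
    have "parity_class N p (stair t) = {..<nat (m - int t)}"
    proof (rule set_eqI)
      fix y
      have X: "int (2 * y + p) - int N = 2 * int y + int t - 2 * m" using m by simp
      have "even (int (2 * y + p) - int N + int t)" unfolding X by simp
      moreover have "int (2 * y + p) - int N < - int t \<longleftrightarrow> y < nat (m - int t)" unfolding X by linarith
      ultimately show "y \<in> parity_class N p (stair t) \<longleftrightarrow> y \<in> {..<nat (m - int t)}"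
        unfolding parity_class_def mem_Collect_eq beads_stair lessThan_iff by blast
    qed
    then show ?thesis using True m t assms(2) by auto
  next
    case False
    then obtain m where m: "int t + int N - int p = 2 * m + 1" by (elim oddE)
    have "parity_class N p (stair t) = {..<nat (m + 1)}"
    proof (rule set_eqI)
      fix y
      have X: "int (2 * y + p) - int N = 2 * int y + int t - 2 * m - 1" using m by simp
      have "odd (int (2 * y + p) - int N + int t)" unfolding X by simp
      moreover have "int (2 * y + p) - int N < int t \<longleftrightarrow> y < nat (m + 1)" unfolding X by linarith
      moreover have "u < int t" if "u < - int t" for u using that by simp
      ultimately show "y \<in> parity_class N p (stair t) \<longleftrightarrow> y \<in> {..<nat (m + 1)}"
        unfolding parity_class_def mem_Collect_eq beads_stair lessThan_iff by blast
    qed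
    then show ?thesis using False m t assms(2) by auto
  qed
qed

text \<open>The bead of the quotient at \<open>\<kappa>\<close> comes from the bead of the partition at this place.\<close>

definition unfold_pos :: "nat \<Rightarrow> nat \<Rightarrow> int \<Rightarrow> int" where
  "unfold_pos e t \<kappa> = \<kappa> - int t + (if even \<kappa> then 0 else int e - 1)"

lemma quot2_bar_bconf:
  assumes "odd e" "is_partition l" "is_core 2 l (stair t)"
  shows "is_bipartition (quot2_bar t l)"
    and "bconf (int t + (1 - int e) div 2, 0) (quot2_bar t l) \<kappa> = bead_ind l (unfold_pos e t \<kappa>)"
proof -
  define N where "N = 2 * length l + 1"
  \<comment> \<open>Because of the swap in \<open>quot2_bar\<close>, the second component is always
    the class of the places having the parity of t, for even and for odd t.\<close>
  define p where "p = (if even t then 1 else 0 :: nat)"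
  have N: "length l \<le> N" "odd N" by (simp_all add: N_def)
  have fst: "fst (quot2_bar t l) = pi_beta (parity_class N (1 - p) l)"
    and snd: "snd (quot2_bar t l) = pi_beta (parity_class N p l)"
    by (simp_all add: quot2_bar_def quot2_parity_class N_def p_def)
  show "is_bipartition (quot2_bar t l)"
    unfolding is_bipartition_def fst snd using pi_beta_beads(1) finite_parity_class[OF assms(2)] by blast
  have core: "(hook_removal 2)\<^sup>*\<^sup>* l (stair t)" using assms(3) by (simp add: is_core_def)
  have p: "p \<le> 1" "1 - p \<le> 1" "int (1 - p) = 1 - int p" by (auto simp: p_def)
  have c: "2 * int (card (parity_class N p l)) = int N - int t - int p"
    "2 * int (card (parity_class N (1 - p) l)) = int N + int t + int p"
    using card_parity_class_core[OF core N(1) p(1)] card_parity_class_core[OF core N(1) p(2)]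
      card_parity_class_stair[of N t p] card_parity_class_stair[of N t "1 - p"] N(2) p
    by (auto simp: p_def split: if_splits)
  have b: "w \<in> beads (snd (quot2_bar t l)) \<longleftrightarrow> 2 * w - int t \<in> beads l"
    "w \<in> beads (fst (quot2_bar t l)) \<longleftrightarrow> 2 * w + int t + 1 \<in> beads l" for w
    using parity_class_beads[OF assms(2) N(1) p(1), of w] parity_class_beads[OF assms(2) N(1) p(2), of w]
    unfolding fst snd c p(3) by (simp_all add: algebra_simps)
  show "bconf (int t + (1 - int e) div 2, 0) (quot2_bar t l) \<kappa> = bead_ind l (unfold_pos e t \<kappa>)"
  proof (cases "even \<kappa>")
    case True
    then have "2 * (\<kappa> div 2) = \<kappa>" by simp
    with True show ?thesis by (simp add: bconf_def bead_ind_def unfold_pos_def b)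
  next
    case False
    obtain m where m: "int e = 2 * m + 1" using assms(1) by (metis even_of_nat oddE)
    \<comment> \<open>The origin of \<open>e - 1\<close> in \<open>unfold_pos\<close>: doubling
      removes the fraction in the charge of the first component, exactly since e is odd.\<close>
    have h: "2 * (\<kappa> div 2 - (int t + (1 - int e) div 2)) + int t + 1 = \<kappa> - int t + (int e - 1)"
      using False m by (auto elim!: oddE)
    have "\<kappa> div 2 - (int t + (1 - int e) div 2) \<in> beads (fst (quot2_bar t l)) \<longleftrightarrow>
        \<kappa> - int t + (int e - 1) \<in> beads l"
      by (simp only: b h)
    then show ?thesis by (simp only: bconf_def bead_ind_def unfold_pos_def False if_False fst_conv)
  qed
qed

text \<open>Verified on the beads of the staircase: with e = 2m + 1, the occupied even places are
  those below 0 and the occupied odd ones those of content less than s - m.\<close>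

lemma empty_bconf:
  assumes "odd e"
  shows "bconf (int s + (1 - int e) div 2, 0) ([], []) \<kappa> = bead_ind (stair s) (unfold_pos e s \<kappa>)"
proof -
  have empty: "w \<in> beads [] \<longleftrightarrow> w < 0" for w
    using beads_stair[of w 0] by (auto simp: stair_def)
  obtain m where m: "int e = 2 * m + 1" using assms by (metis even_of_nat oddE)
  show ?thesis
  proof (cases "even \<kappa>")
    case True
    then show ?thesis
      by (auto simp: bconf_def bead_ind_def unfold_pos_def empty beads_stair elim!: evenE)
  next
    case False
    then obtain j where j: "\<kappa> = 2 * j + 1" by (elim oddE)
    have "bead_ind (stair s) (unfold_pos e s \<kappa>) = of_bool (j + m < int s)"
      unfolding bead_ind_def unfold_pos_def beads_stair j m by auto
    moreover have "bconf (int s + (1 - int e) div 2, 0) ([], []) \<kappa> = of_bool (j + m < int s)"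
      using m by (auto simp: bconf_def empty j)
    ultimately show ?thesis by simp
  qed
qed

lemma unfold_pos_bij:
  assumes "odd e"
  shows "bij (unfold_pos e t)"
proof (rule bij_betw_byWitness[where f' = "\<lambda>u. u + int t - (if even (u + int t) then 0 else int e - 1)"])
  show "\<forall>a\<in>UNIV. unfold_pos e t a + int t - (if even (unfold_pos e t a + int t) then 0 else int e - 1) = a"
    using assms by (auto simp: unfold_pos_def)
  show "\<forall>a'\<in>UNIV. unfold_pos e t (a' + int t - (if even (a' + int t) then 0 else int e - 1)) = a'"
    using assms by (auto simp: unfold_pos_def)
qed auto

text \<open>A factor 2 does not affect divisibility by the odd number e. At odd places the 1 lost in
  \<open>\<kappa> div 2\<close> is made up for by the displacement \<open>e - 1\<close>, which
  leaves a multiple of e.\<close>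

lemma res_unfold_pos:
  assumes "odd e"
  shows "res e i \<kappa> \<longleftrightarrow> int e dvd unfold_pos e t \<kappa> - (2 * i - int t)"
proof -
  have cop: "coprime (int e) 2" using assms by simp
  have "int e dvd \<kappa> div 2 - i \<longleftrightarrow> int e dvd 2 * (\<kappa> div 2 - i)"
    by (rule coprime_dvd_mult_right_iff[OF cop, symmetric])
  also have "\<dots> \<longleftrightarrow> int e dvd unfold_pos e t \<kappa> - (2 * i - int t)"
  proof (cases "even \<kappa>")
    case True
    then show ?thesis by (auto simp: unfold_pos_def algebra_simps)
  next
    case False
    then obtain m where m: "\<kappa> = 2 * m + 1" by (elim oddE)
    have "unfold_pos e t \<kappa> - (2 * i - int t) = 2 * (\<kappa> div 2 - i) + int e"
      by (simp add: unfold_pos_def m)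
    then show ?thesis by (simp only: dvd_add_triv_right_iff)
  qed
  finally show ?thesis by (simp add: res_def)
qed

text \<open>\<open>unfold_pos\<close> commutes with subtracting 2, as this keeps the parity. So the
  terms of the two sums correspond one by one.\<close>

lemma weight_class_weight:
  assumes "odd e" "\<And>\<kappa>. x \<kappa> = bead_ind l (unfold_pos e t \<kappa>)"
  shows "weight e i x = class_weight e (2 * i - int t) l"
proof -
  let ?X = "unfold_pos e t"
  have X2: "?X (\<kappa> - 2) = ?X \<kappa> - 2" for \<kappa> by (simp add: unfold_pos_def)
  have j: "jump e i x \<kappa> = drop2 e (2 * i - int t) l (?X \<kappa>)" for \<kappa>
    unfolding jump_def drop2_def res_unfold_pos[OF assms(1), of i \<kappa> t] assms(2) X2 by simp
  note bij = unfold_pos_bij[OF assms(1), of t]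
  have "?X ` {u. jump e i x u \<noteq> 0} = {u. drop2 e (2 * i - int t) l u \<noteq> 0}"
  proof (intro equalityI subsetI)
    fix u assume "u \<in> {u. drop2 e (2 * i - int t) l u \<noteq> 0}"
    moreover obtain \<kappa> where "u = ?X \<kappa>" using bij by (metis bij_pointE)
    ultimately show "u \<in> ?X ` {u. jump e i x u \<noteq> 0}" by (simp add: j)
  qed (auto simp: j)
  then have "class_weight e (2 * i - int t) l = sum (drop2 e (2 * i - int t) l) (?X ` {u. jump e i x u \<noteq> 0})"
    by (simp add: class_weight_def)
  also have "\<dots> = sum (\<lambda>\<kappa>. drop2 e (2 * i - int t) l (?X \<kappa>)) {u. jump e i x u \<noteq> 0}"
    using bij_is_inj[OF bij] by (subst sum.reindex) (auto intro: inj_on_subset)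
  finally show ?thesis by (simp add: weight_def j)
qed

lemma fedge_cong:
  assumes "int e dvd i - j"
  shows "fedge e i = fedge e j"
proof -
  have "res e i u \<longleftrightarrow> res e j u" for u
    using res_iff[of e i u j] res_iff[of e j u i] assms adjacent_flip(3)[of e i j] by blast
  then have "profile e i = profile e j" by (simp add: profile_def jump_def fun_eq_iff)
  then show ?thesis by (intro ext) (simp only: fedge_def)
qed

text \<open>The axioms assert equalities, which hold before \<open>h\<close> by injectivity, or the
  existence of vertices joined to given ones by arrows, which lie in the image because it is closed
  under arrows in both directions.\<close>

lemma (in stembridge) pullback:
  assumes inj: "inj_on h W" and img: "h ` W \<subseteq> V"
    and up: "\<And>a i y. a \<in> W \<Longrightarrow> edge i (h a) y \<Longrightarrow> y \<in> h ` W"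
    and down: "\<And>a i y. a \<in> W \<Longrightarrow> edge i y (h a) \<Longrightarrow> y \<in> h ` W"
  shows "stembridge W I (\<lambda>i a b. a \<in> W \<and> b \<in> W \<and> edge i (h a) (h b))
    (\<lambda>i a. eps i (h a)) (\<lambda>i a. wt i (h a)) cartan"
proof -
  have hin: "h a \<in> V" if "a \<in> W" for a using img that by blast
  have up': "\<exists>b\<in>W. y = h b \<and> edge i (h a) (h b)" if "a \<in> W" "edge i (h a) y" for a i y
    using up[OF that] that by blast
  have down': "\<exists>b\<in>W. y = h b \<and> edge i (h b) (h a)" if "a \<in> W" "edge i y (h a)" for a i y
    using down[OF that] that by blast
  interpret W: crystal W I "\<lambda>i a b. a \<in> W \<and> b \<in> W \<and> edge i (h a) (h b)"
    "\<lambda>i a. eps i (h a)" "\<lambda>i a. wt i (h a)" cartan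
  proof (unfold_locales, goal_cases)
    case (1 i x y)
    then show ?case using edge_in by blast
  next
    case (2 i x y y')
    then show ?case using edge_fun inj by (metis inj_onD)
  next
    case (3 i x y x')
    then show ?case using edge_inj inj by (metis inj_onD)
  next
    case (4 x i)
    then show ?case using phi_pos[OF hin] up' by metis
  next
    case (5 x i)
    then show ?case using eps_pos[OF hin] down' by metis
  next
    case (6 i x y)
    then show ?case using eps_step by blast
  next
    case (7 i x y j)
    then show ?case using wt_step by blast
  qed
  have inc: "W.both_inc i j x y z \<longleftrightarrow> both_inc i j (h x) (h y) (h z)" for i j x y z
    by (simp add: W.both_inc_def both_inc_def)
  show ?thesis
  proof (unfold_locales, goal_cases)
    case (1 i x y j z)
    then obtain w where w: "edge j (h y) w" "edge i (h z) w"
      using square[of i "h x" "h y" j "h z"] inc by blast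
    moreover obtain b where "b \<in> W" "w = h b" using up[OF _ w(1)] 1 by blast
    ultimately show ?case using 1 by blast
  next
    case (2 i x y j z)
    then obtain y1 y2 z1 z2 w where w: "edge j (h y) y1" "edge j y1 y2" "edge i y2 w"
      "edge i (h z) z1" "edge i z1 z2" "edge j z2 w"
      using octagon[of i "h x" "h y" j "h z"] inc by blast
    obtain a1 where a1: "a1 \<in> W" "y1 = h a1" using up[OF _ w(1)] 2 by blast
    obtain a2 where a2: "a2 \<in> W" "y2 = h a2" using up[of a1 j y2] a1 w by blast
    obtain b1 where b1: "b1 \<in> W" "z1 = h b1" using up[OF _ w(4)] 2 by blast
    obtain b2 where b2: "b2 \<in> W" "z2 = h b2" using up[of b1 i z2] b1 w by blast
    obtain c where c: "c \<in> W" "w = h c" using up[of a2 i w] a2 w by blast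
    show ?case using w a1 a2 b1 b2 c 2 by blast
  next
    case (3 i x y j z w)
    then show ?case using no_square[of i "h x" "h y" j "h z" "h w"] inc by blast
  next
    case (4 i y x j z)
    then have "edge i (h y) (h x)" "edge j (h z) (h x)" "i \<noteq> j" by auto
    from below[OF this] show ?case
    proof (elim disjE exE conjE)
      fix w assume w: "edge j w (h y)" "edge i w (h z)"
      obtain b where "b \<in> W" "w = h b" using down[OF _ w(1)] 4 by blast
      with w 4 show ?case by blast
    next
      fix y1 y2 z1 z2 w
      assume w: "edge j y1 (h y)" "edge j y2 y1" "edge i w y2" "edge i z1 (h z)" "edge i z2 z1" "edge j w z2"
      obtain a1 where a1: "a1 \<in> W" "y1 = h a1" using down[OF _ w(1)] 4 by blast
      obtain a2 where a2: "a2 \<in> W" "y2 = h a2" using down[of a1 j y2] a1 w by blast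
      obtain b1 where b1: "b1 \<in> W" "z1 = h b1" using down[OF _ w(4)] 4 by blast
      obtain b2 where b2: "b2 \<in> W" "z2 = h b2" using down[of b1 i z2] b1 w by blast
      obtain c where c: "c \<in> W" "w = h c" using down[of a2 i w] a2 w by blast
      show ?case by (rule disjI2) (use w a1 a2 b1 b2 c 4 in blast)
    qed
  qed
qed

lemma crys_stembridge:
  assumes e: "2 < e"
  shows "stembridge {\<nu>. is_bipartition \<nu>} {0..<int e}
    (\<lambda>i x y. i \<in> {0..<int e} \<and> crys_edge e d x ((i + k) mod int e) y)
    (\<lambda>i x. fock_eps e (i + k) (bconf d x)) (\<lambda>i x. weight e (i + k) (bconf d x)) (affine_cartan e)"
proof -
  interpret F: stembridge "{x. maya x}" "{0..<int e}" "\<lambda>i x y. i \<in> {0..<int e} \<and> fedge e (i + k) x y"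
    "\<lambda>i. fock_eps e (i + k)" "\<lambda>i. weight e (i + k)" "affine_cartan e"
    by (rule fock_stembridge[OF e])
  have "stembridge {\<nu>. is_bipartition \<nu>} {0..<int e}
    (\<lambda>i x y. x \<in> {\<nu>. is_bipartition \<nu>} \<and> y \<in> {\<nu>. is_bipartition \<nu>} \<and>
       (i \<in> {0..<int e} \<and> fedge e (i + k) (bconf d x) (bconf d y)))
    (\<lambda>i x. fock_eps e (i + k) (bconf d x)) (\<lambda>i x. weight e (i + k) (bconf d x)) (affine_cartan e)"
  proof (rule F.pullback)
    show "inj_on (bconf d) {\<nu>. is_bipartition \<nu>}" using bconf_inject unfolding inj_on_def by blast
    show "bconf d ` {\<nu>. is_bipartition \<nu>} \<subseteq> {x. maya x}" using maya_bconf by blast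
    show "y \<in> bconf d ` {\<nu>. is_bipartition \<nu>}"
      if "a \<in> {\<nu>. is_bipartition \<nu>}" "i \<in> {0..<int e} \<and> fedge e (i + k) (bconf d a) y" for a i y
      using fedge_from_bconf[of a e "i + k" d y] that by blast
    show "y \<in> bconf d ` {\<nu>. is_bipartition \<nu>}"
      if "a \<in> {\<nu>. is_bipartition \<nu>}" "i \<in> {0..<int e} \<and> fedge e (i + k) y (bconf d a)" for a i y
      using fedge_to_bconf[OF e, of a "i + k" y d] that by blast
  qed
  \<comment> \<open>Arrows between configurations depend on the colour modulo e only, whereas
    \<open>crys_edge\<close> requires a reduced label.\<close>
  moreover have "fedge e ((i + k) mod int e) = fedge e (i + k)" for i
    by (rule fedge_cong) (metis mod_eq_dvd_iff mod_mod_trivial)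
  then have "(\<lambda>i x y. i \<in> {0..<int e} \<and> crys_edge e d x ((i + k) mod int e) y) =
    (\<lambda>i x y. x \<in> {\<nu>. is_bipartition \<nu>} \<and> y \<in> {\<nu>. is_bipartition \<nu>} \<and>
       (i \<in> {0..<int e} \<and> fedge e (i + k) (bconf d x) (bconf d y)))"
    using e by (auto simp: crys_edge_iff fun_eq_iff)
  ultimately show ?thesis by simp
qed

text \<open>Components ignore labels, so the relabelled crystal has the components of the original
  one.\<close>

lemma ex_colour_shift:
  assumes "e > 0"
  shows "(\<exists>i. crys_edge e d x i y) \<longleftrightarrow> (\<exists>i. i \<in> {0..<int e} \<and> crys_edge e d x ((i + k) mod int e) y)"
proof
  assume "\<exists>i. crys_edge e d x i y"
  then obtain i where i: "crys_edge e d x i y" by blast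
  then have "0 \<le> i" "i < int e" by (simp_all add: crys_edge_def)
  then have "((i - k) mod int e + k) mod int e = i" by (simp add: mod_simps)
  with i assms show "\<exists>i. i \<in> {0..<int e} \<and> crys_edge e d x ((i + k) mod int e) y"
    by (intro exI[of _ "(i - k) mod int e"]) auto
qed blast

text \<open>With no incoming arrow the peak does not exceed the weight, and the peak is never
  negative.\<close>

lemma highest_weight_nonneg:
  assumes e: "2 < e" and hw: "highest_weight e d \<nu>"
  shows "weight e i (bconf d \<nu>) \<ge> 0"
proof -
  have b: "is_bipartition \<nu>" using hw by (simp add: highest_weight_def)
  then have t: "tame (bconf d \<nu>)" using maya_bconf by (simp add: maya_def)
  have "\<not> (\<exists>y. fedge e i y (bconf d \<nu>))"
  proof
    assume "\<exists>y. fedge e i y (bconf d \<nu>)"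
    then obtain y where y: "fedge e i y (bconf d \<nu>)" by blast
    obtain \<nu>' where n: "is_bipartition \<nu>'" "y = bconf d \<nu>'" using fedge_to_bconf[OF e b y] by blast
    have "fedge e (i mod int e) = fedge e i" by (rule fedge_cong) (metis mod_eq_dvd_iff mod_mod_trivial)
    then have "crys_edge e d \<nu>' (i mod int e) \<nu>" using b n y e by (simp add: crys_edge_iff)
    with hw show False unfolding highest_weight_def by blast
  qed
  then have "peak (profile e i (bconf d \<nu>)) \<le> weight e i (bconf d \<nu>)"
    using fedge_iff_lastmax[OF e maya_bconf[OF b]] ex_lastmax_iff[OF profile_height[OF t]] by (meson not_le)
  then show ?thesis using peak_nonneg(1)[OF profile_height[OF t], of e i] by simp
qed

theorem theorem7p8:
  fixes e t :: nat and lam :: "nat list"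
  assumes "e > 1" and "odd e"
    and "is_partition lam"
    and "is_core 2 lam (stair t)"
    and "highest_weight e (int t + (1 - int e) div 2, 0) (quot2_bar t lam)"
  shows "\<exists>s. is_core e lam (stair s) \<and>
           (\<exists>f (k::int).
              bij_betw f (component e (int t + (1 - int e) div 2, 0) (quot2_bar t lam))
                         (component e (int s + (1 - int e) div 2, 0) ([], [])) \<and>
              (\<forall>x \<in> component e (int t + (1 - int e) div 2, 0) (quot2_bar t lam).
               \<forall>y \<in> component e (int t + (1 - int e) div 2, 0) (quot2_bar t lam).
               \<forall>i \<in> {0..<int e}.
                 crys_edge e (int t + (1 - int e) div 2, 0) x i y \<longleftrightarrow>
                 crys_edge e (int s + (1 - int e) div 2, 0) (f x) ((i + k) mod int e) (f y)))"
proof -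
  define c where "c = (int t + (1 - int e) div 2, 0 :: int)"
  define \<mu> where "\<mu> = quot2_bar t lam"
  have e: "2 < e" using assms(1,2) by (cases "e = 2") auto
  have conf: "bconf c \<mu> \<kappa> = bead_ind lam (unfold_pos e t \<kappa>)" and bip: "is_bipartition \<mu>" for \<kappa>
    using quot2_bar_bconf[OF assms(2-4)] by (simp_all add: c_def \<mu>_def)
  have hw: "highest_weight e c \<mu>" using assms(5) by (simp add: c_def \<mu>_def)
  obtain m where m: "int e = 2 * m + 1" using assms(2) by (metis even_of_nat oddE)
  have wt_lam: "weight e i (bconf c \<mu>) = class_weight e (2 * i - int t) lam" for i
    by (rule weight_class_weight[OF assms(2) conf])
  obtain core where core: "is_core e lam core" using ex_core e by (metis gr0I not_less_zero)
  have part: "is_partition core" using core core_partition assms(3) by (auto simp: is_core_def)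
  have cw: "class_weight e r core = class_weight e r lam" for r
    using class_weight_core core by (simp add: is_core_def)
  have "class_weight e r core \<ge> 0" for r
  proof -
    \<comment> \<open>With e = 2m + 1, \<open>m + 1\<close> is the inverse of 2 modulo e. So 2i - t
      is congruent to r: every class of beads belongs to some colour.\<close>
    define i where "i = (r + int t) * (m + 1)"
    have "2 * i - int t - r = (r + int t) * int e" using m by (simp add: i_def algebra_simps)
    then have "int e dvd (2 * i - int t) - r" by simp
    then have "class_weight e (2 * i - int t) lam = class_weight e r lam" by (rule class_weight_cong)
    then show ?thesis using highest_weight_nonneg[OF e hw, of i] wt_lam cw by simp
  qed
  with core obtain s where s: "core = stair s" using core_is_stair[OF part] unfolding is_core_def by blast
  define d where "d = (int s + (1 - int e) div 2, 0 :: int)"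
  \<comment> \<open>The solution of 2k = s - t modulo e, by the same inverse of 2; colour i + k for
    \<open>d\<close> then sees the class that colour i sees for \<open>c\<close>.\<close>
  define k where "k = (int s - int t) * (m + 1)"
  have wt_s: "weight e j (bconf d ([], [])) = class_weight e (2 * j - int s) (stair s)" for j
    unfolding d_def by (rule weight_class_weight[OF assms(2) empty_bconf[OF assms(2)]])
  interpret A: stembridge "{\<nu>. is_bipartition \<nu>}" "{0..<int e}"
    "\<lambda>i x y. i \<in> {0..<int e} \<and> crys_edge e c x ((i + 0) mod int e) y"
    "\<lambda>i x. fock_eps e (i + 0) (bconf c x)" "\<lambda>i x. weight e (i + 0) (bconf c x)" "affine_cartan e"
    by (rule crys_stembridge[OF e])
  interpret B: stembridge "{\<nu>. is_bipartition \<nu>}" "{0..<int e}"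
    "\<lambda>i x y. i \<in> {0..<int e} \<and> crys_edge e d x ((i + k) mod int e) y"
    "\<lambda>i x. fock_eps e (i + k) (bconf d x)" "\<lambda>i x. weight e (i + k) (bconf d x)" "affine_cartan e"
    by (rule crys_stembridge[OF e])
  interpret P: stembridge_pair "{\<nu>. is_bipartition \<nu>}" "{0..<int e}"
    "\<lambda>i x y. i \<in> {0..<int e} \<and> crys_edge e c x ((i + 0) mod int e) y"
    "\<lambda>i x. fock_eps e (i + 0) (bconf c x)" "\<lambda>i x. weight e (i + 0) (bconf c x)" "affine_cartan e"
    "{\<nu>. is_bipartition \<nu>}"
    "\<lambda>i x y. i \<in> {0..<int e} \<and> crys_edge e d x ((i + k) mod int e) y"
    "\<lambda>i x. fock_eps e (i + k) (bconf d x)" "\<lambda>i x. weight e (i + k) (bconf d x)" \<mu> "([], [])"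
  proof (unfold_locales, goal_cases)
    case 1
    show ?case using bip by simp
  next
    case 2
    show ?case by (simp add: is_bipartition_def is_partition_def)
  next
    case (3 i y)
    show ?case using hw unfolding highest_weight_def by blast
  next
    \<comment> \<open>The target of an arrow contains the added node, so the empty bipartition is
      not a target.\<close>
    case (4 i y)
    show ?case by (auto simp: crys_edge_def bnodes_def comp_of_def diag_def)
  next
    case (5 i)
    have "(2 * (i + k) - int s) - (2 * i - int t) = (int s - int t) * int e"
      using m by (simp add: k_def algebra_simps)
    then have "int e dvd (2 * (i + k) - int s) - (2 * i - int t)" by simp
    from class_weight_cong[OF this, of "stair s"]
    have "weight e (i + k) (bconf d ([], [])) = class_weight e (2 * i - int t) (stair s)"
      unfolding wt_s .
    also have "\<dots> = weight e (i + 0) (bconf c \<mu>)" unfolding wt_lam s[symmetric] cw by simp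
    finally show ?case by simp
  qed
  have "e > 0" using e by simp
  have compA: "component e c \<mu> = {y. \<exists>n. A.reach \<mu> n y}"
    using A.component_eq_reach[OF P.hw] ex_colour_shift[OF \<open>e > 0\<close>, of c _ _ 0]
    by (simp add: component_def ex_disj_distrib)
  have compB: "component e d ([], []) = {y. \<exists>n. B.reach ([], []) n y}"
    using B.component_eq_reach[OF P.hw'] ex_colour_shift[OF \<open>e > 0\<close>, of d _ _ k]
    by (simp add: component_def ex_disj_distrib)
  obtain f where f: "bij_betw f (component e c \<mu>) (component e d ([], []))"
    "\<And>x y i. x \<in> component e c \<mu> \<Longrightarrow> y \<in> component e c \<mu> \<Longrightarrow>
      (i \<in> {0..<int e} \<and> crys_edge e c x ((i + 0) mod int e) y) \<longleftrightarrow>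
      (i \<in> {0..<int e} \<and> crys_edge e d (f x) ((i + k) mod int e) (f y))"
    using P.isomorphism unfolding compA compB by blast
  have "crys_edge e c x i y \<longleftrightarrow> crys_edge e d (f x) ((i + k) mod int e) (f y)"
    if "x \<in> component e c \<mu>" "y \<in> component e c \<mu>" "i \<in> {0..<int e}" for x y i
    using f(2)[OF that(1,2), of i] that(3) by simp
  with f(1) core show ?thesis unfolding c_def d_def \<mu>_def s by blast
qed

end
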